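(* Let $p$ be a prime, let $G$ be a finite $p$-group, let $A$ and $B$ be subgroups of $G$ and let $\varphi : A\to B$ be an isomorphism. Then the HNN-extension $G^{*}=(G,t;\ t^{-1}At=B,\ \varphi)$ is residually a finite $p$-group if and only if there exists a chief series $$1=G_{0}\leqslant G_{1}\leqslant \cdots \leqslant G_{n-1}\leqslant G_{n}=G$$ of the group $G$ satisfying the following conditions: (1) $(A\cap G_{i})\varphi=B\cap G_{i}$ for all $i=0,1,\dots,n$; (2) for every $i=0,1,\dots,n-1$ and every $a\in A\cap G_{i+1}$, the elements $a\varphi$ and $a$ are congruent modulo the subgroup $G_{i}$, i.e. $(a\varphi)G_i=aG_i$.
   Context: Maps are written on the right: $a\varphi$ is the image of $a$ under $\varphi$. The HNN-extension $(G,t;\ t^{-1}At=B,\ \varphi)$ is the group generated by $G$ and a new letter $t$ subject to the relations of $G$ together with $t^{-1}at=a\varphi$ for all $a\in A$. A group is residually a finite $p$-group if for each of its non-identity elements $g$ there is a homomorphism onto a finite $p$-group whose value at $g$ is not $1$. A chief series of $G$ is a series of subgroups, each normal in $G$, which admits no non-trivial refinement by normal subgroups of $G$; for a finite $p$-group this is the same as a series of normal subgroups of $G$ all of whose factors $G_{i+1}/G_i$ have order $p$. *)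

theory Defs
  imports "HOL-Algebra.Coset" "HOL-Computational_Algebra.Primes"
begin

section \<open>Group presentations\<close>

text \<open>A letter \<open>(x, True)\<close> stands for the generator \<open>x\<close> and \<open>(x, False)\<close> for its formal inverse.
  A pair of words \<open>(u, v)\<close> in the set of relations stands for the relation \<open>u = v\<close>.\<close>

type_synonym 'x word = "('x \<times> bool) list"

definition words :: "'x set \<Rightarrow> 'x word set" where
  "words X = lists (X \<times> UNIV)"

inductive pres_eq :: "'x set \<Rightarrow> ('x word \<times> 'x word) set \<Rightarrow> 'x word \<Rightarrow> 'x word \<Rightarrow> bool"
  for X R where
  refl: "u \<in> words X \<Longrightarrow> pres_eq X R u u"
| sym: "pres_eq X R u v \<Longrightarrow> pres_eq X R v u"
| trans: "pres_eq X R u v \<Longrightarrow> pres_eq X R v w \<Longrightarrow> pres_eq X R u w"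
| append: "pres_eq X R u u' \<Longrightarrow> pres_eq X R v v' \<Longrightarrow> pres_eq X R (u @ v) (u' @ v')"
| cancel: "x \<in> X \<Longrightarrow> pres_eq X R [(x, b), (x, \<not> b)] []"
| rel: "(u, v) \<in> R \<Longrightarrow> u \<in> words X \<Longrightarrow> v \<in> words X \<Longrightarrow> pres_eq X R u v"

definition pres_class :: "'x set \<Rightarrow> ('x word \<times> 'x word) set \<Rightarrow> 'x word \<Rightarrow> 'x word set" where
  "pres_class X R u = {v. pres_eq X R u v}"

definition presented_group :: "'x set \<Rightarrow> ('x word \<times> 'x word) set \<Rightarrow> 'x word set monoid" where
  "presented_group X R =
     \<lparr>carrier = pres_class X R ` words X,
      monoid.mult = (\<lambda>U V. {w. \<exists>u\<in>U. \<exists>v\<in>V. pres_eq X R (u @ v) w}),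
      one = pres_class X R []\<rparr>"

lemma words_simps [simp]:
  "[] \<in> words X"
  "a # u \<in> words X \<longleftrightarrow> fst a \<in> X \<and> u \<in> words X"
  "u @ v \<in> words X \<longleftrightarrow> u \<in> words X \<and> v \<in> words X"
  by (cases a; auto simp: words_def)+

lemma pres_eq_words: "pres_eq X R u v \<Longrightarrow> u \<in> words X \<and> v \<in> words X"
  by (induction rule: pres_eq.induct) auto

lemma pres_class_eq_iff:
  "u \<in> words X \<Longrightarrow> pres_class X R u = pres_class X R v \<longleftrightarrow> pres_eq X R u v"
  unfolding pres_class_def by (auto intro: pres_eq.intros)

lemma presented_group_mult:
  assumes "u \<in> words X" "v \<in> words X"
  shows "pres_class X R u \<otimes>\<^bsub>presented_group X R\<^esub> pres_class X R v = pres_class X R (u @ v)"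
  using assms unfolding presented_group_def pres_class_def
  by (auto intro: pres_eq.intros)

lemma presented_group_carrier: "carrier (presented_group X R) = pres_class X R ` words X"
  and presented_group_one: "\<one>\<^bsub>presented_group X R\<^esub> = pres_class X R []"
  by (simp_all add: presented_group_def)

lemma pres_eq_inverse:
  assumes "u \<in> words X"
  shows "\<exists>v\<in>words X. pres_eq X R (v @ u) []"
  using assms
proof (induction u)
  case Nil
  show ?case by (rule bexI[of _ "[]"]) (auto intro: pres_eq.refl)
next
  case (Cons a u)
  then obtain v where v: "v \<in> words X" "pres_eq X R (v @ u) []" by auto
  obtain x b where a: "a = (x, b)" by (cases a)
  have x: "x \<in> X" and u: "u \<in> words X" using Cons.prems a by auto
  have "pres_eq X R ([(x, \<not> b), (x, b)] @ u) ([] @ u)"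
    using pres_eq.cancel[OF x, of R "\<not> b"] pres_eq.refl[OF u] by (intro pres_eq.append) auto
  then have "pres_eq X R (v @ ([(x, \<not> b), (x, b)] @ u)) (v @ ([] @ u))"
    by (rule pres_eq.append[OF pres_eq.refl[OF v(1)]])
  then have "pres_eq X R ((v @ [(x, \<not> b)]) @ a # u) []"
    using v(2) a by (auto intro: pres_eq.trans)
  then show ?case using v x by (intro bexI[of _ "v @ [(x, \<not> b)]"]) auto
qed

lemma group_presented_group: "group (presented_group X R)"
proof (rule groupI)
  fix U assume "U \<in> carrier (presented_group X R)"
  then obtain u where u: "u \<in> words X" "U = pres_class X R u"
    by (auto simp: presented_group_carrier)
  obtain v where v: "v \<in> words X" "pres_eq X R (v @ u) []"
    using pres_eq_inverse[OF u(1)] by blast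
  then show "\<exists>V\<in>carrier (presented_group X R).
      V \<otimes>\<^bsub>presented_group X R\<^esub> U = \<one>\<^bsub>presented_group X R\<^esub>"
    using u by (intro bexI[of _ "pres_class X R v"])
      (auto simp: presented_group_carrier presented_group_mult presented_group_one pres_class_eq_iff)
qed (auto simp: presented_group_carrier presented_group_mult presented_group_one)

section \<open>HNN-extensions\<close>

datatype 'a hnn_gen = Base 'a | Stable

definition hnn_gens :: "('a, 'b) monoid_scheme \<Rightarrow> 'a hnn_gen set" where
  "hnn_gens G = insert Stable (Base ` carrier G)"

text \<open>The relations of \<open>G\<close> are given by its multiplication table.\<close>

definition hnn_rels ::
  "('a, 'b) monoid_scheme \<Rightarrow> 'a set \<Rightarrow> ('a \<Rightarrow> 'a) \<Rightarrow> ('a hnn_gen word \<times> 'a hnn_gen word) set" where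
  "hnn_rels G A \<phi> =
     {([(Base g, True), (Base h, True)], [(Base (g \<otimes>\<^bsub>G\<^esub> h), True)]) | g h.
        g \<in> carrier G \<and> h \<in> carrier G} \<union>
     {([(Stable, False), (Base a, True), (Stable, True)], [(Base (\<phi> a), True)]) | a. a \<in> A}"

text \<open>The second associated subgroup is \<open>\<phi> ` A\<close>, so it is not a separate argument.\<close>

definition hnn_extension ::
  "('a, 'b) monoid_scheme \<Rightarrow> 'a set \<Rightarrow> ('a \<Rightarrow> 'a) \<Rightarrow> 'a hnn_gen word set monoid" where
  "hnn_extension G A \<phi> = presented_group (hnn_gens G) (hnn_rels G A \<phi>)"

definition hnn_base :: "('a, 'b) monoid_scheme \<Rightarrow> 'a set \<Rightarrow> ('a \<Rightarrow> 'a) \<Rightarrow> 'a \<Rightarrow> 'a hnn_gen word set"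
  where "hnn_base G A \<phi> g = pres_class (hnn_gens G) (hnn_rels G A \<phi>) [(Base g, True)]"

definition hnn_stable :: "('a, 'b) monoid_scheme \<Rightarrow> 'a set \<Rightarrow> ('a \<Rightarrow> 'a) \<Rightarrow> 'a hnn_gen word set"
  where "hnn_stable G A \<phi> = pres_class (hnn_gens G) (hnn_rels G A \<phi>) [(Stable, True)]"

lemma group_hnn_extension: "group (hnn_extension G A \<phi>)"
  unfolding hnn_extension_def by (rule group_presented_group)

lemma hnn_base_hom: "hnn_base G A \<phi> \<in> hom G (hnn_extension G A \<phi>)" if "group G"
proof -
  interpret group G by fact
  have "pres_eq (hnn_gens G) (hnn_rels G A \<phi>) [(Base (g \<otimes>\<^bsub>G\<^esub> h), True)]
      [(Base g, True), (Base h, True)]"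
    if "g \<in> carrier G" "h \<in> carrier G" for g h
    using that by (intro pres_eq.sym[OF pres_eq.rel]) (auto simp: hnn_rels_def hnn_gens_def)
  then show ?thesis
    by (auto simp: hom_def hnn_base_def hnn_extension_def presented_group_carrier
        presented_group_mult hnn_gens_def pres_class_eq_iff)
qed

lemma hnn_stable_relation:
  assumes "group G" "A \<subseteq> carrier G" "\<phi> ` A \<subseteq> carrier G" "a \<in> A"
  defines "H \<equiv> hnn_extension G A \<phi>"
  shows "inv\<^bsub>H\<^esub> hnn_stable G A \<phi> \<otimes>\<^bsub>H\<^esub> hnn_base G A \<phi> a \<otimes>\<^bsub>H\<^esub> hnn_stable G A \<phi>
    = hnn_base G A \<phi> (\<phi> a)"
proof -
  let ?X = "hnn_gens G" and ?R = "hnn_rels G A \<phi>"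
  interpret H: group H unfolding H_def by (rule group_hnn_extension)
  have X: "Stable \<in> ?X" "Base a \<in> ?X" "Base (\<phi> a) \<in> ?X"
    using assms by (auto simp: hnn_gens_def)
  have "inv\<^bsub>H\<^esub> hnn_stable G A \<phi> = pres_class ?X ?R [(Stable, False)]"
    using X pres_eq.cancel[OF X(1), of ?R False]
    by (intro H.inv_equality) (auto simp: H_def hnn_extension_def hnn_stable_def
        presented_group_carrier presented_group_mult presented_group_one pres_class_eq_iff)
  moreover have "pres_eq ?X ?R [(Stable, False), (Base a, True), (Stable, True)] [(Base (\<phi> a), True)]"
    using X assms by (intro pres_eq.rel) (auto simp: hnn_rels_def)
  ultimately show ?thesis
    using X by (simp add: H_def hnn_extension_def hnn_stable_def hnn_base_def
        presented_group_mult pres_class_eq_iff)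
qed

section \<open>Residual \<open>p\<close>-finiteness and chief series\<close>

definition finite_p_group :: "nat \<Rightarrow> ('a, 'b) monoid_scheme \<Rightarrow> bool" where
  "finite_p_group p G \<longleftrightarrow> group G \<and> finite (carrier G) \<and> (\<exists>k. order G = p ^ k)"

text \<open>The target groups live on \<open>nat\<close>; this is no restriction, since every finite group is isomorphic
  to one with carrier in \<open>nat\<close> (see \<open>residually_finite_p_groupI\<close> below).\<close>

definition residually_finite_p_group :: "nat \<Rightarrow> ('a, 'b) monoid_scheme \<Rightarrow> bool" where
  "residually_finite_p_group p G \<longleftrightarrow>
     (\<forall>g\<in>carrier G. g \<noteq> \<one>\<^bsub>G\<^esub> \<longrightarrow>
        (\<exists>(P :: nat monoid) h. finite_p_group p P \<and> h \<in> epi G P \<and> h g \<noteq> \<one>\<^bsub>P\<^esub>))"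

definition chief_series :: "('a, 'b) monoid_scheme \<Rightarrow> nat \<Rightarrow> (nat \<Rightarrow> 'a set) \<Rightarrow> bool" where
  "chief_series G n S \<longleftrightarrow>
     S 0 = {\<one>\<^bsub>G\<^esub>} \<and> S n = carrier G \<and>
     (\<forall>i\<le>n. S i \<lhd> G) \<and>
     (\<forall>i<n. S i \<subset> S (Suc i)) \<and>
     (\<forall>i<n. \<not> (\<exists>N. N \<lhd> G \<and> S i \<subset> N \<and> N \<subset> S (Suc i)))"

lemma finite_p_group_nat_copy:
  fixes P :: "('c, 'd) monoid_scheme"
  assumes "finite_p_group p P"
  shows "\<exists>(Q :: nat monoid) f. finite_p_group p Q \<and> f \<in> iso P Q"
proof -
  interpret group P using assms by (simp add: finite_p_group_def)
  have fin: "finite (carrier P)" using assms by (simp add: finite_p_group_def)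
  obtain f :: "'c \<Rightarrow> nat" where inj: "inj_on f (carrier P)"
    using finite_imp_inj_to_nat_seg[OF fin] by blast
  define Q :: "nat monoid" where
    "Q = \<lparr>carrier = f ` carrier P,
          monoid.mult = (\<lambda>x y. f (inv_into (carrier P) f x \<otimes>\<^bsub>P\<^esub> inv_into (carrier P) f y)),
          one = f \<one>\<^bsub>P\<^esub>\<rparr>"
  have f: "f \<in> iso P Q"
    unfolding iso_def hom_def bij_betw_def Q_def using inj by auto
  have "group (Q\<lparr>one := f \<one>\<^bsub>P\<^esub>\<rparr>)" by (rule iso_imp_img_group[OF f])
  then have "group Q" by (simp add: Q_def)
  moreover have "order Q = order P" using inj by (simp add: order_def Q_def card_image)
  ultimately have "finite_p_group p Q"
    using assms by (auto simp: finite_p_group_def Q_def)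
  with f show ?thesis by blast
qed

lemma residually_finite_p_groupI:
  fixes G :: "('a, 'b) monoid_scheme"
  assumes "\<And>g. g \<in> carrier G \<Longrightarrow> g \<noteq> \<one>\<^bsub>G\<^esub> \<Longrightarrow>
    \<exists>(P :: 'c monoid) h. finite_p_group p P \<and> h \<in> epi G P \<and> h g \<noteq> \<one>\<^bsub>P\<^esub>"
  shows "residually_finite_p_group p G"
  unfolding residually_finite_p_group_def
proof (intro ballI impI)
  fix g assume g: "g \<in> carrier G" "g \<noteq> \<one>\<^bsub>G\<^esub>"
  then obtain P :: "'c monoid" and h
    where P: "finite_p_group p P" "h \<in> epi G P" "h g \<noteq> \<one>\<^bsub>P\<^esub>" using assms by blast
  obtain Q :: "nat monoid" and f where Q: "finite_p_group p Q" "f \<in> iso P Q"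
    using finite_p_group_nat_copy[OF P(1)] by blast
  have grp: "group P" "group Q" using P Q by (auto simp: finite_p_group_def)
  have f: "f \<in> hom P Q" "inj_on f (carrier P)" "f ` carrier P = carrier Q"
    using Q(2) by (auto simp: iso_def bij_betw_def)
  have h: "h \<in> hom G P" "h ` carrier G = carrier P" using P(2) by (auto simp: epi_def)
  have "f \<circ> h \<in> epi G Q"
    using hom_compose[OF h(1) f(1)] f(3) h(2) by (auto simp: epi_def simp flip: image_image)
  moreover have "(f \<circ> h) g \<noteq> \<one>\<^bsub>Q\<^esub>"
  proof -
    have "f \<one>\<^bsub>P\<^esub> = \<one>\<^bsub>Q\<^esub>" by (rule hom_one[OF f(1) grp])
    moreover have "h g \<in> carrier P" using h g by auto
    ultimately show ?thesis
      using P(3) f(2) monoid.one_closed[OF group.is_monoid[OF grp(1)]]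
      by (metis comp_apply inj_on_contraD)
  qed
  ultimately show "\<exists>(P :: nat monoid) h. finite_p_group p P \<and> h \<in> epi G P \<and> h g \<noteq> \<one>\<^bsub>P\<^esub>"
    using Q(1) by blast
qed

end

theory Submission
  imports Defs "HOL-Algebra.Sylow" "HOL-Algebra.Group_Action" "HOL-Algebra.Multiplicative_Group"
    "HOL-Algebra.Elementary_Groups"
begin

text \<open>Necessity: the base group embeds in the HNN-extension, so residual \<open>p\<close>-finiteness yields a
  homomorphism onto a finite \<open>p\<close>-group \<open>P\<close> that is injective on \<open>G\<close>. A central series of \<open>P\<close> with
  cyclic factors pulls back to the required series, since conjugation by the image of \<open>t\<close> is
  trivial on central factors.

  Sufficiency: the permutations of \<open>G\<close> that respect all coset partitions \<open>G / G\<^sub>i\<close> and commute with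
  right multiplication by \<open>G\<^sub>i\<^sub>+\<^sub>1 / G\<^sub>i\<close> form a finite \<open>p\<close>-group. It contains \<open>G\<close>, acting by left
  multiplication, and, by lifting level by level, also a permutation realising the stable letter.
  Thus some homomorphism to a finite \<open>p\<close>-group \<open>P\<close> is injective on \<open>G\<close>. A reduced word containing
  \<open>t\<close> then describes a path without backtracking in a finite graph, the quotient of the
  Bass--Serre tree by the kernel, with vertex set \<open>P / G\<close> and edge set \<open>P / A\<close>. Adjoining to \<open>P\<close>
  the module \<open>\<int>/p[P]\<close> by means of the derivation with \<open>G \<mapsto> 0\<close> and \<open>t \<mapsto> 1\<^sub>A\<close>
  separates the ends of a shortest closed subpath, because its edges are distinct. After finitely
  many such steps all vertices on the path are distinct, and the word has a non-trivial image.\<close>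

section \<open>Finite \<open>p\<close>-groups\<close>

text \<open>Both directions meet in one notion, \<open>hnn_faithful\<close>: a representation of the
  extension that is injective on \<open>G\<close>. For necessity, residual
  \<open>p\<close>-finiteness speaks only of non-trivial elements of the extension, so
  \<open>G\<close> must first be known to embed. Any bijection \<open>s\<close> of \<open>G\<close>
  with \<open>s (\<phi> a \<otimes> x) = a \<otimes> s x\<close> yields this, and one exists because
  two free actions of \<open>A\<close> on the same finite set are isomorphic. Sufficiency needs such
  an \<open>s\<close> inside a finite \<open>p\<close>-group. The obstacle is that an orbit of the
  image of \<open>\<phi>\<close> may meet a coset of \<open>S (Suc i)\<close> more than once, so a
  lift prescribed at one point could contradict itself; (1), (2) and centrality rule this out. In
  the module step the derivation counts signed passages through each edge modulo \<open>p\<close>.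
  The first edge of a shortest closed subpath is passed exactly once, so its coefficient is 1 or -1,
  which is non-zero for every prime.\<close>

lemma finite_p_group_subgroup:
  assumes "prime p" "finite_p_group p G" "subgroup H G"
  shows "finite_p_group p (G\<lparr>carrier := H\<rparr>)"
proof -
  interpret group G using assms(2) by (simp add: finite_p_group_def)
  obtain k where k: "order G = p ^ k" using assms(2) by (auto simp: finite_p_group_def)
  have "card H dvd p ^ k" using lagrange[OF assms(3)] k by (metis dvd_triv_right)
  then obtain j where "card H = p ^ j" using divides_primepow_nat[OF assms(1)] by blast
  moreover have "finite H"
    using subgroup.subset[OF assms(3)] assms(2) finite_subset by (auto simp: finite_p_group_def)
  ultimately show ?thesis
    using subgroup_imp_group[OF assms(3)] by (auto simp: finite_p_group_def order_def)
qed

lemma finite_p_group_DirProd: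
  assumes "finite_p_group p G" "finite_p_group p H"
  shows "finite_p_group p (G \<times>\<times> H)"
proof -
  obtain i j where "order G = p ^ i" "order H = p ^ j" using assms by (auto simp: finite_p_group_def)
  then have "order (G \<times>\<times> H) = p ^ (i + j)"
    by (simp add: order_def card_cartesian_product power_add)
  then show ?thesis using assms DirProd_group[of G H] by (auto simp: finite_p_group_def)
qed

lemma (in normal) order_FactGroup: "order (G Mod H) * card H = order G"
  using lagrange[OF is_subgroup] by (simp add: FactGroup_def order_def)

lemma finite_p_group_FactGroup:
  assumes "prime p" "finite_p_group p G" "N \<lhd> G"
  shows "finite_p_group p (G Mod N)"
proof -
  interpret normal N G by fact
  obtain k where k: "order G = p ^ k" using assms(2) by (auto simp: finite_p_group_def)
  have "order (G Mod N) dvd p ^ k" using order_FactGroup k by (metis dvd_triv_left)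
  then obtain j where "order (G Mod N) = p ^ j" using divides_primepow_nat[OF assms(1)] by blast
  moreover have "finite (carrier (G Mod N))"
    using assms(2) by (simp add: finite_p_group_def carrier_FactGroup)
  ultimately show ?thesis
    using factorgroup_is_group by (auto simp: finite_p_group_def)
qed

text \<open>If a prime \<open>q\<close> divides the order, Sylow gives a non-trivial element of
  \<open>q\<close>-power order; that order also divides \<open>p ^ k\<close>, so
  \<open>q = p\<close>. This serves for groups whose exponent is easier to control than their
  order.\<close>

lemma finite_p_groupI_exponent:
  fixes G (structure)
  assumes "prime p" "group G" "finite (carrier G)"
    and pow: "\<And>x. x \<in> carrier G \<Longrightarrow> x [^] (p ^ k) = \<one>"
  shows "finite_p_group p G"
proof -
  interpret group G by fact
  have ord0: "order G \<noteq> 0" using assms(3) order_gt_0_iff_finite by simp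
  have "q = p" if q: "prime q" "q dvd order G" for q :: nat
  proof -
    obtain m where m: "order G = q ^ multiplicity q (order G) * m"
      using multiplicity_dvd[of q "order G"] by (auto elim: dvdE)
    obtain H where H: "subgroup H G" "card H = q ^ multiplicity q (order G)"
      using sylow_thm[OF q(1) assms(2) m assms(3)] by blast
    have "multiplicity q (order G) > 0"
      using q ord0 by (simp add: prime_multiplicity_gt_zero_iff)
    then have "card H > 1" using H(2) prime_gt_1_nat[OF q(1)] by (metis One_nat_def one_less_power)
    have "H \<noteq> {\<one>}" using \<open>card H > 1\<close> by auto
    then obtain x where x: "x \<in> H" "x \<noteq> \<one>"
      using subgroup.one_closed[OF H(1)] by blast
    interpret H: group "G\<lparr>carrier := H\<rparr>" by (rule subgroup_imp_group[OF H(1)])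
    have xG: "x \<in> carrier G" using x H(1) subgroup.mem_carrier by metis
    have "x [^]\<^bsub>G\<lparr>carrier := H\<rparr>\<^esub> card H = \<one>"
      using H.pow_order_eq_1[of x] x by (simp add: order_def)
    then have "x [^] card H = \<one>" by (simp add: nat_pow_def)
    then have "ord x dvd q ^ multiplicity q (order G)" using xG H(2) pow_eq_id by simp
    moreover have "ord x dvd p ^ k" using pow[OF xG] xG pow_eq_id by simp
    moreover have "ord x \<noteq> 1" using x(2) xG ord_eq_1 by blast
    ultimately obtain i j where ij: "ord x = q ^ i" "ord x = p ^ j" "i \<noteq> 0"
      using divides_primepow_nat[OF q(1)] divides_primepow_nat[OF assms(1)]
      by (metis power_0)
    then have "q dvd p ^ j" by (metis dvd_power not_gr_zero)
    then show "q = p" using q(1) assms(1) prime_dvd_power primes_dvd_imp_eq by blast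
  qed
  moreover obtain m where m: "order G = p ^ multiplicity p (order G) * m" "\<not> p dvd m"
    using multiplicity_decompose'[of "order G" p] ord0 assms(1)
    by (metis mult.commute not_prime_unit)
  ultimately have "m = 1"
    by (metis dvd_mult prime_factor_nat)
  then have "order G = p ^ multiplicity p (order G)" using m by simp
  then show ?thesis using assms(2,3) by (auto simp: finite_p_group_def)
qed

text \<open>All conjugacy classes have \<open>p\<close>-power size, and the class of \<open>\<one>\<close> is a singleton; as \<open>p\<close>
  divides \<open>card M\<close>, another one must be a singleton, too.\<close>

lemma normal_meets_center:
  fixes G (structure)
  assumes p: "prime p" and G: "finite_p_group p G" and M: "M \<lhd> G" "M \<noteq> {\<one>}"
  shows "\<exists>z\<in>M. z \<noteq> \<one> \<and> (\<forall>g\<in>carrier G. g \<otimes> z = z \<otimes> g)"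
proof (rule ccontr)
  assume contra: "\<not> ?thesis"
  interpret normal M G by fact
  define c where "c = (\<lambda>g. \<lambda>h \<in> carrier G. g \<otimes> h \<otimes> inv g)"
  interpret act: group_action G "carrier G" c unfolding c_def by (rule action_by_conjugation)
  have finG: "finite (carrier G)" using G by (simp add: finite_p_group_def)
  have finM: "finite M" using finG subset finite_subset by blast
  obtain k where k: "order G = p ^ k" using G by (auto simp: finite_p_group_def)
  have oneM: "\<one> \<in> M" by (rule subgroup.one_closed[OF is_subgroup])
  define Os where "Os = orbit G c ` M"
  have cl: "c g x \<in> M" if "g \<in> carrier G" "x \<in> M" for g x
    using that by (simp add: c_def inv_op_closed2)
  have sub: "C \<subseteq> M" if "C \<in> Os" for C
    using that cl by (auto simp: Os_def orbit_def)
  have "\<Union>Os = M"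
  proof
    show "\<Union>Os \<subseteq> M" using sub by blast
    show "M \<subseteq> \<Union>Os" using act.orbit_refl subset by (auto simp: Os_def)
  qed
  moreover have "pairwise disjnt Os"
    unfolding pairwise_def disjnt_def
  proof (intro ballI impI)
    fix a b assume ab: "a \<in> Os" "b \<in> Os" "a \<noteq> b"
    then have "a \<in> orbits G (carrier G) c" "b \<in> orbits G (carrier G) c"
      using subset by (auto simp: Os_def orbits_def)
    then show "a \<inter> b = {}" using act.disjoint_union ab(3) by blast
  qed
  ultimately have "card M = (\<Sum>C\<in>Os. card C)"
    using card_Union_disjoint[of Os] finite_subset[OF sub finM] by simp
  moreover have one: "orbit G c \<one> = {\<one>}"
    by (auto simp: orbit_def c_def intro!: exI[of _ \<one>])
  moreover have "finite Os" "{\<one>} \<in> Os"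
    using finM imageI[OF oneM, of "orbit G c"] one by (simp_all add: Os_def)
  ultimately have cM: "card M = 1 + (\<Sum>C\<in>Os - {{\<one>}}. card C)"
    by (simp add: sum.remove)
  have "p dvd card C" if C: "C \<in> Os - {{\<one>}}" for C
  proof -
    obtain x where x: "x \<in> M" "C = orbit G c x" using C by (auto simp: Os_def)
    have "x \<noteq> \<one>" using C x one by auto
    then obtain g where g: "g \<in> carrier G" "g \<otimes> x \<noteq> x \<otimes> g" using contra x by auto
    have xG: "x \<in> carrier G" using x subset by auto
    have ne: "c g x \<noteq> x" using g xG by (simp add: c_def) (metis inv_solve_right m_closed)
    have "card C dvd p ^ k"
      using act.orbit_stabilizer_theorem[OF xG] k x by (metis dvd_triv_left)
    then obtain j where j: "card C = p ^ j" using divides_primepow_nat[OF p] by blast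
    have "x \<in> C" "c g x \<in> C" using act.orbit_refl[OF xG] x g by (auto simp: orbit_def)
    then have "card C \<noteq> 1" using ne by (metis card_1_singletonE singletonD)
    then show ?thesis using j by (cases j) auto
  qed
  then have "p dvd (\<Sum>C\<in>Os - {{\<one>}}. card C)" by (rule dvd_sum)
  then have ndvd: "\<not> p dvd card M" using cM p by (metis dvd_add_left_iff not_prime_unit)
  have "card M dvd p ^ k" using lagrange[OF is_subgroup] k by (metis dvd_triv_right)
  then obtain j where j: "card M = p ^ j" using divides_primepow_nat[OF p] by blast
  then have "card M = 1" using ndvd by (cases j) auto
  then show False using M(2) oneM by (metis card_1_singletonE singletonD)
qed

lemma (in normal) rcos_eq_iff:
  assumes "x \<in> carrier G" "y \<in> carrier G"
  shows "H #> x = H #> y \<longleftrightarrow> x \<otimes> inv y \<in> H"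
proof
  assume "H #> x = H #> y"
  then have "H #> (x \<otimes> inv y) = H" using coset_mult_inv2[OF _ assms subset] by simp
  then show "x \<otimes> inv y \<in> H" using coset_join1[OF _ _ is_subgroup] assms by simp
next
  assume "x \<otimes> inv y \<in> H"
  then have "H #> (x \<otimes> inv y) = H" using coset_join2[OF _ is_subgroup] assms by simp
  then show "H #> x = H #> y" using coset_mult_inv1[OF _ assms subset] by simp
qed

lemma (in normal) lcos_eq_rcos: "x \<in> carrier G \<Longrightarrow> x <# H = H #> x"
  by (rule coset_eq[rule_format, symmetric])

text \<open>The image of \<open>M\<close> in \<open>G Mod N\<close> is a non-trivial normal subgroup
  of a finite \<open>p\<close>-group, so it meets the centre there.\<close>

lemma exists_central_mod:
  fixes G (structure)
  assumes p: "prime p" and G: "finite_p_group p G" and NM: "N \<lhd> G" "M \<lhd> G" "N \<subset> M"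
  shows "\<exists>z\<in>M - N. \<forall>g\<in>carrier G. N #> (g \<otimes> z) = N #> (z \<otimes> g)"
proof -
  interpret N: normal N G by fact
  interpret M: normal M G by fact
  interpret Q: group "G Mod N" by (rule N.factorgroup_is_group)
  let ?q = "\<lambda>a. N #> a"
  have hom: "?q \<in> hom G (G Mod N)" by (rule N.r_coset_hom_Mod)
  have surj: "?q ` carrier G = carrier (G Mod N)"
    by (auto simp: FactGroup_def RCOSETS_def)
  have "?q ` M \<lhd> G Mod N"
  proof -
    interpret group_hom G "G Mod N" ?q
      using hom by unfold_locales
    show ?thesis using M.surj_hom_normal_subgroup[OF _ surj] group_hom_axioms by blast
  qed
  moreover obtain m where m: "m \<in> M" "m \<notin> N" using NM(3) by blast
  have one: "\<one>\<^bsub>G Mod N\<^esub> = N" by (simp add: FactGroup_def)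
  have iff: "?q x = N \<longleftrightarrow> x \<in> N" if "x \<in> carrier G" for x
    using N.coset_join1[OF _ that N.is_subgroup] N.coset_join2[OF that N.is_subgroup] by blast
  have "?q ` M \<noteq> {\<one>\<^bsub>G Mod N\<^esub>}" using m iff M.subset one by auto
  ultimately obtain Z where Z: "Z \<in> ?q ` M" "Z \<noteq> \<one>\<^bsub>G Mod N\<^esub>"
    "\<forall>g\<in>carrier (G Mod N). g \<otimes>\<^bsub>G Mod N\<^esub> Z = Z \<otimes>\<^bsub>G Mod N\<^esub> g"
    using normal_meets_center[OF p finite_p_group_FactGroup[OF p G NM(1)]] by meson
  then obtain z where z: "z \<in> M" "Z = ?q z" by auto
  have zG: "z \<in> carrier G" using z M.subset by auto
  have "z \<notin> N" using z zG iff Z(2) one by auto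
  moreover have "?q (g \<otimes> z) = ?q (z \<otimes> g)" if g: "g \<in> carrier G" for g
    using Z(3) z(2) surj g zG hom_mult[OF hom] by (metis image_eqI)
  ultimately show ?thesis using z by blast
qed

section \<open>Representations of HNN-extensions\<close>

text \<open>The data of a homomorphism from the HNN-extension to \<open>P\<close>. The relation is
  written without inverses, so that for permutations it can be checked pointwise.\<close>

locale hnn_rep = group_hom G P f for G (structure) and P (structure) and f +
  fixes A and \<phi> and t
  assumes A_subset: "A \<subseteq> carrier G"
    and \<phi>_closed: "\<And>a. a \<in> A \<Longrightarrow> \<phi> a \<in> carrier G"
    and t_closed [simp, intro]: "t \<in> carrier P"
    and t_rel: "\<And>a. a \<in> A \<Longrightarrow> f a \<otimes>\<^bsub>P\<^esub> t = t \<otimes>\<^bsub>P\<^esub> f (\<phi> a)"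

lemma hnn_rep_compose:
  assumes "hnn_rep G P f A \<phi> t" "group Q" "h \<in> hom P Q"
  shows "hnn_rep G Q (h \<circ> f) A \<phi> (h t)"
proof -
  interpret hnn_rep G P f A \<phi> t by fact
  interpret h: group_hom P Q h
    using assms(2,3) H.is_group by (simp add: group_hom_def group_hom_axioms_def)
  show ?thesis
  proof (intro hnn_rep.intro group_hom.intro group_hom_axioms.intro hnn_rep_axioms.intro)
    show "h \<circ> f \<in> hom G Q" using Group.hom_compose[OF homh assms(3)] .
    show "(h \<circ> f) a \<otimes>\<^bsub>Q\<^esub> h t = h t \<otimes>\<^bsub>Q\<^esub> (h \<circ> f) (\<phi> a)" if "a \<in> A" for a
      using t_rel[OF that] that A_subset \<phi>_closed by (simp flip: h.hom_mult add: subset_iff)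
  qed (use A_subset \<phi>_closed assms in auto)
qed

lemma hnn_rep_extension:
  assumes "group G" "A \<subseteq> carrier G" "\<phi> ` A \<subseteq> carrier G"
  shows "hnn_rep G (hnn_extension G A \<phi>) (hnn_base G A \<phi>) A \<phi> (hnn_stable G A \<phi>)"
proof -
  let ?H = "hnn_extension G A \<phi>"
  interpret H: group ?H by (rule group_hnn_extension)
  have t: "hnn_stable G A \<phi> \<in> carrier ?H"
    by (simp add: hnn_stable_def hnn_extension_def presented_group_carrier hnn_gens_def)
  have b: "hnn_base G A \<phi> g \<in> carrier ?H" if "g \<in> carrier G" for g
    using hnn_base_hom[OF assms(1)] that by (auto simp: hom_def)
  have "hnn_base G A \<phi> a \<otimes>\<^bsub>?H\<^esub> hnn_stable G A \<phi>
      = hnn_stable G A \<phi> \<otimes>\<^bsub>?H\<^esub> hnn_base G A \<phi> (\<phi> a)" if a: "a \<in> A" for a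
    using hnn_stable_relation[OF assms a] t b[of a] b[of "\<phi> a"] a assms
    by (simp add: H.m_assoc subset_iff) (metis H.inv_solve_left' H.m_closed a image_eqI)
  then show ?thesis
    using assms t hnn_base_hom[OF assms(1)]
    by (intro hnn_rep.intro group_hom.intro group_hom_axioms.intro hnn_rep_axioms.intro) auto
qed

section \<open>Evaluation of words and the universal property of the extension\<close>

primrec letter_val :: "('a \<Rightarrow> 'c) \<Rightarrow> 'c \<Rightarrow> 'a hnn_gen \<Rightarrow> 'c" where
  "letter_val f t (Base g) = f g"
| "letter_val f t Stable = t"

primrec word_val :: "('c, 'd) monoid_scheme \<Rightarrow> ('a \<Rightarrow> 'c) \<Rightarrow> 'c \<Rightarrow> 'a hnn_gen word \<Rightarrow> 'c" where
  "word_val P f t [] = \<one>\<^bsub>P\<^esub>"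
| "word_val P f t (x # w) =
    (if snd x then letter_val f t (fst x) else inv\<^bsub>P\<^esub> letter_val f t (fst x)) \<otimes>\<^bsub>P\<^esub> word_val P f t w"

context hnn_rep
begin

lemma letter_val_closed: "x \<in> hnn_gens G \<Longrightarrow> letter_val f t x \<in> carrier P"
  by (auto simp: hnn_gens_def)

lemma word_val_closed: "w \<in> words (hnn_gens G) \<Longrightarrow> word_val P f t w \<in> carrier P"
  by (induction w) (auto simp: letter_val_closed)

lemma word_val_append:
  "v \<in> words (hnn_gens G) \<Longrightarrow> w \<in> words (hnn_gens G) \<Longrightarrow>
    word_val P f t (v @ w) = word_val P f t v \<otimes>\<^bsub>P\<^esub> word_val P f t w"
  by (induction v) (auto simp: letter_val_closed word_val_closed H.m_assoc)

lemma word_val_cong: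
  assumes "pres_eq (hnn_gens G) (hnn_rels G A \<phi>) v w"
  shows "word_val P f t v = word_val P f t w"
  using assms
proof (induction rule: pres_eq.induct)
  case (append u u' v v')
  then show ?case
    using pres_eq_words[OF append.hyps(1)] pres_eq_words[OF append.hyps(2)]
    by (simp add: word_val_append)
next
  case (cancel x b)
  then show ?case using letter_val_closed[of x] by simp
next
  case (rel u v)
  then show ?case
    using A_subset \<phi>_closed t_rel
    by (auto simp: hnn_rels_def subset_iff H.m_assoc[symmetric])
qed auto

theorem hnn_universal:
  "\<exists>h\<in>hom (hnn_extension G A \<phi>) P.
    h (hnn_stable G A \<phi>) = t \<and> (\<forall>g\<in>carrier G. h (hnn_base G A \<phi> g) = f g)"
proof -
  let ?X = "hnn_gens G" and ?R = "hnn_rels G A \<phi>"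
  \<comment> \<open>Evaluation is constant on each class by \<open>word_val_cong\<close>, so its
    image there is a singleton.\<close>
  define h where "h = (\<lambda>U. the_elem (word_val P f t ` U))"
  have h: "h (pres_class ?X ?R w) = word_val P f t w" if "w \<in> words ?X" for w
  proof -
    have "word_val P f t ` pres_class ?X ?R w = {word_val P f t w}"
    proof (intro Set.equalityI Set.subsetI)
      fix y assume "y \<in> word_val P f t ` pres_class ?X ?R w"
      then show "y \<in> {word_val P f t w}"
        using word_val_cong by (auto simp: pres_class_def)
    next
      fix y assume "y \<in> {word_val P f t w}"
      then show "y \<in> word_val P f t ` pres_class ?X ?R w"
        using pres_eq.refl[OF that, of ?R] by (auto simp: pres_class_def)
    qed
    then show ?thesis by (simp add: h_def)
  qed
  have "h \<in> hom (hnn_extension G A \<phi>) P"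
    by (auto simp: hom_def hnn_extension_def presented_group_carrier presented_group_mult
        h word_val_closed word_val_append)
  moreover have "h (hnn_stable G A \<phi>) = t"
    using h[of "[(Stable, True)]"] by (simp add: hnn_stable_def hnn_gens_def)
  moreover have "h (hnn_base G A \<phi> g) = f g" if "g \<in> carrier G" for g
    using h[of "[(Base g, True)]"] that by (simp add: hnn_base_def hnn_gens_def)
  ultimately show ?thesis by blast
qed

end

subsection \<open>Reduced words\<close>

text \<open>The list \<open>[(e1, g1), ..., (en, gn)]\<close> encodes the product of the \<open>t\<^sup>\<plusminus>\<^sup>1 gi\<close>, where
  \<open>True\<close> stands for the exponent \<open>+1\<close> and \<open>False\<close> for \<open>-1\<close>.\<close>

primrec syl_val :: "('c, 'd) monoid_scheme \<Rightarrow> ('a \<Rightarrow> 'c) \<Rightarrow> 'c \<Rightarrow> (bool \<times> 'a) list \<Rightarrow> 'c" where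
  "syl_val P f t [] = \<one>\<^bsub>P\<^esub>"
| "syl_val P f t (s # L) =
    (if fst s then t else inv\<^bsub>P\<^esub> t) \<otimes>\<^bsub>P\<^esub> f (snd s) \<otimes>\<^bsub>P\<^esub> syl_val P f t L"

text \<open>No pinch in the sense of Britton: neither \<open>t \<phi>(a) t^-1\<close> nor
  \<open>t^-1 a t\<close> with \<open>a\<close> in \<open>A\<close> occurs inside the
  product.\<close>

definition hnn_reduced :: "'a set \<Rightarrow> ('a \<Rightarrow> 'a) \<Rightarrow> (bool \<times> 'a) list \<Rightarrow> bool" where
  "hnn_reduced A \<phi> L \<longleftrightarrow> (\<forall>i. Suc i < length L \<longrightarrow> fst (L ! i) \<noteq> fst (L ! Suc i) \<longrightarrow>
     snd (L ! i) \<notin> (if fst (L ! i) then \<phi> ` A else A))"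

context hnn_rep
begin

lemma syl_val_closed: "snd ` set L \<subseteq> carrier G \<Longrightarrow> syl_val P f t L \<in> carrier P"
  by (induction L) auto

lemma syl_val_append:
  "snd ` set L \<subseteq> carrier G \<Longrightarrow> snd ` set M \<subseteq> carrier G \<Longrightarrow>
    syl_val P f t (L @ M) = syl_val P f t L \<otimes>\<^bsub>P\<^esub> syl_val P f t M"
  by (induction L) (auto simp: syl_val_closed H.m_assoc)

lemma syl_val_hom:
  assumes "group Q" "h \<in> hom P Q" "snd ` set L \<subseteq> carrier G"
  shows "syl_val Q (h \<circ> f) (h t) L = h (syl_val P f t L)"
proof -
  interpret h: group_hom P Q h
    using assms H.is_group by (simp add: group_hom_def group_hom_axioms_def)
  show ?thesis using assms(3) by (induction L) (auto simp: syl_val_closed)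
qed

lemma t_rel_inv:
  assumes "a \<in> A"
  shows "inv\<^bsub>P\<^esub> t \<otimes>\<^bsub>P\<^esub> f a = f (\<phi> a) \<otimes>\<^bsub>P\<^esub> inv\<^bsub>P\<^esub> t"
proof -
  have c: "f a \<in> carrier P" "f (\<phi> a) \<in> carrier P" using assms A_subset \<phi>_closed by auto
  have "inv\<^bsub>P\<^esub> t \<otimes>\<^bsub>P\<^esub> f a = inv\<^bsub>P\<^esub> t \<otimes>\<^bsub>P\<^esub> (f a \<otimes>\<^bsub>P\<^esub> t) \<otimes>\<^bsub>P\<^esub> inv\<^bsub>P\<^esub> t"
    using c by (simp add: H.m_assoc)
  also have "\<dots> = f (\<phi> a) \<otimes>\<^bsub>P\<^esub> inv\<^bsub>P\<^esub> t"
    unfolding t_rel[OF assms] using c by (simp flip: H.m_assoc)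
  finally show ?thesis .
qed

text \<open>A base element on the right is swallowed by the last syllable, or by the leading base
  element if there is no syllable. Needed for the element that remains when a pinch
  collapses.\<close>

lemma syl_val_absorb:
  assumes "g \<in> carrier G" "k \<in> carrier G" "snd ` set L \<subseteq> carrier G"
  shows "\<exists>g'\<in>carrier G. \<exists>L'. snd ` set L' \<subseteq> carrier G \<and> length L' = length L \<and>
    f g \<otimes>\<^bsub>P\<^esub> syl_val P f t L \<otimes>\<^bsub>P\<^esub> f k = f g' \<otimes>\<^bsub>P\<^esub> syl_val P f t L'"
proof (cases L rule: rev_cases)
  case Nil
  then show ?thesis using assms by (intro bexI[of _ "g \<otimes> k"] exI[of _ "[]"]) auto
next
  case (snoc M s)
  then show ?thesis
    using assms by (intro bexI[of _ g] exI[of _ "M @ [(fst s, snd s \<otimes> k)]"])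
      (auto simp: syl_val_append syl_val_closed H.m_assoc)
qed

text \<open>A pinch equals the image of a base element \<open>l\<close>; merged with the base part
  of the following syllable it is absorbed to the left, so two syllables disappear.\<close>

lemma syl_val_shorten:
  assumes g: "g \<in> carrier G" and L: "snd ` set L \<subseteq> carrier G" "\<not> hnn_reduced A \<phi> L"
  shows "\<exists>g'\<in>carrier G. \<exists>L'. snd ` set L' \<subseteq> carrier G \<and> length L' < length L \<and>
    f g \<otimes>\<^bsub>P\<^esub> syl_val P f t L = f g' \<otimes>\<^bsub>P\<^esub> syl_val P f t L'"
proof -
  obtain i where i: "Suc i < length L" "fst (L ! i) \<noteq> fst (L ! Suc i)"
    "snd (L ! i) \<in> (if fst (L ! i) then \<phi> ` A else A)"
    using L(2) by (auto simp: hnn_reduced_def)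
  define e k k' where "e = fst (L ! i)" and "k = snd (L ! i)" and "k' = snd (L ! Suc i)"
  define M N where "M = take i L" and "N = drop (Suc (Suc i)) L"
  have Leq: "L = M @ (e, k) # (\<not> e, k') # N"
  proof -
    have "L ! i = (e, k)" "L ! Suc i = (\<not> e, k')"
      using i(2) by (auto simp: e_def k_def k'_def prod_eq_iff)
    then show ?thesis
      using i(1) unfolding M_def N_def
      by (metis Cons_nth_drop_Suc Suc_lessD append_take_drop_id)
  qed
  have c: "k \<in> carrier G" "k' \<in> carrier G" "snd ` set M \<subseteq> carrier G" "snd ` set N \<subseteq> carrier G"
    using L(1) unfolding Leq by auto
  have "\<exists>l\<in>carrier G. (if e then t else inv\<^bsub>P\<^esub> t) \<otimes>\<^bsub>P\<^esub> f k \<otimes>\<^bsub>P\<^esub> (if \<not> e then t else inv\<^bsub>P\<^esub> t) = f l"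
  proof (cases e)
    case True
    then obtain a where a: "a \<in> A" "k = \<phi> a" using i(3) by (auto simp: e_def k_def)
    then show ?thesis
      using True A_subset \<phi>_closed t_rel[OF a(1)]
      by (intro bexI[of _ a]) (auto simp flip: t_rel simp: H.m_assoc subset_iff)
  next
    case False
    then have "k \<in> A" using i(3) by (auto simp: e_def k_def)
    then show ?thesis
      using False A_subset \<phi>_closed
      by (intro bexI[of _ "\<phi> k"]) (auto simp: t_rel_inv H.m_assoc subset_iff)
  qed
  then obtain l where l: "l \<in> carrier G"
    "(if e then t else inv\<^bsub>P\<^esub> t) \<otimes>\<^bsub>P\<^esub> f k \<otimes>\<^bsub>P\<^esub> (if \<not> e then t else inv\<^bsub>P\<^esub> t) = f l" by blast
  define E E' where "E = (if e then t else inv\<^bsub>P\<^esub> t)" and "E' = (if \<not> e then t else inv\<^bsub>P\<^esub> t)"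
  have EE: "E \<in> carrier P" "E' \<in> carrier P" by (auto simp: E_def E'_def)
  have "syl_val P f t L = syl_val P f t M \<otimes>\<^bsub>P\<^esub> (E \<otimes>\<^bsub>P\<^esub> f k \<otimes>\<^bsub>P\<^esub> E' \<otimes>\<^bsub>P\<^esub> f k') \<otimes>\<^bsub>P\<^esub> syl_val P f t N"
    unfolding Leq using c EE
    by (simp add: syl_val_append syl_val_closed H.m_assoc flip: E_def E'_def)
  also have "E \<otimes>\<^bsub>P\<^esub> f k \<otimes>\<^bsub>P\<^esub> E' \<otimes>\<^bsub>P\<^esub> f k' = f (l \<otimes> k')"
    using l c by (simp add: E_def E'_def)
  finally have "f g \<otimes>\<^bsub>P\<^esub> syl_val P f t L = f g \<otimes>\<^bsub>P\<^esub> syl_val P f t M \<otimes>\<^bsub>P\<^esub> f (l \<otimes> k') \<otimes>\<^bsub>P\<^esub> syl_val P f t N"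
    using c l g by (simp add: syl_val_closed H.m_assoc del: hom_mult)
  moreover obtain g' L' where L': "g' \<in> carrier G" "snd ` set L' \<subseteq> carrier G" "length L' = length M"
    "f g \<otimes>\<^bsub>P\<^esub> syl_val P f t M \<otimes>\<^bsub>P\<^esub> f (l \<otimes> k') = f g' \<otimes>\<^bsub>P\<^esub> syl_val P f t L'"
    using syl_val_absorb[OF g, of "l \<otimes> k'" M] l c by auto
  ultimately have "f g \<otimes>\<^bsub>P\<^esub> syl_val P f t L = f g' \<otimes>\<^bsub>P\<^esub> syl_val P f t (L' @ N)"
    using c by (simp add: syl_val_append syl_val_closed H.m_assoc)
  moreover have "length (L' @ N) < length L" unfolding Leq using L'(3) by simp
  ultimately show ?thesis using L' c by (intro bexI[of _ g'] exI[of _ "L' @ N"]) auto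
qed

lemma syl_val_reduce:
  assumes "g \<in> carrier G" "snd ` set L \<subseteq> carrier G"
  shows "\<exists>g'\<in>carrier G. \<exists>L'. snd ` set L' \<subseteq> carrier G \<and> hnn_reduced A \<phi> L' \<and>
    f g \<otimes>\<^bsub>P\<^esub> syl_val P f t L = f g' \<otimes>\<^bsub>P\<^esub> syl_val P f t L'"
  using assms
proof (induction L arbitrary: g rule: length_induct)
  case (1 L)
  then show ?case
    using syl_val_shorten[of g L] by (cases "hnn_reduced A \<phi> L") (blast, metis)
qed

end

text \<open>The extension is treated as a representation of itself: a word is first collected into
  syllables and then freed of pinches by \<open>syl_val_reduce\<close>.\<close>

lemma hnn_normal_form:
  fixes G A \<phi>
  defines "H \<equiv> hnn_extension G A \<phi>" and "b \<equiv> hnn_base G A \<phi>" and "t \<equiv> hnn_stable G A \<phi>"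
  assumes "group G" "A \<subseteq> carrier G" "\<phi> ` A \<subseteq> carrier G" and x: "x \<in> carrier H"
  shows "\<exists>g\<in>carrier G. \<exists>L. snd ` set L \<subseteq> carrier G \<and> hnn_reduced A \<phi> L \<and>
    x = b g \<otimes>\<^bsub>H\<^esub> syl_val H b t L"
proof -
  let ?X = "hnn_gens G" and ?R = "hnn_rels G A \<phi>"
  interpret hnn_rep G H b A \<phi> t
    unfolding H_def b_def t_def using assms by (intro hnn_rep_extension)
  have "\<exists>g\<in>carrier G. \<exists>L. snd ` set L \<subseteq> carrier G \<and>
      word_val H b t w = b g \<otimes>\<^bsub>H\<^esub> syl_val H b t L" if "w \<in> words ?X" for w
    using that
  proof (induction w)
    case Nil
    show ?case by (intro bexI[of _ "\<one>\<^bsub>G\<^esub>"] exI[of _ "[]"]) auto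
  next
    case (Cons a w)
    then obtain g L where gL: "g \<in> carrier G" "snd ` set L \<subseteq> carrier G"
      "word_val H b t w = b g \<otimes>\<^bsub>H\<^esub> syl_val H b t L" by auto
    show ?case
    proof (cases "fst a")
      case (Base k)
      then have k: "k \<in> carrier G" using Cons.prems by (auto simp: hnn_gens_def)
      define k' where "k' = (if snd a then k else inv\<^bsub>G\<^esub> k)"
      have "word_val H b t (a # w) = b (k' \<otimes>\<^bsub>G\<^esub> g) \<otimes>\<^bsub>H\<^esub> syl_val H b t L"
        using Base k gL by (auto simp: k'_def syl_val_closed H.m_assoc)
      moreover have "k' \<otimes>\<^bsub>G\<^esub> g \<in> carrier G" using k gL(1) by (auto simp: k'_def)
      ultimately show ?thesis using gL(2) by blast
    next
      case Stable
      then have "word_val H b t (a # w) = b \<one>\<^bsub>G\<^esub> \<otimes>\<^bsub>H\<^esub> syl_val H b t ((snd a, g) # L)"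
        using gL by (auto simp: syl_val_closed H.m_assoc)
      then show ?thesis using gL by (intro bexI[of _ "\<one>\<^bsub>G\<^esub>"] exI[of _ "(snd a, g) # L"]) auto
    qed
  qed
  moreover obtain w where w: "w \<in> words ?X" "x = pres_class ?X ?R w"
    using x by (auto simp: H_def hnn_extension_def presented_group_carrier)
  \<comment> \<open>In the tautological representation a word evaluates to its own class, which
    links an arbitrary element to a value.\<close>
  moreover have "word_val H b t w = pres_class ?X ?R w" if "w \<in> words ?X" for w
    using that
  proof (induction w)
    case Nil
    show ?case by (simp add: H_def hnn_extension_def presented_group_one)
  next
    case (Cons a w)
    obtain y e where a: "a = (y, e)" by (cases a)
    have y: "y \<in> ?X" using Cons.prems a by simp
    have l: "letter_val b t y = pres_class ?X ?R [(y, True)]"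
      by (cases y) (auto simp: b_def t_def hnn_base_def hnn_stable_def)
    have li: "inv\<^bsub>H\<^esub> letter_val b t y = pres_class ?X ?R [(y, False)]"
      unfolding l using y pres_eq.cancel[OF y, of ?R False]
      by (intro H.inv_equality)
        (auto simp: H_def hnn_extension_def presented_group_carrier presented_group_mult
          presented_group_one pres_class_eq_iff)
    have "word_val H b t (a # w) = pres_class ?X ?R [a] \<otimes>\<^bsub>H\<^esub> pres_class ?X ?R w"
      using l li a Cons by simp
    then show ?case
      using Cons.prems a y presented_group_mult[of "[a]" ?X w ?R]
      by (simp add: H_def hnn_extension_def)
  qed
  ultimately obtain g L where "g \<in> carrier G" "snd ` set L \<subseteq> carrier G"
    "x = b g \<otimes>\<^bsub>H\<^esub> syl_val H b t L" by metis
  then show ?thesis using syl_val_reduce[of g L] by metis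
qed

section \<open>Separating reduced words\<close>

text \<open>The semidirect product of the regular module \<open>\<int>/p[P]\<close>, viewed as functions from \<open>P\<close> to
  \<open>{0..<p}\<close>, with \<open>P\<close>.\<close>

definition regular_semidirect :: "nat \<Rightarrow> ('c, 'd) monoid_scheme \<Rightarrow> (('c \<Rightarrow> int) \<times> 'c) monoid" where
  "regular_semidirect p P =
     \<lparr>carrier = (carrier P \<rightarrow>\<^sub>E {0..<int p}) \<times> carrier P,
      monoid.mult = (\<lambda>u v. (\<lambda>z\<in>carrier P. (fst u z + fst v (inv\<^bsub>P\<^esub> snd u \<otimes>\<^bsub>P\<^esub> z)) mod int p,
        snd u \<otimes>\<^bsub>P\<^esub> snd v)),
      one = (\<lambda>z\<in>carrier P. 0, \<one>\<^bsub>P\<^esub>)\<rparr>"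

lemma group_regular_semidirect:
  fixes P (structure)
  assumes "group P" "p > 0"
  shows "group (regular_semidirect p P)"
proof -
  interpret group P by fact
  have closed: "(\<lambda>z\<in>carrier P. F z mod int p) \<in> carrier P \<rightarrow>\<^sub>E {0..<int p}" for F
    using assms(2) by auto
  show ?thesis
  proof (rule groupI)
    fix x y z
    assume "x \<in> carrier (regular_semidirect p P)" "y \<in> carrier (regular_semidirect p P)"
      "z \<in> carrier (regular_semidirect p P)"
    then have c: "snd x \<in> carrier P" "snd y \<in> carrier P" "snd z \<in> carrier P"
      by (auto simp: regular_semidirect_def)
    have "((fst x w + fst y (inv snd x \<otimes> w)) mod int p + fst z (inv (snd x \<otimes> snd y) \<otimes> w)) mod int p
        = (fst x w + (fst y (inv snd x \<otimes> w) + fst z (inv snd y \<otimes> (inv snd x \<otimes> w))) mod int p) mod int p"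
      if "w \<in> carrier P" for w
      using c that by (simp add: m_assoc inv_mult_group mod_add_left_eq mod_add_right_eq add.assoc)
    with c show "x \<otimes>\<^bsub>regular_semidirect p P\<^esub> y \<otimes>\<^bsub>regular_semidirect p P\<^esub> z
        = x \<otimes>\<^bsub>regular_semidirect p P\<^esub> (y \<otimes>\<^bsub>regular_semidirect p P\<^esub> z)"
      by (simp add: regular_semidirect_def m_assoc cong: restrict_cong)
  next
    fix x assume x: "x \<in> carrier (regular_semidirect p P)"
    then have "fst x z mod int p = fst x z" if "z \<in> carrier P" for z
      using x that by (auto simp: regular_semidirect_def PiE_iff)
    with x show "\<one>\<^bsub>regular_semidirect p P\<^esub> \<otimes>\<^bsub>regular_semidirect p P\<^esub> x = x"
      by (auto simp: regular_semidirect_def prod_eq_iff PiE_def intro!: extensionalityI[where A = "carrier P"])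
    show "\<exists>y\<in>carrier (regular_semidirect p P).
        y \<otimes>\<^bsub>regular_semidirect p P\<^esub> x = \<one>\<^bsub>regular_semidirect p P\<^esub>"
    proof (rule bexI)
      let ?y = "(\<lambda>z\<in>carrier P. (- fst x (snd x \<otimes> z)) mod int p, inv snd x)"
      show "?y \<otimes>\<^bsub>regular_semidirect p P\<^esub> x = \<one>\<^bsub>regular_semidirect p P\<^esub>"
        using x by (auto simp: regular_semidirect_def mod_simps intro!: restrict_ext)
      show "?y \<in> carrier (regular_semidirect p P)"
        using x closed by (auto simp: regular_semidirect_def)
    qed
  qed (use closed assms(2) in \<open>auto simp: regular_semidirect_def\<close>)
qed

lemma finite_p_group_regular_semidirect:
  assumes "prime p" "finite_p_group p P"
  shows "finite_p_group p (regular_semidirect p P)"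
proof -
  have P: "group P" "finite (carrier P)" using assms(2) by (auto simp: finite_p_group_def)
  obtain k where k: "card (carrier P) = p ^ k"
    using assms(2) by (auto simp: finite_p_group_def order_def)
  have "finite (carrier (regular_semidirect p P))"
    using P by (simp add: regular_semidirect_def finite_PiE)
  moreover have "order (regular_semidirect p P) = p ^ (p ^ k + k)"
    using P k by (simp add: order_def regular_semidirect_def card_cartesian_product card_PiE power_add)
  ultimately show ?thesis
    using group_regular_semidirect[OF P(1)] prime_gt_0_nat[OF assms(1)]
    by (auto simp: finite_p_group_def)
qed

text \<open>Injectivity on the base makes the kernel on the extension act freely on the Bass--Serre
  tree; this is what keeps reduced words free of backtracking in the quotient graph.\<close>

locale hnn_faithful = hnn_rep +
  assumes subgroup_A: "subgroup A G"
    and inj_f: "inj_on f (carrier G)"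
begin

text \<open>Two prefixes of a word collide if they lead to the same vertex \<open>u f(G)\<close> of the quotient of the
  Bass--Serre tree by the kernel of the representation.\<close>

definition collide :: "(bool \<times> 'a) list \<Rightarrow> nat \<Rightarrow> nat \<Rightarrow> bool" where
  "collide L i j \<longleftrightarrow>
    (\<exists>g\<in>carrier G. syl_val P f t (take j L) = syl_val P f t (take i L) \<otimes>\<^bsub>P\<^esub> f g)"

lemma collide_sym:
  assumes "snd ` set L \<subseteq> carrier G" "collide L i j"
  shows "collide L j i"
proof -
  obtain g where g: "g \<in> carrier G"
    "syl_val P f t (take j L) = syl_val P f t (take i L) \<otimes>\<^bsub>P\<^esub> f g"
    using assms(2) by (auto simp: collide_def)
  have "snd ` set (take i L) \<subseteq> carrier G" using assms(1) set_take_subset by fastforce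
  then have "syl_val P f t (take i L) = syl_val P f t (take j L) \<otimes>\<^bsub>P\<^esub> f (inv\<^bsub>G\<^esub> g)"
    using g by (simp add: syl_val_closed H.m_assoc)
  then show ?thesis using g(1) unfolding collide_def by blast
qed

text \<open>\<open>hnn_rep\<close> does not postulate that \<phi> is multiplicative. It follows from
  faithfulness, since \<open>f (\<phi> a)\<close> is the conjugate of \<open>f a\<close> by
  \<open>t\<close>.\<close>

lemma \<phi>_inv:
  assumes "a \<in> A"
  shows "\<phi> (inv\<^bsub>G\<^esub> a) = inv\<^bsub>G\<^esub> \<phi> a"
proof -
  have ia: "inv\<^bsub>G\<^esub> a \<in> A" using assms subgroup_A by (simp add: subgroup.m_inv_closed)
  have c: "a \<in> carrier G" "\<phi> a \<in> carrier G" "\<phi> (inv\<^bsub>G\<^esub> a) \<in> carrier G"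
    using assms ia A_subset \<phi>_closed by auto
  have "t \<otimes>\<^bsub>P\<^esub> (f (\<phi> a) \<otimes>\<^bsub>P\<^esub> f (\<phi> (inv\<^bsub>G\<^esub> a))) = f a \<otimes>\<^bsub>P\<^esub> f (inv\<^bsub>G\<^esub> a) \<otimes>\<^bsub>P\<^esub> t"
    using c t_rel[OF assms] t_rel[OF ia]
    by (metis H.m_assoc G.inv_closed hom_closed t_closed)
  also have "\<dots> = t" using c by simp
  finally have "f (\<phi> a \<otimes>\<^bsub>G\<^esub> \<phi> (inv\<^bsub>G\<^esub> a)) = f \<one>\<^bsub>G\<^esub>"
    using c by (metis G.m_closed H.l_cancel_one H.r_cancel_one' hom_closed hom_mult hom_one t_closed)
  then have "\<phi> a \<otimes>\<^bsub>G\<^esub> \<phi> (inv\<^bsub>G\<^esub> a) = \<one>\<^bsub>G\<^esub>"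
    by (rule inj_onD[OF inj_f]) (use c in auto)
  then show ?thesis using c by (metis G.inv_equality G.inv_comm)
qed

text \<open>The first component of the value of a prefix records how often each edge coset has been
  passed, with sign, modulo \<open>p\<close>. Right multiplication by \<open>F g\<close> leaves it
  unchanged, so a collision of \<open>i\<close> and \<open>j\<close> would force equal records. The
  edge of step \<open>i\<close> is not passed again before \<open>j\<close>, and its coefficient
  therefore changes by 1 or -1.\<close>

lemma separate_collision:
  assumes p: "prime p" "finite_p_group p P"
    and L: "snd ` set L \<subseteq> carrier G" "hnn_reduced A \<phi> L"
    and ij: "i < j" "j \<le> length L"
    and minimal: "\<And>i' j'. i' < j' \<Longrightarrow> j' \<le> length L \<Longrightarrow> j' - i' < j - i \<Longrightarrow> \<not> collide L i' j'"
  defines "W \<equiv> regular_semidirect p P"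
    and "F \<equiv> \<lambda>g. (\<lambda>z\<in>carrier P. 0, f g)"
    and "T \<equiv> (\<lambda>z\<in>carrier P. if z \<in> f ` A then 1 else 0, t)"
  shows "hnn_faithful G W F A \<phi> T" and "snd \<in> hom W P"
    and "\<not> hnn_faithful.collide G W F T L i j"
proof -
  have p1: "p > 1" using prime_gt_1_nat[OF p(1)] .
  interpret W: group W unfolding W_def using group_regular_semidirect[OF H.is_group] p1 by simp
  have carr: "carrier W = (carrier P \<rightarrow>\<^sub>E {0..<int p}) \<times> carrier P" by (simp add: W_def regular_semidirect_def)
  have subA: "subgroup (f ` A) P" using subgroup_A by (rule subgroup_img_is_subgroup)
  \<comment> \<open>Left translation by \<open>f a\<close> with \<open>a\<close> in \<open>A\<close>
    fixes the indicator of the image of \<open>A\<close>. On first components this is the relation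
    required of \<open>T\<close>, and the reason why \<open>T\<close> carries this
    indicator.\<close>
  have invA: "f (inv\<^bsub>G\<^esub> a) \<otimes>\<^bsub>P\<^esub> z \<in> f ` A \<longleftrightarrow> z \<in> f ` A" if "a \<in> A" "z \<in> carrier P" for a z
  proof -
    have aG: "a \<in> carrier G" using that A_subset by auto
    have fa: "f a \<in> f ` A" "f (inv\<^bsub>G\<^esub> a) \<in> f ` A"
      using that subgroup.m_inv_closed[OF subgroup_A] by auto
    have "z = f a \<otimes>\<^bsub>P\<^esub> (f (inv\<^bsub>G\<^esub> a) \<otimes>\<^bsub>P\<^esub> z)"
      using that aG by (simp add: H.m_assoc[symmetric])
    then show ?thesis using fa subgroup.m_closed[OF subA] by metis
  qed
  have F: "F \<in> hom G W"
    using p1 by (auto simp: hom_def carr F_def) (auto simp: W_def regular_semidirect_def)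
  have T: "T \<in> carrier W" using p1 by (auto simp: carr T_def)
  show faith: "hnn_faithful G W F A \<phi> T"
  proof (intro hnn_faithful.intro hnn_rep.intro group_hom.intro group_hom_axioms.intro
      hnn_rep_axioms.intro hnn_faithful_axioms.intro)
    show "inj_on F (carrier G)" using inj_f by (auto simp: inj_on_def F_def)
    show "F a \<otimes>\<^bsub>W\<^esub> T = T \<otimes>\<^bsub>W\<^esub> F (\<phi> a)" if "a \<in> A" for a
      using that t_rel[OF that] A_subset invA[OF that] p1
      by (auto simp: W_def regular_semidirect_def F_def T_def subset_iff intro!: restrict_ext)
  qed (use F T A_subset \<phi>_closed subgroup_A W.is_group in auto)
  show homsnd: "snd \<in> hom W P" by (auto simp: hom_def W_def regular_semidirect_def)
  interpret W: hnn_faithful G W F A \<phi> T by (rule faith)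
  define u where "u = (\<lambda>k. syl_val P f t (take k L))"
  define v where "v = (\<lambda>k. syl_val W F T (take k L))"
  define e g where "e = (\<lambda>k. fst (L ! k))" and "g = (\<lambda>k. snd (L ! k))"
  have tk: "snd ` set (take k L) \<subseteq> carrier G" for k using L(1) set_take_subset by fastforce
  have gc: "g k \<in> carrier G" if "k < length L" for k using L(1) that by (auto simp: g_def)
  have uc: "u k \<in> carrier P" for k unfolding u_def by (rule syl_val_closed[OF tk])
  have take_Suc: "take (Suc k) L = take k L @ [L ! k]" if "k < length L" for k
    using that by (simp add: take_Suc_conv_app_nth)
  have single: "snd ` set [L ! k] \<subseteq> carrier G" if "k < length L" for k using gc[OF that] by (simp add: g_def)
  have uSuc: "u (Suc k) = u k \<otimes>\<^bsub>P\<^esub> ((if e k then t else inv\<^bsub>P\<^esub> t) \<otimes>\<^bsub>P\<^esub> f (g k))" if "k < length L" for k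
    unfolding u_def take_Suc[OF that] syl_val_append[OF tk single[OF that]]
    using gc[OF that] by (simp add: e_def g_def)
  have vSuc: "v (Suc k) = v k \<otimes>\<^bsub>W\<^esub> ((if e k then T else inv\<^bsub>W\<^esub> T) \<otimes>\<^bsub>W\<^esub> F (g k))" if "k < length L" for k
    unfolding v_def take_Suc[OF that] W.syl_val_append[OF tk single[OF that]]
    using gc[OF that] by (simp add: e_def g_def)
  have coll: "collide L i' j' \<longleftrightarrow> (\<exists>g\<in>carrier G. u j' = u i' \<otimes>\<^bsub>P\<^esub> f g)" for i' j'
    by (simp add: collide_def u_def)
  have snd_v: "snd (v k) = u k" for k
    using W.syl_val_hom[OF H.is_group homsnd tk, of k]
    by (simp add: u_def v_def F_def T_def comp_def)
  \<comment> \<open>\<open>c k\<close> represents the edge passed at step \<open>k\<close>. The edge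
    of \<open>x\<close> joins the vertices of \<open>x\<close> and \<open>x t\<close>, so a step by
    \<open>t\<close> from \<open>u k\<close> uses the edge of \<open>u k\<close>, and a step by the
    inverse uses that of \<open>u k\<close> times the inverse of \<open>t\<close>.\<close>
  define c where "c = (\<lambda>k. if e k then u k else u k \<otimes>\<^bsub>P\<^esub> inv\<^bsub>P\<^esub> t)"
  have cc: "c k \<in> carrier P" for k using uc by (simp add: c_def)
  have invT: "inv\<^bsub>W\<^esub> T = (\<lambda>z\<in>carrier P. (if t \<otimes>\<^bsub>P\<^esub> z \<in> f ` A then - 1 else 0) mod int p, inv\<^bsub>P\<^esub> t)"
  proof (rule W.inv_equality[OF _ T])
    show "(\<lambda>z\<in>carrier P. (if t \<otimes>\<^bsub>P\<^esub> z \<in> f ` A then - 1 else 0) mod int p, inv\<^bsub>P\<^esub> t) \<otimes>\<^bsub>W\<^esub> T = \<one>\<^bsub>W\<^esub>"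
      by (auto simp: W_def regular_semidirect_def T_def mod_simps intro!: restrict_ext)
    show "(\<lambda>z\<in>carrier P. (if t \<otimes>\<^bsub>P\<^esub> z \<in> f ` A then - 1 else 0) mod int p, inv\<^bsub>P\<^esub> t) \<in> carrier W"
      using p1 by (auto simp: carr)
  qed
  have edge_step: "fst (v (Suc k)) z mod int p = (fst (v k) z +
      (if inv\<^bsub>P\<^esub> c k \<otimes>\<^bsub>P\<^esub> z \<in> f ` A then if e k then 1 else - 1 else 0)) mod int p"
    if k: "k < length L" and z: "z \<in> carrier P" for k z
  proof -
    have uz: "inv\<^bsub>P\<^esub> u k \<otimes>\<^bsub>P\<^esub> z \<in> carrier P" using uc z by simp
    show ?thesis
    proof (cases "e k")
      case True
      then show ?thesis
        using uz z gc[OF k] p1 unfolding vSuc[OF k] c_def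
        by (simp add: W_def regular_semidirect_def T_def F_def snd_v[unfolded W_def] mod_simps)
    next
      case False
      have "inv\<^bsub>P\<^esub> c k \<otimes>\<^bsub>P\<^esub> z = t \<otimes>\<^bsub>P\<^esub> (inv\<^bsub>P\<^esub> u k \<otimes>\<^bsub>P\<^esub> z)"
        using False uc z by (simp add: c_def H.inv_mult_group H.m_assoc)
      then show ?thesis
        using False uz z gc[OF k] p1 unfolding vSuc[OF k] invT
        by (simp add: W_def regular_semidirect_def F_def snd_v[unfolded W_def] mod_simps)
    qed
  qed
  \<comment> \<open>If edge \<open>i\<close> is passed again in the same direction, vertices
    \<open>i\<close> and \<open>k\<close> collide; in the opposite direction, \<open>Suc i\<close>
    and \<open>k\<close> do. Both pairs are closer than \<open>i\<close>, \<open>j\<close>, except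
    when \<open>k = Suc i\<close>, and then injectivity of \<open>f\<close> exposes a pinch.\<close>
  have distinct_edges: "inv\<^bsub>P\<^esub> c k \<otimes>\<^bsub>P\<^esub> c i \<notin> f ` A" if k: "i < k" "k < j" for k
  proof
    assume "inv\<^bsub>P\<^esub> c k \<otimes>\<^bsub>P\<^esub> c i \<in> f ` A"
    then obtain a where a: "a \<in> A" "inv\<^bsub>P\<^esub> c k \<otimes>\<^bsub>P\<^esub> c i = f a" by auto
    have aG: "a \<in> carrier G" "\<phi> a \<in> carrier G" using a(1) A_subset \<phi>_closed by auto
    have ck: "c i = c k \<otimes>\<^bsub>P\<^esub> f a" using a(2) cc aG by (metis H.inv_solve_left' hom_closed)
    have lens: "i < length L" "k < length L" using k ij by auto
    have no1: "\<not> collide L i k" using minimal[of i k] k ij by auto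
    have no2: "\<not> collide L (Suc i) k" if "k \<noteq> Suc i" using minimal[of "Suc i" k] k ij that by auto
    have red: "g i \<notin> (if e i then \<phi> ` A else A)" if "k = Suc i" "e i \<noteq> e k"
      using L(2) that lens by (auto simp: hnn_reduced_def e_def g_def)
    note gi = gc[OF lens(1)]
    show False
    proof (cases "e i = e k")
      case True
      have "\<exists>b\<in>carrier G. u i = u k \<otimes>\<^bsub>P\<^esub> f b"
      proof (cases "e k")
        case True
        then show ?thesis using ck \<open>e i = e k\<close> aG by (auto simp: c_def)
      next
        case False
        then have "u i \<otimes>\<^bsub>P\<^esub> inv\<^bsub>P\<^esub> t = u k \<otimes>\<^bsub>P\<^esub> f (\<phi> a) \<otimes>\<^bsub>P\<^esub> inv\<^bsub>P\<^esub> t"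
          using ck \<open>e i = e k\<close> aG uc t_rel_inv[OF a(1)] by (simp add: c_def H.m_assoc)
        then have "u i = u k \<otimes>\<^bsub>P\<^esub> f (\<phi> a)"
          using aG uc by (metis H.right_cancel H.inv_closed H.m_closed hom_closed t_closed)
        then show ?thesis using aG by blast
      qed
      then show False using no1 collide_sym[OF L(1)] coll by blast
    next
      case False
      have "\<exists>b. (b \<in> (if e i then \<phi> ` A else A)) \<and> inv\<^bsub>G\<^esub> b \<in> (if e i then \<phi> ` A else A)
          \<and> b \<in> carrier G \<and> u (Suc i) = u k \<otimes>\<^bsub>P\<^esub> f (b \<otimes>\<^bsub>G\<^esub> g i)"
      proof (cases "e i")
        case True
        then have "u i = u k \<otimes>\<^bsub>P\<^esub> inv\<^bsub>P\<^esub> t \<otimes>\<^bsub>P\<^esub> f a" using ck False by (simp add: c_def)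
        also have "\<dots> = u k \<otimes>\<^bsub>P\<^esub> f (\<phi> a) \<otimes>\<^bsub>P\<^esub> inv\<^bsub>P\<^esub> t"
          using aG uc t_rel_inv[OF a(1)] by (simp add: H.m_assoc)
        finally have "u (Suc i) = u k \<otimes>\<^bsub>P\<^esub> f (\<phi> a) \<otimes>\<^bsub>P\<^esub> inv\<^bsub>P\<^esub> t \<otimes>\<^bsub>P\<^esub> (t \<otimes>\<^bsub>P\<^esub> f (g i))"
          using uSuc[OF lens(1)] True by simp
        also have "\<dots> = u k \<otimes>\<^bsub>P\<^esub> f (\<phi> a \<otimes>\<^bsub>G\<^esub> g i)"
          using aG gi uc[of k] by (simp add: H.m_assoc) (simp add: H.m_assoc[symmetric])
        finally show ?thesis
          using True a(1) aG \<phi>_inv[OF a(1)] subgroup.m_inv_closed[OF subgroup_A a(1)]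
          by (intro exI[of _ "\<phi> a"]) (auto simp flip: \<phi>_inv)
      next
        case ei: False
        then have "u (Suc i) = u i \<otimes>\<^bsub>P\<^esub> inv\<^bsub>P\<^esub> t \<otimes>\<^bsub>P\<^esub> f (g i)"
          using uSuc[OF lens(1)] uc gi by (simp add: H.m_assoc)
        also have "u i \<otimes>\<^bsub>P\<^esub> inv\<^bsub>P\<^esub> t = u k \<otimes>\<^bsub>P\<^esub> f a" using ck False ei by (simp add: c_def)
        finally have "u (Suc i) = u k \<otimes>\<^bsub>P\<^esub> f (a \<otimes>\<^bsub>G\<^esub> g i)"
          using aG gi uc by (simp add: H.m_assoc)
        then show ?thesis
          using ei a(1) aG subgroup.m_inv_closed[OF subgroup_A a(1)] by auto
      qed
      then obtain b where b: "b \<in> carrier G" "u (Suc i) = u k \<otimes>\<^bsub>P\<^esub> f (b \<otimes>\<^bsub>G\<^esub> g i)"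
        "inv\<^bsub>G\<^esub> b \<in> (if e i then \<phi> ` A else A)" by blast
      have "k = Suc i"
        using no2 collide_sym[OF L(1)] coll b(1,2) gi G.m_closed by blast
      then have "f (b \<otimes>\<^bsub>G\<^esub> g i) = f \<one>\<^bsub>G\<^esub>"
        using b(2) H.l_cancel_one'[OF uc[of k] hom_closed[OF G.m_closed[OF b(1) gi]]] hom_one by simp
      then have "b \<otimes>\<^bsub>G\<^esub> g i = \<one>\<^bsub>G\<^esub>"
        using inj_onD[OF inj_f _ G.m_closed[OF b(1) gi] G.one_closed] by blast
      then have "inv\<^bsub>G\<^esub> g i = b" by (rule G.inv_equality[OF _ gi b(1)])
      then have "g i = inv\<^bsub>G\<^esub> b" using G.inv_inv[OF gi] by simp
      then show False using red[OF \<open>k = Suc i\<close> False] b(3) by simp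
    qed
  qed
  \<comment> \<open>Step \<open>i\<close> contributes 1 or -1 at the point \<open>c i\<close>; by
    \<open>distinct_edges\<close> the later steps contribute nothing there.\<close>
  have "fst (v k) (c i) mod int p = (fst (v i) (c i) + (if e i then 1 else - 1)) mod int p"
    if "Suc i \<le> k" "k \<le> j" for k
    using that
  proof (induction k rule: dec_induct)
    case base
    have "inv\<^bsub>P\<^esub> c i \<otimes>\<^bsub>P\<^esub> c i \<in> f ` A" using cc subgroup.one_closed[OF subA] by simp
    then show ?case using edge_step[of i "c i"] ij cc by simp
  next
    case (step k)
    then show ?case
      using edge_step[of k "c i"] distinct_edges[of k] ij cc by simp
  qed
  then have jump: "fst (v j) (c i) mod int p = (fst (v i) (c i) + (if e i then 1 else - 1)) mod int p"
    using ij by simp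
  show "\<not> W.collide L i j"
  proof
    assume "W.collide L i j"
    then obtain b where b: "b \<in> carrier G" "v j = v i \<otimes>\<^bsub>W\<^esub> F b"
      by (auto simp: W.collide_def v_def)
    \<comment> \<open>The module part of \<open>F b\<close> is zero, so the collision makes the
      coefficients at \<open>i\<close> and \<open>j\<close> agree, against
      \<open>jump\<close>.\<close>
    have "fst (v j) (c i) = fst (v i) (c i) mod int p"
      using b cc[of i] uc by (simp add: W_def regular_semidirect_def F_def snd_v[unfolded W_def])
    then have "fst (v i) (c i) mod int p = (fst (v i) (c i) + (if e i then 1 else - 1)) mod int p"
      using jump by simp
    then have "int p dvd (if e i then 1 else - 1)"
      by (metis add_diff_cancel_left' dvd_minus_iff minus_diff_eq mod_eq_dvd_iff)
    then have "int p dvd 1" by (auto split: if_splits)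
    then show False using p1 by simp
  qed
qed

end

section \<open>Removing collisions and deducing residual finiteness\<close>

lemma syl_val_cong:
  "(\<And>g. g \<in> snd ` set L \<Longrightarrow> f g = f' g) \<Longrightarrow> syl_val P f t L = syl_val P f' t L"
  by (induction L) auto

lemma hnn_faithful_compose:
  assumes "hnn_faithful G P f A \<phi> t" "group Q" "h \<in> hom P Q" "inj_on h (carrier P)"
  shows "hnn_faithful G Q (h \<circ> f) A \<phi> (h t)"
proof -
  interpret hnn_faithful G P f A \<phi> t by fact
  have "inj_on (h \<circ> f) (carrier G)"
    using inj_f assms(4) by (intro comp_inj_on inj_on_subset[OF assms(4)]) auto
  then show ?thesis
    using hnn_rep_compose[OF hnn_rep_axioms assms(2,3)] subgroup_A
    by (simp add: hnn_faithful_def hnn_faithful_axioms_def)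
qed

text \<open>Collisions push forward. Read contrapositively, enlarging \<open>P\<close> along a
  projection back to \<open>P\<close> creates no new collision, and replacing a group by an
  isomorphic copy changes none.\<close>

lemma collide_hom:
  assumes "hnn_faithful G P f A \<phi> t" "hnn_faithful G Q f' A \<phi> t'"
    and h: "h \<in> hom P Q" "\<And>g. g \<in> carrier G \<Longrightarrow> h (f g) = f' g" "h t = t'"
    and L: "snd ` set L \<subseteq> carrier G"
    and coll: "hnn_faithful.collide G P f t L i j"
  shows "hnn_faithful.collide G Q f' t' L i j"
proof -
  interpret P: hnn_faithful G P f A \<phi> t by fact
  interpret Q: hnn_faithful G Q f' A \<phi> t' by fact
  have sub: "snd ` set (take k L) \<subseteq> carrier G" for k using L set_take_subset by fastforce
  have val: "syl_val Q f' t' (take k L) = h (syl_val P f t (take k L))" for k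
  proof -
    have "syl_val Q f' t' (take k L) = syl_val Q (h \<circ> f) t' (take k L)"
    proof (rule syl_val_cong)
      fix g assume "g \<in> snd ` set (take k L)"
      then have "g \<in> carrier G" using sub[of k] by (rule rev_subsetD)
      then show "f' g = (h \<circ> f) g" using h(2) by simp
    qed
    then show ?thesis using P.syl_val_hom[OF Q.H.is_group h(1) sub[of k]] h(3) by simp
  qed
  obtain g where g: "g \<in> carrier G"
    "syl_val P f t (take j L) = syl_val P f t (take i L) \<otimes>\<^bsub>P\<^esub> f g"
    using coll by (auto simp: P.collide_def)
  then have "syl_val Q f' t' (take j L) = syl_val Q f' t' (take i L) \<otimes>\<^bsub>Q\<^esub> f' g"
    using h(2) by (simp add: val hom_mult[OF h(1)] P.syl_val_closed[OF sub])
  then show ?thesis using g(1) unfolding Q.collide_def by blast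
qed

text \<open>Each passage to the semidirect product destroys a shortest collision and creates none,
  so the number of colliding pairs falls. The process may stop once the two ends of the word no
  longer collide, which is the claim. Every new group is copied back to \<open>nat\<close>, since
  the induction must stay at one type while the semidirect product changes it.\<close>

lemma detect_reduced_word:
  fixes P :: "nat monoid"
  assumes p: "prime p" "finite_p_group p P" and faith: "hnn_faithful G P f A \<phi> t"
    and L: "snd ` set L \<subseteq> carrier G" "hnn_reduced A \<phi> L" "L \<noteq> []"
  shows "\<exists>(Q :: nat monoid) f' t'. finite_p_group p Q \<and> hnn_faithful G Q f' A \<phi> t' \<and>
    syl_val Q f' t' L \<notin> f' ` carrier G"
  using p(2) faith
proof (induction "card {(i, j). i < j \<and> j \<le> length L \<and> hnn_faithful.collide G P f t L i j}"
    arbitrary: P f t rule: less_induct)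
  case less
  let ?C = "\<lambda>(P :: nat monoid) f t. {(i, j). i < j \<and> j \<le> length L \<and> hnn_faithful.collide G P f t L i j}"
  interpret hnn_faithful G P f A \<phi> t by (rule less.prems)
  have fin: "finite (?C Q f' t')" for Q :: "nat monoid" and f' t'
    by (rule finite_subset[of _ "{..length L} \<times> {..length L}"]) auto
  show ?case
  proof (cases "collide L 0 (length L)")
    case False
    have "syl_val P f t L \<notin> f ` carrier G"
    proof
      assume "syl_val P f t L \<in> f ` carrier G"
      then obtain g where "g \<in> carrier G" "syl_val P f t L = f g" by auto
      then have "collide L 0 (length L)" by (auto simp: collide_def)
      then show False using False by simp
    qed
    then show ?thesis using less.prems by blast
  next
    case True
    \<comment> \<open>Minimising the distance of a colliding pair provides the hypothesis
      \<open>minimal\<close> of \<open>separate_collision\<close>.\<close>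
    define D where "D = (\<lambda>d. \<exists>i j. i < j \<and> j \<le> length L \<and> collide L i j \<and> d = j - i)"
    have "D (length L)"
      unfolding D_def using True L(3) by (intro exI[of _ 0] exI[of _ "length L"]) auto
    then have "D (Least D)" by (rule LeastI)
    then obtain i j where ij: "i < j" "j \<le> length L" "collide L i j" "Least D = j - i"
      by (auto simp: D_def)
    have minimal: "\<not> collide L i' j'" if "i' < j'" "j' \<le> length L" "j' - i' < j - i" for i' j'
    proof
      assume "collide L i' j'"
      then have "D (j' - i')" using that unfolding D_def by blast
      then have "j - i \<le> j' - i'" unfolding ij(4)[symmetric] by (rule Least_le)
      then show False using that(3) by simp
    qed
    define W F T where "W = regular_semidirect p P"
      and "F = (\<lambda>g. (\<lambda>z\<in>carrier P. 0 :: int, f g))"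
      and "T = (\<lambda>z\<in>carrier P. if z \<in> f ` A then 1 else 0 :: int, t)"
    note sep = separate_collision[OF p(1) less.prems(1) L(1,2) ij(1,2) minimal,
        folded W_def F_def T_def]
    have W: "finite_p_group p W"
      unfolding W_def by (rule finite_p_group_regular_semidirect[OF p(1) less.prems(1)])
    then obtain Q :: "nat monoid" and \<kappa> where Q: "finite_p_group p Q" "\<kappa> \<in> iso W Q"
      using finite_p_group_nat_copy by blast
    have grp: "group W" "group Q" using W Q(1) by (auto simp: finite_p_group_def)
    have \<kappa>: "\<kappa> \<in> hom W Q" "inj_on \<kappa> (carrier W)"
      using Q(2) by (auto simp: iso_def bij_betw_def)
    have faithQ: "hnn_faithful G Q (\<kappa> \<circ> F) A \<phi> (\<kappa> T)"
      by (rule hnn_faithful_compose[OF sep(1) grp(2) \<kappa>])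
    interpret W: hnn_faithful G W F A \<phi> T by (rule sep(1))
    have QW: "W.collide L i' j'" if "hnn_faithful.collide G Q (\<kappa> \<circ> F) (\<kappa> T) L i' j'" for i' j'
    proof (rule collide_hom[OF faithQ sep(1) _ _ _ L(1) that])
      show "inv_into (carrier W) \<kappa> \<in> hom Q W"
        using group.iso_set_sym[OF grp(1) Q(2)] by (simp add: iso_def)
      show "inv_into (carrier W) \<kappa> ((\<kappa> \<circ> F) g) = F g" if "g \<in> carrier G" for g
        using that \<kappa>(2) by (simp add: inv_into_f_f)
      show "inv_into (carrier W) \<kappa> (\<kappa> T) = T" using \<kappa>(2) by (simp add: inv_into_f_f)
    qed
    have WP: "collide L i' j'" if "W.collide L i' j'" for i' j'
      by (rule collide_hom[OF sep(1) less.prems(2) sep(2) _ _ L(1) that])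
        (auto simp: F_def T_def)
    have "?C Q (\<kappa> \<circ> F) (\<kappa> T) \<subset> ?C P f t"
    proof
      show "?C Q (\<kappa> \<circ> F) (\<kappa> T) \<subseteq> ?C P f t" using QW WP by auto
      show "?C Q (\<kappa> \<circ> F) (\<kappa> T) \<noteq> ?C P f t" using QW sep(3) ij by blast
    qed
    then have "card (?C Q (\<kappa> \<circ> F) (\<kappa> T)) < card (?C P f t)"
      by (rule psubset_card_mono[OF fin])
    then show ?thesis using less.hyps[OF _ Q(1) faithQ] by simp
  qed
qed

text \<open>For an element in normal form with no syllables the given representation already works.
  Otherwise \<open>detect_reduced_word\<close> puts the value of the syllables outside the image of
  \<open>G\<close>, where it cannot cancel the leading base element.\<close>

lemma residually_finite_p_group_hnn:
  fixes P :: "nat monoid"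
  assumes p: "prime p" "finite_p_group p P" and faith: "hnn_faithful G P f A \<phi> t"
  shows "residually_finite_p_group p (hnn_extension G A \<phi>)"
  unfolding residually_finite_p_group_def
proof (intro ballI impI)
  let ?H = "hnn_extension G A \<phi>" and ?b = "hnn_base G A \<phi>" and ?t = "hnn_stable G A \<phi>"
  interpret hnn_faithful G P f A \<phi> t by fact
  have \<phi>A: "\<phi> ` A \<subseteq> carrier G" using \<phi>_closed by auto
  interpret H: hnn_rep G ?H ?b A \<phi> ?t
    by (rule hnn_rep_extension[OF G.is_group A_subset \<phi>A])
  fix x assume x: "x \<in> carrier ?H" "x \<noteq> \<one>\<^bsub>?H\<^esub>"
  obtain g L where gL: "g \<in> carrier G" "snd ` set L \<subseteq> carrier G" "hnn_reduced A \<phi> L"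
    "x = ?b g \<otimes>\<^bsub>?H\<^esub> syl_val ?H ?b ?t L"
    using hnn_normal_form[OF G.is_group A_subset \<phi>A x(1)] by blast
  have "\<exists>(Q :: nat monoid) f' t'. finite_p_group p Q \<and> hnn_faithful G Q f' A \<phi> t' \<and>
    f' g \<otimes>\<^bsub>Q\<^esub> syl_val Q f' t' L \<noteq> \<one>\<^bsub>Q\<^esub>"
  proof (cases "L = []")
    case True
    then have "g \<noteq> \<one>\<^bsub>G\<^esub>" using gL x by auto
    then have "f g \<noteq> \<one>\<^bsub>P\<^esub>" using inj_onD[OF inj_f, of g "\<one>\<^bsub>G\<^esub>"] gL(1) by auto
    then show ?thesis using True p(2) faith gL(1) by (intro exI[of _ P] exI[of _ f] exI[of _ t]) simp
  next
    case False
    obtain Q :: "nat monoid" and f' t' where Q: "finite_p_group p Q" "hnn_faithful G Q f' A \<phi> t'"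
      "syl_val Q f' t' L \<notin> f' ` carrier G"
      using detect_reduced_word[OF p faith gL(2,3) False] by blast
    interpret Q: hnn_faithful G Q f' A \<phi> t' by (rule Q(2))
    have "f' g \<otimes>\<^bsub>Q\<^esub> syl_val Q f' t' L \<noteq> \<one>\<^bsub>Q\<^esub>"
    proof
      assume "f' g \<otimes>\<^bsub>Q\<^esub> syl_val Q f' t' L = \<one>\<^bsub>Q\<^esub>"
      then have "inv\<^bsub>Q\<^esub> syl_val Q f' t' L = f' g"
        using gL(1) Q.syl_val_closed[OF gL(2)] by (intro Q.H.inv_equality) auto
      then have "syl_val Q f' t' L = f' (inv\<^bsub>G\<^esub> g)"
        using gL(1) Q.syl_val_closed[OF gL(2)] by (metis Q.H.inv_inv Q.hom_inv)
      then show False using Q(3) imageI[OF G.inv_closed[OF gL(1)], of f'] by simp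
    qed
    then show ?thesis using Q by blast
  qed
  then obtain Q :: "nat monoid" and f' t' where Q: "finite_p_group p Q" "hnn_faithful G Q f' A \<phi> t'"
    "f' g \<otimes>\<^bsub>Q\<^esub> syl_val Q f' t' L \<noteq> \<one>\<^bsub>Q\<^esub>" by blast
  interpret Q: hnn_faithful G Q f' A \<phi> t' by (rule Q(2))
  obtain h where h: "h \<in> hom ?H Q" "h ?t = t'" "\<And>g. g \<in> carrier G \<Longrightarrow> h (?b g) = f' g"
    using Q.hnn_universal by blast
  interpret h: group_hom ?H Q h
    using h(1) by unfold_locales
  have "syl_val Q (h \<circ> ?b) t' L = syl_val Q f' t' L"
    using gL(2) h(3) by (intro syl_val_cong) auto
  then have hx: "h x = f' g \<otimes>\<^bsub>Q\<^esub> syl_val Q f' t' L"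
    using H.syl_val_hom[OF Q.H.is_group h(1) gL(2)] H.syl_val_closed[OF gL(2)] h gL(1,4)
    by simp
  \<comment> \<open>\<open>residually_finite_p_group\<close> demands a surjection, so the target is
    cut down to the image.\<close>
  have "subgroup (h ` carrier ?H) Q" by (rule h.img_is_subgroup)
  then have "finite_p_group p (Q\<lparr>carrier := h ` carrier ?H\<rparr>)"
    by (rule finite_p_group_subgroup[OF p(1) Q(1)])
  moreover have "h \<in> epi ?H (Q\<lparr>carrier := h ` carrier ?H\<rparr>)"
    using h(1) by (auto simp: epi_def hom_def)
  ultimately show "\<exists>(P :: nat monoid) h. finite_p_group p P \<and> h \<in> epi ?H P \<and> h x \<noteq> \<one>\<^bsub>P\<^esub>"
    using Q(3) hx by (intro exI[of _ "Q\<lparr>carrier := h ` carrier ?H\<rparr>"] exI[of _ h]) auto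
qed

section \<open>Permutation representations\<close>

definition left_mult :: "('a, 'b) monoid_scheme \<Rightarrow> 'a \<Rightarrow> 'a \<Rightarrow> 'a" where
  "left_mult G g = (\<lambda>x\<in>carrier G. g \<otimes>\<^bsub>G\<^esub> x)"

lemma BijGroup_simps:
  "carrier (BijGroup S) = Bij S"
  "r \<in> Bij S \<Longrightarrow> s \<in> Bij S \<Longrightarrow> r \<otimes>\<^bsub>BijGroup S\<^esub> s = compose S r s"
  "\<one>\<^bsub>BijGroup S\<^esub> = (\<lambda>x\<in>S. x)"
  by (simp_all add: BijGroup_def)

lemma (in group) left_mult_Bij: "g \<in> carrier G \<Longrightarrow> left_mult G g \<in> Bij (carrier G)"
  unfolding Bij_def left_mult_def
  by (auto intro!: bij_betwI[where g = "\<lambda>x. inv g \<otimes> x"] simp flip: m_assoc)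

text \<open>Evaluated at \<open>x\<close>, the defining relation of the extension for left
  multiplications and \<open>s\<close> is the assumed equivariance; faithfulness on \<open>G\<close>
  is that of the regular action.\<close>

lemma (in group) hnn_faithful_BijGroup:
  assumes A: "subgroup A G" "\<phi> ` A \<subseteq> carrier G"
    and s: "s \<in> Bij (carrier G)"
    and eq: "\<And>a x. a \<in> A \<Longrightarrow> x \<in> carrier G \<Longrightarrow> s (\<phi> a \<otimes> x) = a \<otimes> s x"
  shows "hnn_faithful G (BijGroup (carrier G)) (left_mult G) A \<phi> s"
proof (intro hnn_faithful.intro hnn_rep.intro group_hom.intro group_hom_axioms.intro
    hnn_rep_axioms.intro hnn_faithful_axioms.intro)
  show "left_mult G \<in> hom G (BijGroup (carrier G))"
    by (auto simp: hom_def BijGroup_simps left_mult_Bij)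
      (auto simp: left_mult_def compose_def m_assoc intro!: restrict_ext)
  show "left_mult G a \<otimes>\<^bsub>BijGroup (carrier G)\<^esub> s = s \<otimes>\<^bsub>BijGroup (carrier G)\<^esub> left_mult G (\<phi> a)"
    if a: "a \<in> A" for a
  proof -
    have "a \<in> carrier G" "\<phi> a \<in> carrier G" using a A subgroup.subset by auto
    then show ?thesis
      using s eq[OF a] Bij_imp_funcset[OF s]
      by (auto simp: BijGroup_simps left_mult_Bij compose_def intro!: restrict_ext)
        (auto simp: left_mult_def)
  qed
  show "inj_on (left_mult G) (carrier G)"
  proof (rule inj_onI)
    fix g h assume gh: "g \<in> carrier G" "h \<in> carrier G" "left_mult G g = left_mult G h"
    then have "left_mult G g \<one> = left_mult G h \<one>" by simp
    then show "g = h" using gh(1,2) by (simp add: left_mult_def)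
  qed
qed (use assms group_BijGroup subgroup.subset[OF A(1)] in \<open>auto simp: BijGroup_simps is_group\<close>)

lemma hnn_faithful_subgroup:
  assumes "hnn_faithful G P f A \<phi> t" and K: "subgroup K P" "f ` carrier G \<subseteq> K" "t \<in> K"
  shows "hnn_faithful G (P\<lparr>carrier := K\<rparr>) f A \<phi> t"
proof -
  interpret hnn_faithful G P f A \<phi> t by fact
  show ?thesis
    by (intro hnn_faithful.intro hnn_rep.intro group_hom.intro group_hom_axioms.intro
        hnn_rep_axioms.intro hnn_faithful_axioms.intro)
      (use K A_subset \<phi>_closed t_rel subgroup_A inj_f G.is_group H.subgroup_imp_group[OF K(1)]
        in \<open>auto simp: hom_def\<close>)
qed

section \<open>Chief factors of finite \<open>p\<close>-groups\<close>

lemma (in normal) rcos_group_hom: "group_hom G (G Mod H) (\<lambda>x. H #> x)"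
  using r_coset_hom_Mod factorgroup_is_group
  by (simp add: group_hom_def group_hom_axioms_def is_group)

lemma (in normal) rcos_eq_one_iff:
  "x \<in> carrier G \<Longrightarrow> H #> x = \<one>\<^bsub>G Mod H\<^esub> \<longleftrightarrow> x \<in> H"
  using coset_join1[OF _ _ is_subgroup, of x] coset_join2[OF _ is_subgroup, of x]
  by (auto simp: FactGroup_def)

lemma (in group) subgroup_nat_pow_mem:
  fixes k :: nat
  assumes "subgroup H G" "x \<in> H"
  shows "x [^] k \<in> H"
  using assms by (induction k) (auto simp: subgroup.one_closed subgroup.m_closed)

context
  fixes G (structure) and p N M
  assumes p: "prime p" and G: "finite_p_group p G"
    and N: "N \<lhd> G" and M: "M \<lhd> G" and NM: "N \<subset> M"
    and chief: "\<And>K. K \<lhd> G \<Longrightarrow> N \<subseteq> K \<Longrightarrow> K \<subseteq> M \<Longrightarrow> K = N \<or> K = M"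
begin

text \<open>The elements of \<open>M\<close> that are central modulo \<open>N\<close> form a normal
  subgroup of \<open>G\<close> between \<open>N\<close> and \<open>M\<close>. It exceeds
  \<open>N\<close> by \<open>exists_central_mod\<close>, so it is all of \<open>M\<close>.\<close>

lemma chief_factor_central:
  assumes "z \<in> M" "g \<in> carrier G"
  shows "N #> (g \<otimes> z) = N #> (z \<otimes> g)"
proof -
  interpret N: normal N G by (rule N)
  interpret M: normal M G by (rule M)
  define Q q where "Q = G Mod N" and "q = (\<lambda>x. N #> x)"
  interpret q: group_hom G Q q unfolding Q_def q_def by (rule N.rcos_group_hom)
  have q_one: "q x = \<one>\<^bsub>Q\<^esub> \<longleftrightarrow> x \<in> N" if "x \<in> carrier G" for x
    using N.rcos_eq_one_iff[OF that] by (simp add: Q_def q_def)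
  define Z where "Z = {z \<in> M. \<forall>g\<in>carrier G. q (g \<otimes> z) = q (z \<otimes> g)}"
  have Zc: "z \<in> carrier G" if "z \<in> Z" for z using that M.mem_carrier by (simp add: Z_def)
  have Zq: "q g \<otimes>\<^bsub>Q\<^esub> q z = q z \<otimes>\<^bsub>Q\<^esub> q g" if "z \<in> Z" "g \<in> carrier G" for z g
    using that Zc[OF that(1)] by (simp add: Z_def)
  have ZI: "z \<in> Z" if "z \<in> M" "\<And>g. g \<in> carrier G \<Longrightarrow> q g \<otimes>\<^bsub>Q\<^esub> q z = q z \<otimes>\<^bsub>Q\<^esub> q g" for z
    using that M.mem_carrier[OF that(1)] by (simp add: Z_def)
  have "Z \<lhd> G"
  proof (rule N.normal_invI)
    show "subgroup Z G"
    proof (rule N.subgroupI)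
      show "Z \<subseteq> carrier G" using Zc by blast
      show "Z \<noteq> {}" using ZI[OF M.one_closed] by auto
    next
      fix z assume z: "z \<in> Z"
      show "inv z \<in> Z"
      proof (rule ZI)
        show "inv z \<in> M" using z M.m_inv_closed by (simp add: Z_def)
        fix g assume g: "g \<in> carrier G"
        have c: "q g \<in> carrier Q" "q z \<in> carrier Q" using g Zc[OF z] by auto
        have "q z \<otimes>\<^bsub>Q\<^esub> q g \<otimes>\<^bsub>Q\<^esub> inv\<^bsub>Q\<^esub> q z = q g"
          using Zq[OF z g] c by (simp flip: Zq[OF z g] add: q.H.m_assoc)
        then have "q g \<otimes>\<^bsub>Q\<^esub> inv\<^bsub>Q\<^esub> q z = inv\<^bsub>Q\<^esub> q z \<otimes>\<^bsub>Q\<^esub> q g"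
          using c q.H.inv_solve_left[of "q g \<otimes>\<^bsub>Q\<^esub> inv\<^bsub>Q\<^esub> q z" "q z" "q g"] by (simp add: q.H.m_assoc)
        then show "q g \<otimes>\<^bsub>Q\<^esub> q (inv z) = q (inv z) \<otimes>\<^bsub>Q\<^esub> q g" using Zc[OF z] by simp
      qed
    next
      fix y z assume yz: "y \<in> Z" "z \<in> Z"
      show "y \<otimes> z \<in> Z"
      proof (rule ZI)
        show "y \<otimes> z \<in> M" using yz M.m_closed by (simp add: Z_def)
        fix g assume g: "g \<in> carrier G"
        have c: "q g \<in> carrier Q" "q y \<in> carrier Q" "q z \<in> carrier Q" using g Zc yz by auto
        have "q g \<otimes>\<^bsub>Q\<^esub> (q y \<otimes>\<^bsub>Q\<^esub> q z) = q y \<otimes>\<^bsub>Q\<^esub> q g \<otimes>\<^bsub>Q\<^esub> q z"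
          using c Zq[OF yz(1) g] by (simp flip: q.H.m_assoc)
        also have "\<dots> = q y \<otimes>\<^bsub>Q\<^esub> q z \<otimes>\<^bsub>Q\<^esub> q g"
          using c Zq[OF yz(2) g] by (simp add: q.H.m_assoc)
        finally show "q g \<otimes>\<^bsub>Q\<^esub> q (y \<otimes> z) = q (y \<otimes> z) \<otimes>\<^bsub>Q\<^esub> q g" using Zc yz by simp
      qed
    qed
    fix g z assume gz: "g \<in> carrier G" "z \<in> Z"
    have c: "q g \<in> carrier Q" "q z \<in> carrier Q" using gz Zc by auto
    have conj: "q (g \<otimes> z \<otimes> inv g) = q z"
      using gz(1) Zc[OF gz(2)] c Zq[OF gz(2,1)] by (simp add: q.H.m_assoc)
    show "g \<otimes> z \<otimes> inv g \<in> Z"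
    proof (rule ZI)
      show "g \<otimes> z \<otimes> inv g \<in> M" using gz M.inv_op_closed2 by (simp add: Z_def)
    qed (use conj Zq[OF gz(2)] in simp)
  qed
  moreover have "N \<subseteq> Z"
  proof
    fix z assume z: "z \<in> N"
    then have "q z = \<one>\<^bsub>Q\<^esub>" by (simp add: q_one)
    then show "z \<in> Z" using z NM by (intro ZI) auto
  qed
  moreover have "Z \<noteq> N"
    using exists_central_mod[OF p G N M NM] by (auto simp: Z_def q_def)
  ultimately have "Z = M" using chief[of Z] by (auto simp: Z_def)
  then show ?thesis using assms by (auto simp: Z_def q_def)
qed

text \<open>Since the factor is central, hence abelian, the elements of \<open>M\<close> with
  \<open>p\<close>-th power in \<open>N\<close> form a normal subgroup between \<open>N\<close> and
  \<open>M\<close>; it remains to exclude \<open>N\<close> itself.\<close>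

lemma chief_factor_exponent:
  assumes "z \<in> M"
  shows "z [^] p \<in> N"
proof -
  interpret N: normal N G by (rule N)
  interpret M: normal M G by (rule M)
  define Q q where "Q = G Mod N" and "q = (\<lambda>x. N #> x)"
  interpret q: group_hom G Q q unfolding Q_def q_def by (rule N.rcos_group_hom)
  have q_one: "q x = \<one>\<^bsub>Q\<^esub> \<longleftrightarrow> x \<in> N" if "x \<in> carrier G" for x
    using N.rcos_eq_one_iff[OF that] by (simp add: Q_def q_def)
  define K where "K = {z \<in> M. z [^] p \<in> N}"
  have Mc: "z \<in> carrier G" if "z \<in> M" for z using that by (rule M.mem_carrier)
  have Kq: "z \<in> K \<longleftrightarrow> z \<in> M \<and> q z [^]\<^bsub>Q\<^esub> p = \<one>\<^bsub>Q\<^esub>" for z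
    using Mc[of z] q_one[of "z [^] p"] q.hom_nat_pow[of z p] by (auto simp: K_def)
  have comm: "q y \<otimes>\<^bsub>Q\<^esub> q z = q z \<otimes>\<^bsub>Q\<^esub> q y" if "z \<in> M" "y \<in> carrier G" for y z
    using chief_factor_central[OF that] that Mc by (simp add: q_def[symmetric] flip: q.hom_mult)
  have "K \<lhd> G"
  proof (rule N.normal_invI)
    show "subgroup K G"
    proof (rule N.subgroupI)
      show "K \<subseteq> carrier G" using Mc by (auto simp: K_def)
      have "\<one> \<in> K"
        using subgroup.one_closed[OF M.is_subgroup] subgroup.one_closed[OF N.is_subgroup] by (simp add: K_def)
      then show "K \<noteq> {}" by blast
    next
      fix z assume "z \<in> K"
      then show "inv z \<in> K" using Mc N.m_inv_closed by (auto simp: K_def N.nat_pow_inv)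
    next
      fix y z assume yz: "y \<in> K" "z \<in> K"
      then have yz': "y \<in> M" "z \<in> M" by (auto simp: K_def)
      have c: "q y \<in> carrier Q" "q z \<in> carrier Q" using yz' Mc by auto
      have "q (y \<otimes> z) [^]\<^bsub>Q\<^esub> p = q y [^]\<^bsub>Q\<^esub> p \<otimes>\<^bsub>Q\<^esub> q z [^]\<^bsub>Q\<^esub> p"
        using q.H.pow_mult_distrib[OF comm[OF yz'(2) Mc[OF yz'(1)]] c] yz' Mc by simp
      then show "y \<otimes> z \<in> K" using yz yz' by (simp add: Kq)
    qed
    fix g z assume gz: "g \<in> carrier G" "z \<in> K"
    then have z: "z \<in> M" "z \<in> carrier G" using Mc by (auto simp: K_def)
    have "q (g \<otimes> z \<otimes> inv g) = q z"
      using gz(1) z comm[OF z(1) gz(1)] by (simp add: q.H.m_assoc)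
    then show "g \<otimes> z \<otimes> inv g \<in> K" using gz(2) M.inv_op_closed2[OF gz(1) z(1)] unfolding Kq by metis
  qed
  moreover have "N \<subseteq> K"
  proof
    fix z assume z: "z \<in> N"
    then have "q z = \<one>\<^bsub>Q\<^esub>" by (simp add: q_one)
    then show "z \<in> K" unfolding Kq using z NM by auto
  qed
  moreover have "K \<noteq> N"
  proof
    assume KN: "K = N"
    \<comment> \<open>If only elements of \<open>N\<close> had their \<open>p\<close>-th power in
      \<open>N\<close>, no iterated \<open>p\<close>-th power of \<open>x\<close> could enter
      \<open>N\<close>; but \<open>x\<close> to the order of \<open>G\<close>, a power of
      \<open>p\<close>, is \<one>.\<close>
    obtain x where x: "x \<in> M" "x \<notin> N" using NM by blast
    have "x [^] (p ^ j) \<notin> N" for j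
    proof (induction j)
      case 0
      then show ?case using x Mc by simp
    next
      case (Suc j)
      have "x [^] (p ^ j) \<in> M" by (rule N.subgroup_nat_pow_mem[OF M.is_subgroup x(1)])
      then have "(x [^] (p ^ j)) [^] p \<notin> N" using KN Suc by (auto simp: K_def)
      then show ?case using Mc[OF x(1)] by (simp add: N.nat_pow_pow mult.commute)
    qed
    moreover obtain k where "order G = p ^ k" using G by (auto simp: finite_p_group_def)
    ultimately show False
      using N.pow_order_eq_1[OF Mc[OF x(1)]] subgroup.one_closed[OF N.is_subgroup] by metis
  qed
  ultimately have "K = M" using chief[of K] by (auto simp: K_def)
  then show ?thesis using assms by (auto simp: K_def)
qed

end

section \<open>Tree permutations\<close>

text \<open>The properties of a chief series on which the permutation construction rests: central
  factors of exponent \<open>p\<close>.\<close>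

locale central_p_series =
  fixes G (structure) and p n S
  assumes prime_p: "prime p" and p_group: "finite_p_group p G"
    and S_0: "S 0 = {\<one>}" and S_n: "S n = carrier G"
    and S_normal: "\<And>i. i \<le> n \<Longrightarrow> S i \<lhd> G"
    and S_Suc: "\<And>i. i < n \<Longrightarrow> S i \<subseteq> S (Suc i)"
    and S_central: "\<And>i z g. i < n \<Longrightarrow> z \<in> S (Suc i) \<Longrightarrow> g \<in> carrier G \<Longrightarrow> S i #> (g \<otimes> z) = S i #> (z \<otimes> g)"
    and S_exponent: "\<And>i z. i < n \<Longrightarrow> z \<in> S (Suc i) \<Longrightarrow> z [^] p \<in> S i"

lemma central_p_series_chief:
  assumes "prime p" "finite_p_group p G" "chief_series G n S"
  shows "central_p_series G p n S"
proof -
  have S: "S i \<lhd> G" if "i \<le> n" for i using assms(3) that by (auto simp: chief_series_def)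
  have sub: "S i \<subset> S (Suc i)" if "i < n" for i using assms(3) that by (auto simp: chief_series_def)
  have ch: "K = S i \<or> K = S (Suc i)" if "i < n" "K \<lhd> G" "S i \<subseteq> K" "K \<subseteq> S (Suc i)" for i K
    using assms(3) that unfolding chief_series_def by (metis psubsetI)
  show ?thesis
  proof (rule central_p_series.intro)
    fix i z g
    assume i: "i < n" and z: "z \<in> S (Suc i)"
    then have i': "i \<le> n" "Suc i \<le> n" by auto
    show "z [^]\<^bsub>G\<^esub> p \<in> S i"
      by (rule chief_factor_exponent[OF assms(1,2) S[OF i'(1)] S[OF i'(2)] sub[OF i] ch[OF i] z])
    assume g: "g \<in> carrier G"
    show "S i #>\<^bsub>G\<^esub> (g \<otimes>\<^bsub>G\<^esub> z) = S i #>\<^bsub>G\<^esub> (z \<otimes>\<^bsub>G\<^esub> g)"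
      by (rule chief_factor_central[OF assms(1,2) S[OF i'(1)] S[OF i'(2)] sub[OF i] ch[OF i] z g])
  qed (use assms S sub in \<open>auto simp: chief_series_def\<close>)
qed

section \<open>The finite \<open>p\<close>-group of tree permutations\<close>

context central_p_series
begin

sublocale group G using p_group by (simp add: finite_p_group_def)

lemma finite_G: "finite (carrier G)" using p_group by (simp add: finite_p_group_def)

lemma S_subgroup: "i \<le> n \<Longrightarrow> subgroup (S i) G"
  using S_normal by (simp add: normal_imp_subgroup)

lemma S_closed: "i \<le> n \<Longrightarrow> z \<in> S i \<Longrightarrow> z \<in> carrier G"
  using S_subgroup subgroup.mem_carrier by metis

lemma S_mono: "i \<le> j \<Longrightarrow> j \<le> n \<Longrightarrow> S i \<subseteq> S j"
proof (induction j rule: dec_induct)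
  case (step j)
  then show ?case using S_Suc[of j] by auto
qed simp

lemma rcos_hom: "i \<le> n \<Longrightarrow> group_hom G (G Mod S i) (\<lambda>x. S i #> x)"
  using normal.rcos_group_hom[OF S_normal] .

lemma rcos_eq_iff: "i \<le> n \<Longrightarrow> x \<in> carrier G \<Longrightarrow> y \<in> carrier G \<Longrightarrow>
    S i #> x = S i #> y \<longleftrightarrow> inv x \<otimes> y \<in> S i"
proof -
  assume i: "i \<le> n" and c: "x \<in> carrier G" "y \<in> carrier G"
  define Q q where "Q = G Mod S i" and "q = (\<lambda>x. S i #> x)"
  interpret q: group_hom G Q q unfolding Q_def q_def by (rule rcos_hom[OF i])
  have "inv x \<otimes> y \<in> S i \<longleftrightarrow> q (inv x \<otimes> y) = \<one>\<^bsub>Q\<^esub>"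
    using normal.rcos_eq_one_iff[OF S_normal[OF i]] c by (simp add: q_def Q_def)
  also have "\<dots> \<longleftrightarrow> inv\<^bsub>Q\<^esub> q x \<otimes>\<^bsub>Q\<^esub> q y = \<one>\<^bsub>Q\<^esub>" using c by simp
  also have "\<dots> \<longleftrightarrow> q y = q x"
    using c q.H.inv_solve_left'[of "\<one>\<^bsub>Q\<^esub>" "q x" "q y"] by auto
  finally show ?thesis unfolding q_def by auto
qed

lemma rcos_mono:
  assumes "i \<le> j" "j \<le> n" "x \<in> carrier G" "y \<in> carrier G" "S i #> x = S i #> y"
  shows "S j #> x = S j #> y"
  using assms S_mono[of i j] rcos_eq_iff by auto

lemma rcos_obtain:
  assumes "i \<le> n" "x \<in> carrier G" "y \<in> carrier G" "S i #> y = S i #> x"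
  obtains z where "z \<in> S i" "y = x \<otimes> z"
proof
  show "inv x \<otimes> y \<in> S i" using assms rcos_eq_iff by metis
  show "y = x \<otimes> (inv x \<otimes> y)" using assms by (simp flip: m_assoc)
qed

lemma rcos_mult_right:
  assumes "i \<le> n" "x \<in> carrier G" "z \<in> S i"
  shows "S i #> (x \<otimes> z) = S i #> x"
proof -
  have "z \<in> carrier G" using S_closed assms by blast
  then show ?thesis using assms rcos_eq_iff[of i x "x \<otimes> z"] by (simp flip: m_assoc)
qed

lemma rcos_mult_cong:
  assumes "i \<le> n" "x \<in> carrier G" "x' \<in> carrier G" "y \<in> carrier G" "y' \<in> carrier G"
    "S i #> x = S i #> x'" "S i #> y = S i #> y'"
  shows "S i #> (x \<otimes> y) = S i #> (x' \<otimes> y')"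
proof -
  interpret q: group_hom G "G Mod S i" "\<lambda>x. S i #> x" by (rule rcos_hom[OF assms(1)])
  show ?thesis using q.hom_mult assms by metis
qed

text \<open>Taking \<open>z\<close> in \<open>S j\<close> shows that such a map respects cosets of
  \<open>S j\<close>; between blocks it is a translation by the abelian factor. The bijections among
  these maps form the iterated wreath product of the factors \<open>S (Suc j) / S j\<close>.\<close>

definition tree_map :: "('a \<Rightarrow> 'a) \<Rightarrow> bool" where
  "tree_map s \<longleftrightarrow> s \<in> carrier G \<rightarrow> carrier G \<and>
    (\<forall>j<n. \<forall>x\<in>carrier G. \<forall>z\<in>S (Suc j). S j #> s (x \<otimes> z) = S j #> (s x \<otimes> z))"

lemma tree_mapD:
  assumes "tree_map s" "x \<in> carrier G"
  shows "s x \<in> carrier G" and "j < n \<Longrightarrow> z \<in> S (Suc j) \<Longrightarrow> S j #> s (x \<otimes> z) = S j #> (s x \<otimes> z)"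
  using assms by (auto simp: tree_map_def)

text \<open>Let \<open>s x = s y\<close>. If \<open>inv x \<otimes> y\<close> lies in
  \<open>S (Suc j)\<close>, then \<open>s y\<close> is congruent to
  \<open>s x \<otimes> (inv x \<otimes> y)\<close> modulo \<open>S j\<close>, which forces it into
  \<open>S j\<close>. Descending from \<open>S n\<close> one reaches \<open>S 0\<close>.\<close>

lemma tree_map_inj: "tree_map s \<Longrightarrow> inj_on s (carrier G)"
proof (rule inj_onI)
  fix x y assume s: "tree_map s" and xy: "x \<in> carrier G" "y \<in> carrier G" "s x = s y"
  have "inv x \<otimes> y \<in> S j" if "j \<le> n" for j
    using that
  proof (induction j rule: inc_induct)
    case base
    show ?case using xy S_n by simp
  next
    case (step j)
    let ?z = "inv x \<otimes> y"
    have z: "?z \<in> carrier G" "x \<otimes> ?z = y" using xy by (simp_all flip: m_assoc)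
    have "S j #> s y = S j #> (s x \<otimes> ?z)" using tree_mapD(2)[OF s xy(1) step.hyps(2) step.IH] z by simp
    then show ?case
      using rcos_eq_iff[of j "s x" "s x \<otimes> ?z"] tree_mapD(1)[OF s] step.hyps xy z
      by (simp flip: m_assoc)
  qed
  from this[of 0] have "inv x \<otimes> y = \<one>" using S_0 by simp
  then show "x = y" using xy by (metis inv_closed inv_equality inv_inv)
qed

lemma tree_map_Bij:
  assumes "tree_map s"
  shows "restrict s (carrier G) \<in> Bij (carrier G)"
proof -
  have "s ` carrier G \<subseteq> carrier G" using assms by (auto simp: tree_map_def)
  then have "bij_betw s (carrier G) (carrier G)"
    using tree_map_inj[OF assms] endo_inj_surj[OF finite_G] by (simp add: bij_betw_def)
  then show ?thesis by (simp add: Bij_def)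
qed

definition tree_perms :: "('a \<Rightarrow> 'a) set" where
  "tree_perms = {s \<in> Bij (carrier G). tree_map s}"

lemma tree_perms_restrict: "tree_map s \<Longrightarrow> restrict s (carrier G) \<in> tree_perms"
proof -
  assume s: "tree_map s"
  have "x \<otimes> z \<in> carrier G" if "j < n" "x \<in> carrier G" "z \<in> S (Suc j)" for j x z
    using S_closed[OF _ that(3)] that by simp
  then have "tree_map (restrict s (carrier G))"
    using s by (simp add: tree_map_def Pi_iff)
  then show ?thesis using s by (simp add: tree_perms_def tree_map_Bij)
qed

lemma tree_perms_compose:
  assumes s: "s \<in> tree_perms" and r: "r \<in> tree_perms"
  shows "compose (carrier G) s r \<in> tree_perms"
proof -
  have sr: "tree_map s" "tree_map r" using s r by (auto simp: tree_perms_def)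
  have "S j #> s (r (x \<otimes> z)) = S j #> (s (r x) \<otimes> z)"
    if j: "j < n" and x: "x \<in> carrier G" and z: "z \<in> S (Suc j)" for j x z
  proof -
    have zc: "z \<in> carrier G" using S_closed[OF _ z] j by simp
    have c: "r x \<in> carrier G" "r (x \<otimes> z) \<in> carrier G" using sr x zc by (auto intro: tree_mapD(1))
    \<comment> \<open>The equation for \<open>r\<close> holds only up to \<open>w\<close> in
      \<open>S j\<close>. As \<open>z \<otimes> w\<close> still lies in \<open>S (Suc j)\<close>,
      the equation for \<open>s\<close> applies to it, and \<open>w\<close> is dropped again modulo
      \<open>S j\<close>.\<close>
    obtain w where w: "w \<in> S j" "r (x \<otimes> z) = r x \<otimes> z \<otimes> w"
      using rcos_obtain[of j "r x \<otimes> z" "r (x \<otimes> z)"] tree_mapD(2)[OF sr(2) x j z] c zc j by auto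
    have wc: "w \<in> carrier G" using S_closed[OF _ w(1)] j by simp
    have zw: "z \<otimes> w \<in> S (Suc j)"
      using subgroup.m_closed[OF S_subgroup[of "Suc j"] z, of w] S_Suc[OF j] w(1) j by auto
    have "S j #> s (r (x \<otimes> z)) = S j #> (s (r x) \<otimes> (z \<otimes> w))"
      using tree_mapD(2)[OF sr(1) c(1) j zw] w(2) c zc wc by (simp add: m_assoc)
    also have "\<dots> = S j #> (s (r x) \<otimes> z)"
      using rcos_mult_right[of j "s (r x) \<otimes> z" w] j w(1) wc zc tree_mapD(1)[OF sr(1) c(1)]
      by (simp add: m_assoc)
    finally show ?thesis .
  qed
  then have "tree_map (\<lambda>x. s (r x))" using sr by (auto simp: tree_map_def)
  then show ?thesis using tree_perms_restrict by (simp add: compose_def)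
qed

lemma tree_perms_one: "(\<lambda>x\<in>carrier G. x) \<in> tree_perms"
  using tree_perms_restrict[of "\<lambda>x. x"] by (auto simp: tree_map_def)

lemma tree_perms_pow:
  fixes k :: nat
  assumes "s \<in> tree_perms"
  shows "s [^]\<^bsub>BijGroup (carrier G)\<^esub> k \<in> tree_perms"
proof (induction k)
  case 0
  interpret B: group "BijGroup (carrier G)" by (rule group_BijGroup)
  show ?case using tree_perms_one by (simp only: B.nat_pow_0 BijGroup_simps)
next
  case (Suc k)
  interpret B: group "BijGroup (carrier G)" by (rule group_BijGroup)
  show ?case using Suc assms tree_perms_compose[OF Suc assms]
    by (simp add: BijGroup_simps tree_perms_def)
qed

text \<open>Each \<open>p\<close>-th power gains one level: \<open>s\<close> to the power
  \<open>p ^ k\<close> fixes every coset of \<open>S (n - k)\<close>. On such a coset it translates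
  the cosets of the next smaller term, and these translations have order dividing
  \<open>p\<close>.\<close>

lemma tree_perms_pow_order:
  assumes s: "s \<in> tree_perms"
  shows "s [^]\<^bsub>BijGroup (carrier G)\<^esub> (p ^ n) = \<one>\<^bsub>BijGroup (carrier G)\<^esub>"
proof -
  let ?B = "BijGroup (carrier G)"
  interpret B: group ?B by (rule group_BijGroup)
  have sB: "s \<in> carrier ?B" using s by (simp add: tree_perms_def BijGroup_simps)
  have app: "(r [^]\<^bsub>?B\<^esub> Suc m) x = r ((r [^]\<^bsub>?B\<^esub> m) x)"
    if r: "r \<in> tree_perms" and x: "x \<in> carrier G" for r m x
  proof -
    have "r \<in> carrier ?B" "r [^]\<^bsub>?B\<^esub> m \<in> carrier ?B"
      using r tree_perms_pow[OF r, of m] by (auto simp: tree_perms_def BijGroup_simps)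
    then show ?thesis
      using x B.nat_pow_Suc2[of r m] by (simp add: BijGroup_simps compose_def del: B.nat_pow_Suc)
  qed
  have pow_closed: "(r [^]\<^bsub>?B\<^esub> m) x \<in> carrier G"
    if "r \<in> tree_perms" "x \<in> carrier G" for r x and m :: nat
    using tree_mapD(1) tree_perms_pow[OF that(1), of m] that(2) unfolding tree_perms_def by blast
  have top: "S n #> y = S n #> x" if "y \<in> carrier G" "x \<in> carrier G" for x y
    using that rcos_eq_iff[of n y x] by (simp add: S_n)
  have "S (n - k) #> (s [^]\<^bsub>?B\<^esub> (p ^ k)) x = S (n - k) #> x" if "k \<le> n" "x \<in> carrier G" for k x
    using that
  proof (induction k arbitrary: x)
    case 0
    show ?case unfolding minus_nat.diff_0 by (rule top[OF pow_closed[OF s 0(2)] 0(2)])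
  next
    case (Suc k)
    define j where "j = n - Suc k"
    have j: "j < n" "Suc j = n - k" using Suc.prems by (auto simp: j_def)
    define r where "r = s [^]\<^bsub>?B\<^esub> (p ^ k)"
    have rp: "r \<in> tree_perms" unfolding r_def by (rule tree_perms_pow[OF s])
    then have r: "tree_map r" by (simp add: tree_perms_def)
    have rx: "r x \<in> carrier G" using tree_mapD(1)[OF r] Suc.prems by simp
    have "S (Suc j) #> r x = S (Suc j) #> x"
      using Suc unfolding j(2) r_def by simp
    then obtain w where w: "w \<in> S (Suc j)" "r x = x \<otimes> w"
      using rcos_obtain[of "Suc j" x "r x"] j(1) Suc.prems rx by auto
    have wc: "w \<in> carrier G" using S_closed[OF _ w(1)] j by simp
    have wm: "w [^] m \<in> S (Suc j)" for m :: nat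
      using subgroup_nat_pow_mem[OF S_subgroup w(1)] j(1) by simp
    \<comment> \<open>As \<open>r x = x \<otimes> w\<close>, and \<open>r\<close> commutes modulo
      \<open>S j\<close> with right multiplication by \<open>S (Suc j)\<close>, iteration
      accumulates powers of the same \<open>w\<close>. At \<open>m = p\<close> they fall into
      \<open>S j\<close>.\<close>
    have "S j #> (r [^]\<^bsub>?B\<^esub> m) x = S j #> (x \<otimes> w [^] m)" for m :: nat
    proof (induction m)
      case 0
      show ?case using Suc.prems by (simp add: BijGroup_simps)
    next
      case (Suc m)
      let ?y = "(r [^]\<^bsub>?B\<^esub> m) x"
      have xc: "x \<in> carrier G" by fact
      have y: "?y \<in> carrier G" by (rule pow_closed[OF rp xc])
      obtain v where v: "v \<in> S j" "?y = x \<otimes> w [^] m \<otimes> v"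
        using rcos_obtain[of j "x \<otimes> w [^] m" ?y] Suc y xc wc j(1) by auto
      have vc: "v \<in> carrier G" using S_closed[OF _ v(1)] j by simp
      have wv: "w [^] m \<otimes> v \<in> S (Suc j)"
        using subgroup.m_closed[OF S_subgroup[of "Suc j"] wm, of v] S_Suc[OF j(1)] v(1) j by auto
      have "S j #> r ?y = S j #> (r x \<otimes> (w [^] m \<otimes> v))"
        using tree_mapD(2)[OF r xc j(1) wv] v(2) xc wc vc by (simp add: m_assoc)
      also have "r x \<otimes> (w [^] m \<otimes> v) = x \<otimes> w [^] Suc m \<otimes> v"
        using w(2) xc wc vc nat_pow_Suc2[OF wc, of m] by (simp add: m_assoc del: nat_pow_Suc)
      also have "S j #> \<dots> = S j #> (x \<otimes> w [^] Suc m)"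
        by (rule rcos_mult_right) (use j(1) xc wc v(1) in auto)
      finally show ?case using app[OF rp xc] by simp
    qed
    from this[of p] have "S j #> (r [^]\<^bsub>?B\<^esub> p) x = S j #> x"
      using rcos_mult_right[OF _ Suc.prems(2) S_exponent[OF j(1) w(1)]] j(1) by simp
    moreover have "r [^]\<^bsub>?B\<^esub> p = s [^]\<^bsub>?B\<^esub> (p ^ Suc k)"
      unfolding r_def using sB by (simp add: B.nat_pow_pow mult.commute)
    ultimately show ?case by (simp add: j_def)
  qed
  from this[of n] have eq: "S 0 #> (s [^]\<^bsub>?B\<^esub> (p ^ n)) x = S 0 #> x" if "x \<in> carrier G" for x
    using that by simp
  have mem: "s [^]\<^bsub>?B\<^esub> (p ^ n) \<in> tree_perms" by (rule tree_perms_pow[OF s])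
  have "(s [^]\<^bsub>?B\<^esub> (p ^ n)) x = x" if x: "x \<in> carrier G" for x
  proof -
    have c: "(s [^]\<^bsub>?B\<^esub> (p ^ n)) x \<in> carrier G" by (rule pow_closed[OF s x])
    obtain z where "z \<in> S 0" "(s [^]\<^bsub>?B\<^esub> (p ^ n)) x = x \<otimes> z"
      using rcos_obtain[OF _ x c eq[OF x]] by auto
    then show ?thesis using x S_0 by simp
  qed
  moreover have "s [^]\<^bsub>?B\<^esub> (p ^ n) \<in> extensional (carrier G)"
    using mem by (auto simp: tree_perms_def Bij_def)
  ultimately show ?thesis
    by (auto simp: BijGroup_simps intro!: extensionalityI[where A = "carrier G"])
qed

lemma subgroup_tree_perms: "subgroup tree_perms (BijGroup (carrier G))"
proof -
  let ?B = "BijGroup (carrier G)"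
  interpret B: group ?B by (rule group_BijGroup)
  show ?thesis
  proof (rule B.subgroupI)
    show "tree_perms \<subseteq> carrier ?B" by (auto simp: tree_perms_def BijGroup_simps)
    show "tree_perms \<noteq> {}" using tree_perms_one by blast
  next
    fix s assume s: "s \<in> tree_perms"
    then have sB: "s \<in> carrier ?B" by (simp add: tree_perms_def BijGroup_simps)
    \<comment> \<open>The inverse is itself a power, so closure under inverses reduces to closure
      under composition.\<close>
    have "s [^]\<^bsub>?B\<^esub> (p ^ n - 1) \<otimes>\<^bsub>?B\<^esub> s = s [^]\<^bsub>?B\<^esub> (p ^ n)"
      using prime_gt_0_nat[OF prime_p] by (simp flip: B.nat_pow_Suc)
    then have "s [^]\<^bsub>?B\<^esub> (p ^ n - 1) \<otimes>\<^bsub>?B\<^esub> s = \<one>\<^bsub>?B\<^esub>" using tree_perms_pow_order[OF s] by simp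
    then have "inv\<^bsub>?B\<^esub> s = s [^]\<^bsub>?B\<^esub> (p ^ n - 1)" using sB by (intro B.inv_equality) auto
    then show "inv\<^bsub>?B\<^esub> s \<in> tree_perms" using tree_perms_pow[OF s] by simp
  next
    fix r s assume "r \<in> tree_perms" "s \<in> tree_perms"
    then show "r \<otimes>\<^bsub>?B\<^esub> s \<in> tree_perms"
      using tree_perms_compose[of r s] by (simp add: BijGroup_simps tree_perms_def)
  qed
qed

lemma finite_p_group_tree_perms:
  "finite_p_group p (BijGroup (carrier G)\<lparr>carrier := tree_perms\<rparr>)"
proof (rule finite_p_groupI_exponent[OF prime_p])
  interpret B: group "BijGroup (carrier G)" by (rule group_BijGroup)
  show "group (BijGroup (carrier G)\<lparr>carrier := tree_perms\<rparr>)"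
    by (rule B.subgroup_imp_group[OF subgroup_tree_perms])
  have "tree_perms \<subseteq> carrier G \<rightarrow>\<^sub>E carrier G"
    by (auto simp: tree_perms_def tree_map_def Bij_def PiE_def)
  then show "finite (carrier (BijGroup (carrier G)\<lparr>carrier := tree_perms\<rparr>))"
    using finite_G by (auto intro: finite_subset finite_PiE)
  fix s assume "s \<in> carrier (BijGroup (carrier G)\<lparr>carrier := tree_perms\<rparr>)"
  then show "s [^]\<^bsub>BijGroup (carrier G)\<lparr>carrier := tree_perms\<rparr>\<^esub> (p ^ n)
      = \<one>\<^bsub>BijGroup (carrier G)\<lparr>carrier := tree_perms\<rparr>\<^esub>"
    using tree_perms_pow_order[of s] by (simp add: nat_pow_def)
qed

end

section \<open>Lifting an equivariant permutation through the series\<close>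

locale compatible_series = central_p_series +
  fixes A \<phi>
  assumes subgroup_A: "subgroup A G"
    and \<phi>_closed: "\<And>a. a \<in> A \<Longrightarrow> \<phi> a \<in> carrier G"
    and \<phi>_mult: "\<And>a b. a \<in> A \<Longrightarrow> b \<in> A \<Longrightarrow> \<phi> (a \<otimes> b) = \<phi> a \<otimes> \<phi> b"
    and \<phi>_S: "\<And>i a. i \<le> n \<Longrightarrow> a \<in> A \<Longrightarrow> \<phi> a \<in> S i \<Longrightarrow> a \<in> S i"
    and \<phi>_cong: "\<And>i a. i < n \<Longrightarrow> a \<in> A \<Longrightarrow> a \<in> S (Suc i) \<Longrightarrow> S i #> \<phi> a = S i #> a"
begin

lemma A_closed: "a \<in> A \<Longrightarrow> a \<in> carrier G"
  using subgroup.mem_carrier[OF subgroup_A] .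

lemma \<phi>_one: "\<phi> \<one> = \<one>"
proof -
  have 1: "\<one> \<in> A" using subgroup.one_closed[OF subgroup_A] .
  then have "\<phi> \<one> \<otimes> \<phi> \<one> = \<phi> \<one>" using \<phi>_mult[OF 1 1] by simp
  then show ?thesis using \<phi>_closed[OF 1] by simp
qed

lemma \<phi>_inv: "a \<in> A \<Longrightarrow> \<phi> (inv a) = inv \<phi> a"
proof -
  assume a: "a \<in> A"
  then have ia: "inv a \<in> A" using subgroup.m_inv_closed[OF subgroup_A] by blast
  have "\<phi> (inv a) \<otimes> \<phi> a = \<one>"
    using \<phi>_mult[OF ia a] \<phi>_one A_closed[OF a] by simp
  then show ?thesis using \<phi>_closed[OF a] \<phi>_closed[OF ia] by (metis inv_equality)
qed

text \<open>Two descriptions of one point differ by \<open>d\<close> in \<open>A\<close> and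
  \<open>w\<close> in \<open>S (Suc i)\<close> with
  \<open>\<phi> d \<otimes> r = r \<otimes> w\<close>. So \<open>\<phi> d\<close> is a conjugate of
  \<open>w\<close> and lies in \<open>S (Suc i)\<close>; by (1) \<open>d\<close> does too, and by
  (2) and centrality \<open>d\<close> is congruent to \<open>\<phi> d\<close> and to
  \<open>w\<close> modulo \<open>S i\<close>. Hence exchanging \<open>d\<close> for \<open>w\<close>
  does not alter the prescribed value. Here both conditions on the series enter.\<close>

lemma lift_welldefined:
  assumes i: "i < n" and a: "a \<in> A" "a' \<in> A" and z: "z \<in> S (Suc i)" "z' \<in> S (Suc i)"
    and r: "r \<in> carrier G" and s: "s \<in> carrier G"
    and eq: "\<phi> a \<otimes> r \<otimes> z = \<phi> a' \<otimes> r \<otimes> z'"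
  shows "S i #> (a \<otimes> s \<otimes> z) = S i #> (a' \<otimes> s \<otimes> z')"
proof -
  have i': "i \<le> n" "Suc i \<le> n" using i by auto
  interpret N: normal "S (Suc i)" G by (rule S_normal[OF i'(2)])
  define Q q where "Q = G Mod S i" and "q = (\<lambda>x. S i #> x)"
  interpret q: group_hom G Q q unfolding Q_def q_def by (rule rcos_hom[OF i'(1)])
  have c: "a \<in> carrier G" "a' \<in> carrier G" "z \<in> carrier G" "z' \<in> carrier G"
    "\<phi> a \<in> carrier G" "\<phi> a' \<in> carrier G"
    using a z A_closed \<phi>_closed S_closed[OF i'(2)] by auto
  define d w where "d = inv a' \<otimes> a" and "w = z' \<otimes> inv z"
  have ia': "inv a' \<in> A" using a subgroup.m_inv_closed[OF subgroup_A] by blast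
  have d: "d \<in> A" unfolding d_def by (rule subgroup.m_closed[OF subgroup_A ia' a(1)])
  have w: "w \<in> S (Suc i)" unfolding w_def using z N.m_closed N.m_inv_closed by blast
  have dw: "d \<in> carrier G" "w \<in> carrier G" using d w A_closed S_closed[OF i'(2)] by auto
  have \<phi>d: "\<phi> d = inv \<phi> a' \<otimes> \<phi> a"
    unfolding d_def using \<phi>_mult[OF ia' a(1)] \<phi>_inv[OF a(2)] by simp
  have "\<phi> a \<otimes> r = \<phi> a' \<otimes> r \<otimes> w"
  proof -
    have "\<phi> a \<otimes> r = \<phi> a \<otimes> r \<otimes> z \<otimes> inv z" using c r by (simp add: m_assoc)
    also have "\<dots> = \<phi> a' \<otimes> r \<otimes> w" unfolding eq w_def using c r by (simp add: m_assoc)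
    finally show ?thesis .
  qed
  then have "\<phi> d \<otimes> r = r \<otimes> w"
    unfolding \<phi>d using c r dw by (simp add: m_assoc) (simp flip: m_assoc)
  then have \<phi>d': "\<phi> d = r \<otimes> w \<otimes> inv r"
    using r dw \<phi>_closed[OF d] by (metis inv_solve_right m_closed)
  then have "\<phi> d \<in> S (Suc i)" using N.inv_op_closed2[OF r w] by simp
  then have dS: "d \<in> S (Suc i)" using \<phi>_S[OF i'(2) d] by simp
  have comm: "q v \<otimes>\<^bsub>Q\<^esub> q x = q x \<otimes>\<^bsub>Q\<^esub> q v" if "v \<in> S (Suc i)" "x \<in> carrier G" for v x
    using S_central[OF i that] that S_closed[OF i'(2)] by (simp add: q_def[symmetric] flip: q.hom_mult)
  have "q d = q (\<phi> d)" using \<phi>_cong[OF i d dS] by (simp add: q_def)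
  also have "\<dots> = q w"
    unfolding \<phi>d' using r dw comm[OF w r] by (simp flip: comm[OF w r] add: q.H.m_assoc)
  finally have qd: "q d = q w" .
  have "a = a' \<otimes> d" unfolding d_def using c by (simp flip: m_assoc)
  then have "q (a \<otimes> s \<otimes> z) = q a' \<otimes>\<^bsub>Q\<^esub> (q d \<otimes>\<^bsub>Q\<^esub> q s) \<otimes>\<^bsub>Q\<^esub> q z"
    using c s dw by (simp add: q.H.m_assoc)
  also have "\<dots> = q a' \<otimes>\<^bsub>Q\<^esub> q s \<otimes>\<^bsub>Q\<^esub> (q w \<otimes>\<^bsub>Q\<^esub> q z)"
    using comm[OF dS s] unfolding qd using c s dw by (simp add: q.H.m_assoc)
  also have "q w \<otimes>\<^bsub>Q\<^esub> q z = q z'"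
    unfolding w_def using c by (simp add: q.H.m_assoc)
  also have "q a' \<otimes>\<^bsub>Q\<^esub> q s \<otimes>\<^bsub>Q\<^esub> q z' = q (a' \<otimes> s \<otimes> z')" using c s by simp
  finally show ?thesis by (simp add: q_def)
qed

text \<open>A partial solution: equivariant only modulo \<open>S i\<close>, and a tree map only from
  level \<open>i\<close> upwards. It matters through the induced map on cosets of
  \<open>S i\<close>, so the next lift may change values inside them. At \<open>i = 0\<close> both
  requirements become exact.\<close>

definition equivariant_from :: "nat \<Rightarrow> ('a \<Rightarrow> 'a) \<Rightarrow> bool" where
  "equivariant_from i s \<longleftrightarrow> s \<in> carrier G \<rightarrow> carrier G \<and>
    (\<forall>a\<in>A. \<forall>x\<in>carrier G. S i #> s (\<phi> a \<otimes> x) = S i #> (a \<otimes> s x)) \<and>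
    (\<forall>x\<in>carrier G. \<forall>z\<in>S i. S i #> s (x \<otimes> z) = S i #> s x) \<and>
    (\<forall>j. i \<le> j \<longrightarrow> j < n \<longrightarrow>
      (\<forall>x\<in>carrier G. \<forall>z\<in>S (Suc j). S j #> s (x \<otimes> z) = S j #> (s x \<otimes> z)))"

text \<open>The lift \<open>s'\<close> of \<open>s\<close> to the next level is defined on the orbits of \<open>\<phi>(A) \<times> S (Suc i)\<close>, acting
  by left and right multiplication, by prescribing its value at one point \<open>r\<close> of each orbit.\<close>

lemma equivariant_from_step:
  assumes i: "i < n" and s: "equivariant_from (Suc i) s"
  shows "\<exists>s'. equivariant_from i s'"
proof -
  have i': "i \<le> n" "Suc i \<le> n" using i by auto
  have SA: "subgroup (S (Suc i)) G" by (rule S_subgroup[OF i'(2)])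
  have s_closed: "s x \<in> carrier G" if "x \<in> carrier G" for x
    using s that by (auto simp: equivariant_from_def)
  define R where "R = (\<lambda>x y. \<exists>a\<in>A. \<exists>z\<in>S (Suc i). y = \<phi> a \<otimes> x \<otimes> z)"
  have R_sym: "R y x" if xy: "R x y" "x \<in> carrier G" for x y
  proof -
    obtain a z where az: "a \<in> A" "z \<in> S (Suc i)" "y = \<phi> a \<otimes> x \<otimes> z" using xy(1) by (auto simp: R_def)
    have c: "\<phi> a \<in> carrier G" "z \<in> carrier G" using az \<phi>_closed S_closed[OF i'(2)] by auto
    have "x = \<phi> (inv a) \<otimes> y \<otimes> inv z"
      unfolding az(3) \<phi>_inv[OF az(1)] using c xy(2) by (simp add: m_assoc) (simp flip: m_assoc)
    moreover have "inv a \<in> A" "inv z \<in> S (Suc i)"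
      using az subgroup.m_inv_closed[OF subgroup_A] subgroup.m_inv_closed[OF SA] by auto
    ultimately show ?thesis unfolding R_def by blast
  qed
  have R_trans: "R x w" if xy: "R x y" "R y w" "x \<in> carrier G" for x y w
  proof -
    obtain a z where az: "a \<in> A" "z \<in> S (Suc i)" "y = \<phi> a \<otimes> x \<otimes> z" using xy(1) by (auto simp: R_def)
    obtain b v where bv: "b \<in> A" "v \<in> S (Suc i)" "w = \<phi> b \<otimes> y \<otimes> v" using xy(2) by (auto simp: R_def)
    have c: "\<phi> a \<in> carrier G" "z \<in> carrier G" "\<phi> b \<in> carrier G" "v \<in> carrier G"
      using az bv \<phi>_closed S_closed[OF i'(2)] by auto
    have "w = \<phi> (b \<otimes> a) \<otimes> x \<otimes> (z \<otimes> v)"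
      unfolding bv(3) az(3) \<phi>_mult[OF bv(1) az(1)] using c xy(3) by (simp add: m_assoc)
    moreover have "b \<otimes> a \<in> A" "z \<otimes> v \<in> S (Suc i)"
      using az bv subgroup.m_closed[OF subgroup_A] subgroup.m_closed[OF SA] by auto
    ultimately show ?thesis unfolding R_def by blast
  qed
  define r where "r = (\<lambda>x. SOME y. R x y)"
  have R_refl: "R x x" if "x \<in> carrier G" for x
    unfolding R_def using that \<phi>_one
    by (intro bexI[of _ \<one>]) (auto simp: subgroup.one_closed[OF SA] subgroup.one_closed[OF subgroup_A])
  have R_closed: "y \<in> carrier G" if "R x y" "x \<in> carrier G" for x y
    using that \<phi>_closed S_closed[OF i'(2)] by (auto simp: R_def)
  have Rr: "R x (r x)" if "x \<in> carrier G" for x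
    unfolding r_def using R_refl[OF that] by (rule someI)
  have r_eq: "r y = r x" if "R x y" "x \<in> carrier G" for x y
  proof -
    \<comment> \<open>As \<open>R\<close> is an equivalence, related points have equal predicates,
      and therefore \<open>SOME\<close> picks the same representative for both.\<close>
    have "R y = R x" using R_sym R_trans R_closed that by blast
    then show ?thesis by (simp add: r_def)
  qed
  have r_closed: "r x \<in> carrier G" if "x \<in> carrier G" for x using R_closed[OF Rr[OF that] that] .
  have "\<forall>x\<in>carrier G. \<exists>a z. a \<in> A \<and> z \<in> S (Suc i) \<and> x = \<phi> a \<otimes> r x \<otimes> z"
    using R_sym[OF Rr] unfolding R_def by blast
  then obtain \<alpha> \<zeta> where \<alpha>\<zeta>: "\<alpha> x \<in> A" "\<zeta> x \<in> S (Suc i)" "x = \<phi> (\<alpha> x) \<otimes> r x \<otimes> \<zeta> x"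
    if "x \<in> carrier G" for x by metis
  define s' where "s' = (\<lambda>x. \<alpha> x \<otimes> s (r x) \<otimes> \<zeta> x)"
  \<comment> \<open>The coordinates \<alpha> and \<zeta> of a point are arbitrary choices; modulo
    \<open>S i\<close> any other choice gives the same value.\<close>
  have s'_eq: "S i #> s' x = S i #> (a \<otimes> s (r x) \<otimes> z)"
    if x: "x \<in> carrier G" "a \<in> A" "z \<in> S (Suc i)" "x = \<phi> a \<otimes> r x \<otimes> z" for x a z
    unfolding s'_def
    using lift_welldefined[OF i \<alpha>\<zeta>(1)[OF x(1)] x(2) \<alpha>\<zeta>(2)[OF x(1)] x(3) r_closed[OF x(1)] s_closed[OF r_closed[OF x(1)]]]
      \<alpha>\<zeta>(3)[OF x(1)] x(4) by simp
  have \<alpha>c: "\<alpha> x \<in> carrier G" "\<zeta> x \<in> carrier G" "\<phi> (\<alpha> x) \<in> carrier G" if "x \<in> carrier G" for x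
    using \<alpha>\<zeta>[OF that] A_closed \<phi>_closed S_closed[OF i'(2)] by auto
  have s'_closed: "s' x \<in> carrier G" if "x \<in> carrier G" for x
    unfolding s'_def using \<alpha>c[OF that] s_closed r_closed that by simp
  have left: "S i #> s' (\<phi> b \<otimes> x) = S i #> (b \<otimes> s' x)" if b: "b \<in> A" and x: "x \<in> carrier G" for b x
  proof -
    have bc: "b \<in> carrier G" "\<phi> b \<in> carrier G" using b A_closed \<phi>_closed by auto
    have "R x (\<phi> b \<otimes> x)"
      unfolding R_def using b bc x
      by (intro bexI[of _ b] bexI[of _ \<one>]) (auto simp: subgroup.one_closed[OF SA])
    then have rr: "r (\<phi> b \<otimes> x) = r x" by (rule r_eq[OF _ x])
    have "\<phi> b \<otimes> x = \<phi> b \<otimes> (\<phi> (\<alpha> x) \<otimes> r x \<otimes> \<zeta> x)" using \<alpha>\<zeta>(3)[OF x] by simp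
    also have "\<dots> = \<phi> (b \<otimes> \<alpha> x) \<otimes> r x \<otimes> \<zeta> x"
      using \<phi>_mult[OF b \<alpha>\<zeta>(1)[OF x]] \<alpha>c[OF x] bc r_closed[OF x] by (simp add: m_assoc)
    finally have "S i #> s' (\<phi> b \<otimes> x) = S i #> (b \<otimes> \<alpha> x \<otimes> s (r x) \<otimes> \<zeta> x)"
      by (rule s'_eq[OF m_closed[OF bc(2) x] subgroup.m_closed[OF subgroup_A b \<alpha>\<zeta>(1)[OF x]]
            \<alpha>\<zeta>(2)[OF x], unfolded rr])
    also have "b \<otimes> \<alpha> x \<otimes> s (r x) \<otimes> \<zeta> x = b \<otimes> s' x"
      unfolding s'_def using \<alpha>c[OF x] bc s_closed[OF r_closed[OF x]] by (simp add: m_assoc)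
    finally show ?thesis .
  qed
  have right: "S i #> s' (x \<otimes> z) = S i #> (s' x \<otimes> z)" if x: "x \<in> carrier G" and z: "z \<in> S (Suc i)" for x z
  proof -
    have zc: "z \<in> carrier G" using S_closed[OF i'(2) z] .
    have "R x (x \<otimes> z)"
      unfolding R_def using z zc x \<phi>_one
      by (intro bexI[of _ \<one>] bexI[of _ z]) (auto simp: subgroup.one_closed[OF subgroup_A])
    then have rr: "r (x \<otimes> z) = r x" by (rule r_eq[OF _ x])
    have "x \<otimes> z = \<phi> (\<alpha> x) \<otimes> r x \<otimes> \<zeta> x \<otimes> z" using \<alpha>\<zeta>(3)[OF x] by simp
    also have "\<dots> = \<phi> (\<alpha> x) \<otimes> r x \<otimes> (\<zeta> x \<otimes> z)"
      using \<alpha>c[OF x] zc r_closed[OF x] by (simp add: m_assoc)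
    finally have "S i #> s' (x \<otimes> z) = S i #> (\<alpha> x \<otimes> s (r x) \<otimes> (\<zeta> x \<otimes> z))"
      by (rule s'_eq[OF m_closed[OF x zc] \<alpha>\<zeta>(1)[OF x]
            subgroup.m_closed[OF SA \<alpha>\<zeta>(2)[OF x] z], unfolded rr])
    also have "\<alpha> x \<otimes> s (r x) \<otimes> (\<zeta> x \<otimes> z) = s' x \<otimes> z"
      unfolding s'_def using \<alpha>c[OF x] zc s_closed[OF r_closed[OF x]] by (simp add: m_assoc)
    finally show ?thesis .
  qed
  \<comment> \<open>The lift agrees with \<open>s\<close> modulo \<open>S (Suc i)\<close>, so all
    conditions at higher levels are inherited.\<close>
  have same: "S (Suc i) #> s' x = S (Suc i) #> s x" if x: "x \<in> carrier G" for x
  proof -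
    note c = \<alpha>c[OF x] r_closed[OF x] s_closed[OF r_closed[OF x]]
    have "S (Suc i) #> s' x = S (Suc i) #> (\<alpha> x \<otimes> s (r x))"
      unfolding s'_def by (rule rcos_mult_right[OF i'(2) _ \<alpha>\<zeta>(2)[OF x]]) (use c in auto)
    also have "\<dots> = S (Suc i) #> s (\<phi> (\<alpha> x) \<otimes> r x)"
      using s \<alpha>\<zeta>(1)[OF x] c by (auto simp: equivariant_from_def)
    also have "\<dots> = S (Suc i) #> s (\<phi> (\<alpha> x) \<otimes> r x \<otimes> \<zeta> x)"
      using s \<alpha>\<zeta>(2)[OF x] c by (auto simp: equivariant_from_def)
    finally show ?thesis using \<alpha>\<zeta>(3)[OF x] by simp
  qed
  have above: "S j #> s' (x \<otimes> z) = S j #> (s' x \<otimes> z)"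
    if j: "Suc i \<le> j" "j < n" and x: "x \<in> carrier G" and z: "z \<in> S (Suc j)" for j x z
  proof -
    have zc: "z \<in> carrier G" using S_closed[OF _ z] j by simp
    have j': "j \<le> n" using j by simp
    have same_j: "S j #> s' y = S j #> s y" if y: "y \<in> carrier G" for y
      by (rule rcos_mono[OF j(1) j' s'_closed[OF y] s_closed[OF y] same[OF y]])
    have "S j #> s' (x \<otimes> z) = S j #> s (x \<otimes> z)" using same_j x zc by simp
    also have "\<dots> = S j #> (s x \<otimes> z)" using s j x z by (auto simp: equivariant_from_def)
    also have "\<dots> = S j #> (s' x \<otimes> z)"
      by (rule rcos_mult_cong[OF j' _ _ zc zc]) (use s_closed s'_closed same_j x in auto)
    finally show ?thesis .
  qed
  have "S i #> s' (x \<otimes> z) = S i #> s' x" if x: "x \<in> carrier G" and z: "z \<in> S i" for x z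
  proof -
    have "z \<in> S (Suc i)" using S_Suc[OF i] z by blast
    then show ?thesis using right[OF x] rcos_mult_right[OF i'(1) s'_closed[OF x] z] by simp
  qed
  moreover have "S j #> s' (x \<otimes> z) = S j #> (s' x \<otimes> z)"
    if "i \<le> j" "j < n" "x \<in> carrier G" "z \<in> S (Suc j)" for j x z
    using that right above[of j x z] by (cases "j = i") auto
  ultimately have "equivariant_from i s'"
    unfolding equivariant_from_def using s'_closed left by auto
  then show ?thesis by blast
qed

lemma ex_equivariant_tree_map:
  "\<exists>s. tree_map s \<and> (\<forall>a\<in>A. \<forall>x\<in>carrier G. s (\<phi> a \<otimes> x) = a \<otimes> s x)"
proof -
  have "\<exists>s. equivariant_from 0 s"
  proof (rule inc_induct[where P = "\<lambda>i. \<exists>s. equivariant_from i s" and i = 0 and j = n])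
    have top: "S n #> x = S n #> y" if "x \<in> carrier G" "y \<in> carrier G" for x y
      using that rcos_eq_iff[of n x y] by (simp add: S_n)
    have "S n #> (\<phi> a \<otimes> x) = S n #> (a \<otimes> x)" if "a \<in> A" "x \<in> carrier G" for a x
      using that A_closed \<phi>_closed by (intro top) auto
    moreover have "S n #> (x \<otimes> z) = S n #> x" if "x \<in> carrier G" "z \<in> S n" for x z
      using that S_n by (intro top) auto
    \<comment> \<open>Modulo \<open>S n\<close>, the whole group, all elements are congruent, so the
      identity starts the descent.\<close>
    ultimately have "equivariant_from n (\<lambda>x. x)"
      unfolding equivariant_from_def by auto
    then show "\<exists>s. equivariant_from n s" by blast
  qed (use equivariant_from_step in auto)
  then obtain s where s: "equivariant_from 0 s" by blast
  have s_closed: "s x \<in> carrier G" if "x \<in> carrier G" for x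
    using s that by (auto simp: equivariant_from_def)
  have "s (\<phi> a \<otimes> x) = a \<otimes> s x" if a: "a \<in> A" and x: "x \<in> carrier G" for a x
  proof -
    have c: "s (\<phi> a \<otimes> x) \<in> carrier G" "a \<otimes> s x \<in> carrier G"
      using a x s_closed A_closed \<phi>_closed by auto
    have "S 0 #> s (\<phi> a \<otimes> x) = S 0 #> (a \<otimes> s x)"
      using s a x by (simp add: equivariant_from_def)
    then obtain z where "z \<in> S 0" "s (\<phi> a \<otimes> x) = a \<otimes> s x \<otimes> z"
      using rcos_obtain[OF _ c(2,1)] by auto
    then show ?thesis using S_0 c by simp
  qed
  moreover have "tree_map s" using s by (simp add: tree_map_def equivariant_from_def)
  ultimately show ?thesis by blast
qed

lemma residually_finite_p_group_hnn_extension: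
  "residually_finite_p_group p (hnn_extension G A \<phi>)"
proof -
  let ?B = "BijGroup (carrier G)"
  obtain s where s: "tree_map s" "\<And>a x. a \<in> A \<Longrightarrow> x \<in> carrier G \<Longrightarrow> s (\<phi> a \<otimes> x) = a \<otimes> s x"
    using ex_equivariant_tree_map by blast
  define t where "t = restrict s (carrier G)"
  have t: "t \<in> tree_perms" unfolding t_def by (rule tree_perms_restrict[OF s(1)])
  have "hnn_faithful G ?B (left_mult G) A \<phi> t"
  proof (rule hnn_faithful_BijGroup[OF subgroup_A])
    show "t (\<phi> a \<otimes> x) = a \<otimes> t x" if "a \<in> A" "x \<in> carrier G" for a x
      using that s(2) \<phi>_closed by (simp add: t_def)
  qed (use \<phi>_closed t in \<open>auto simp: tree_perms_def\<close>)
  moreover have "left_mult G g \<in> tree_perms" if g: "g \<in> carrier G" for g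
    unfolding left_mult_def
  proof (rule tree_perms_restrict)
    have "g \<otimes> (x \<otimes> z) = g \<otimes> x \<otimes> z" if "j < n" "x \<in> carrier G" "z \<in> S (Suc j)" for j x z
      using g that S_closed[OF _ that(3)] by (simp add: m_assoc)
    then show "tree_map ((\<otimes>) g)" using g by (auto simp: tree_map_def)
  qed
  ultimately have faith: "hnn_faithful G (?B\<lparr>carrier := tree_perms\<rparr>) (left_mult G) A \<phi> t"
    using t by (intro hnn_faithful_subgroup subgroup_tree_perms) auto
  obtain Q :: "nat monoid" and \<kappa> where Q: "finite_p_group p Q" "\<kappa> \<in> iso (?B\<lparr>carrier := tree_perms\<rparr>) Q"
    using finite_p_group_nat_copy[OF finite_p_group_tree_perms] by blast
  have "group Q" using Q(1) by (simp add: finite_p_group_def)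
  then have "hnn_faithful G Q (\<kappa> \<circ> left_mult G) A \<phi> (\<kappa> t)"
    using Q(2) by (intro hnn_faithful_compose[OF faith]) (auto simp: iso_def bij_betw_def)
  then show ?thesis by (rule residually_finite_p_group_hnn[OF prime_p Q(1)])
qed

end

section \<open>Embedding the base group\<close>

text \<open>\<open>A\<close> acts freely on \<open>G\<close> by left multiplication, directly and
  through \<phi>. The orbits are the right cosets of \<open>A\<close> and of \<open>B\<close>, equal
  in number by Lagrange; matching them by a bijection \<beta> and matching base points gives the
  map.\<close>

lemma (in group) ex_equivariant_Bij:
  assumes fin: "finite (carrier G)" and AB: "subgroup A G" "subgroup B G"
    and \<phi>: "\<phi> \<in> iso (G\<lparr>carrier := A\<rparr>) (G\<lparr>carrier := B\<rparr>)"
  shows "\<exists>s\<in>Bij (carrier G). \<forall>a\<in>A. \<forall>x\<in>carrier G. s (\<phi> a \<otimes> x) = a \<otimes> s x"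
proof -
  have \<phi>': "bij_betw \<phi> A B" "\<And>a b. a \<in> A \<Longrightarrow> b \<in> A \<Longrightarrow> \<phi> (a \<otimes> b) = \<phi> a \<otimes> \<phi> b"
    using \<phi> by (auto simp: iso_def hom_def)
  have sub: "A \<subseteq> carrier G" "B \<subseteq> carrier G" using AB subgroup.subset by auto
  define \<psi> where "\<psi> = inv_into A \<phi>"
  have \<psi>: "\<psi> b \<in> A" "\<phi> (\<psi> b) = b" if "b \<in> B" for b
    using that \<phi>'(1) by (auto simp: \<psi>_def bij_betw_def inv_into_into f_inv_into_f)
  have \<psi>_mult: "\<psi> (\<phi> a \<otimes> b) = a \<otimes> \<psi> b" if a: "a \<in> A" and b: "b \<in> B" for a b
  proof -
    have "\<phi> a \<otimes> b = \<phi> (a \<otimes> \<psi> b)" using \<phi>'(2)[OF a \<psi>(1)[OF b]] \<psi>(2)[OF b] by simp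
    moreover have "a \<otimes> \<psi> b \<in> A" by (rule subgroup.m_closed[OF AB(1) a \<psi>(1)[OF b]])
    ultimately show ?thesis using \<phi>'(1) by (simp add: \<psi>_def bij_betw_def inv_into_f_f)
  qed
  have \<phi>B: "\<phi> a \<in> B" if "a \<in> A" for a using that \<phi>'(1) by (auto simp: bij_betw_def)
  have "card A = card B" using \<phi>'(1) by (rule bij_betw_same_card)
  moreover have "card B > 0" using AB(2) fin by (simp add: subgroup.finite_imp_card_positive)
  ultimately have "card (rcosets B) = card (rcosets A)"
    using lagrange[OF AB(1)] lagrange[OF AB(2)] by (metis mult_right_cancel not_gr_zero)
  moreover have "finite (rcosets A)" "finite (rcosets B)" using fin by (simp_all add: RCOSETS_def)
  ultimately obtain \<beta> where \<beta>: "bij_betw \<beta> (rcosets B) (rcosets A)"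
    using finite_same_card_bij by blast
  \<comment> \<open>Both base points depend on \<open>x\<close> only through its coset
    \<open>B #> x\<close>, so they do not change when \<open>x\<close> is multiplied by
    \<open>\<phi> a\<close>.\<close>
  define rB rA where "rB = (\<lambda>x. SOME y. y \<in> B #> x)" and "rA = (\<lambda>x. SOME y. y \<in> \<beta> (B #> x))"
  have cos: "B #> x \<in> rcosets B" if "x \<in> carrier G" for x using rcosetsI[OF sub(2) that] .
  have rB: "rB x \<in> B #> x" if "x \<in> carrier G" for x
    unfolding rB_def using rcos_self[OF that AB(2)] by (rule someI)
  have rA: "rA x \<in> \<beta> (B #> x)" if x: "x \<in> carrier G" for x
  proof -
    have "\<beta> (B #> x) \<in> rcosets A" using \<beta> cos[OF x] by (auto simp: bij_betw_def)
    then have "\<beta> (B #> x) \<noteq> {}" using rcos_self[OF _ AB(1)] by (auto simp: RCOSETS_def)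
    then show ?thesis unfolding rA_def by (simp add: some_in_eq)
  qed
  have rBc: "rB x \<in> carrier G" if "x \<in> carrier G" for x
    using rB[OF that] r_coset_subset_G[OF sub(2) that] by blast
  have rAc: "rA x \<in> carrier G" and A_rA: "A #> rA x = \<beta> (B #> x)" if x: "x \<in> carrier G" for x
  proof -
    have "\<beta> (B #> x) \<in> rcosets A" using \<beta> cos[OF x] by (auto simp: bij_betw_def)
    then obtain y where y: "y \<in> carrier G" "\<beta> (B #> x) = A #> y" by (auto simp: RCOSETS_def)
    show "rA x \<in> carrier G" using rA[OF x] r_coset_subset_G[OF sub(1) y(1)] y(2) by blast
    show "A #> rA x = \<beta> (B #> x)" using repr_independence[OF _ y(1) AB(1), of "rA x"] rA[OF x] y(2) by simp
  qed
  have quot: "x \<otimes> inv rB x \<in> B" if x: "x \<in> carrier G" for x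
  proof -
    obtain b where b: "b \<in> B" "rB x = b \<otimes> x" using rB[OF x] by (auto simp: r_coset_def)
    have "x \<otimes> inv rB x = inv b" unfolding b(2) using b(1) sub x by (simp add: inv_mult_group subset_iff) (simp flip: m_assoc)
    then show ?thesis using subgroup.m_inv_closed[OF AB(2) b(1)] by simp
  qed
  \<comment> \<open>Writing \<open>x\<close> as an element of \<open>B\<close> times the base point
    \<open>rB x\<close>, the first factor is transported by the inverse of \<phi> and the base point
    is exchanged for \<open>rA x\<close>.\<close>
  define s where "s = (\<lambda>x. \<psi> (x \<otimes> inv rB x) \<otimes> rA x)"
  have s_closed: "s x \<in> carrier G" if x: "x \<in> carrier G" for x
    unfolding s_def using \<psi>(1)[OF quot[OF x]] sub rAc[OF x] by auto
  have inj: "inj_on s (carrier G)"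
  proof (rule inj_onI)
    fix x y assume x: "x \<in> carrier G" and y: "y \<in> carrier G" and eq: "s x = s y"
    have A_s: "A #> s z = \<beta> (B #> z)" if z: "z \<in> carrier G" for z
    proof -
      have "s z \<in> A #> rA z" unfolding s_def r_coset_def using \<psi>(1)[OF quot[OF z]] by blast
      then show ?thesis using repr_independence[OF _ rAc[OF z] AB(1)] A_rA[OF z] by simp
    qed
    have "\<beta> (B #> x) = \<beta> (B #> y)" using A_s[OF x] A_s[OF y] eq by simp
    then have B: "B #> x = B #> y" using \<beta> cos[OF x] cos[OF y] by (auto simp: bij_betw_def dest: inj_onD)
    then have r: "rB x = rB y" "rA x = rA y" by (simp_all add: rB_def rA_def)
    have "\<psi> (x \<otimes> inv rB x) = \<psi> (y \<otimes> inv rB y)"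
      using eq r(2) subsetD[OF sub(1) \<psi>(1)[OF quot[OF x]]] subsetD[OF sub(1) \<psi>(1)[OF quot[OF y]]]
        rAc[OF y] by (simp add: s_def)
    then have "x \<otimes> inv rB x = y \<otimes> inv rB y" using \<psi>(2)[OF quot[OF x]] \<psi>(2)[OF quot[OF y]] by metis
    then have "x \<otimes> inv rB y = y \<otimes> inv rB y" unfolding r(1) .
    then show "x = y" using x y rBc[OF y] by simp
  qed
  moreover have "s ` carrier G \<subseteq> carrier G" using s_closed by auto
  ultimately have "bij_betw s (carrier G) (carrier G)"
    using endo_inj_surj[OF fin] by (simp add: bij_betw_def)
  then have "restrict s (carrier G) \<in> Bij (carrier G)" by (simp add: Bij_def)
  moreover have "s (\<phi> a \<otimes> x) = a \<otimes> s x" if a: "a \<in> A" and x: "x \<in> carrier G" for a x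
  proof -
    have c: "\<phi> a \<in> carrier G" "a \<in> carrier G" using a \<phi>B sub by auto
    have "B #> (\<phi> a \<otimes> x) = B #> x"
      using repr_independence[OF rcosI[OF \<phi>B[OF a] sub(2) x] x AB(2)] by simp
    then have r: "rB (\<phi> a \<otimes> x) = rB x" "rA (\<phi> a \<otimes> x) = rA x" by (simp_all add: rB_def rA_def)
    have "s (\<phi> a \<otimes> x) = \<psi> (\<phi> a \<otimes> (x \<otimes> inv rB x)) \<otimes> rA x"
      unfolding s_def r using c x rBc[OF x] by (simp add: m_assoc)
    also have "\<dots> = a \<otimes> s x"
      unfolding \<psi>_mult[OF a quot[OF x]] s_def
      by (rule m_assoc) (use c \<psi>(1)[OF quot[OF x]] sub rAc[OF x] in auto)
    finally show ?thesis .
  qed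
  moreover have "\<phi> a \<otimes> x \<in> carrier G" if "a \<in> A" "x \<in> carrier G" for a x
    using that subsetD[OF sub(2) \<phi>B[OF that(1)]] by simp
  ultimately show ?thesis by (intro bexI[of _ "restrict s (carrier G)"]) simp_all
qed

text \<open>By the universal property, the permutation representation on \<open>G\<close>, which is
  injective on the base, factors through \<open>hnn_base\<close>.\<close>

lemma hnn_base_inj:
  fixes G (structure)
  assumes "group G" and fin: "finite (carrier G)" and AB: "subgroup A G" "subgroup B G"
    and \<phi>: "\<phi> \<in> iso (G\<lparr>carrier := A\<rparr>) (G\<lparr>carrier := B\<rparr>)"
  shows "inj_on (hnn_base G A \<phi>) (carrier G)"
proof -
  interpret group G by fact
  obtain s where s: "s \<in> Bij (carrier G)" "\<And>a x. a \<in> A \<Longrightarrow> x \<in> carrier G \<Longrightarrow> s (\<phi> a \<otimes> x) = a \<otimes> s x"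
    using ex_equivariant_Bij[OF fin AB \<phi>] by blast
  have "\<phi> ` A \<subseteq> carrier G" using \<phi> subgroup.subset[OF AB(2)] by (auto simp: iso_def bij_betw_def)
  then interpret hnn_faithful G "BijGroup (carrier G)" "left_mult G" A \<phi> s
    using s AB(1) by (intro hnn_faithful_BijGroup)
  obtain h where h: "\<And>g. g \<in> carrier G \<Longrightarrow> h (hnn_base G A \<phi> g) = left_mult G g"
    using hnn_universal by blast
  show ?thesis using inj_f h by (metis (no_types, lifting) inj_on_def)
qed

text \<open>Separating homomorphisms are combined in a direct product. Only a homomorphism is
  claimed, because the image need not fill the product.\<close>

lemma residually_finite_p_group_finite_subset:
  assumes H: "group H" "residually_finite_p_group p H"
    and F: "finite F" "F \<subseteq> carrier H - {\<one>\<^bsub>H\<^esub>}"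
  shows "\<exists>(P :: nat monoid) h. finite_p_group p P \<and> h \<in> hom H P \<and> (\<forall>x\<in>F. h x \<noteq> \<one>\<^bsub>P\<^esub>)"
  using F
proof (induction F rule: finite_induct)
  case empty
  have "finite_p_group p (singleton_group (0 :: nat))"
    by (auto simp: finite_p_group_def order_def intro: exI[of _ 0])
  moreover have "(\<lambda>x. 0) \<in> hom H (singleton_group (0 :: nat))"
    by (simp add: hom_def singleton_group_def)
  ultimately show ?case by blast
next
  case (insert x F)
  obtain P :: "nat monoid" and h where P: "finite_p_group p P" "h \<in> hom H P" "\<forall>x\<in>F. h x \<noteq> \<one>\<^bsub>P\<^esub>"
    using insert by blast
  obtain P' :: "nat monoid" and h' where P': "finite_p_group p P'" "h' \<in> epi H P'" "h' x \<noteq> \<one>\<^bsub>P'\<^esub>"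
    using H(2) insert.prems unfolding residually_finite_p_group_def by blast
  have h': "h' \<in> hom H P'" using P'(2) by (simp add: epi_def)
  define k where "k = (\<lambda>y. (h y, h' y))"
  have k: "k \<in> hom H (P \<times>\<times> P')"
    using P(2) h' by (auto simp: k_def hom_def)
  obtain Q :: "nat monoid" and \<kappa> where Q: "finite_p_group p Q" "\<kappa> \<in> iso (P \<times>\<times> P') Q"
    using finite_p_group_nat_copy[OF finite_p_group_DirProd[OF P(1) P'(1)]] by blast
  have grp: "group (P \<times>\<times> P')" "group Q"
    using finite_p_group_DirProd[OF P(1) P'(1)] Q(1) by (auto simp: finite_p_group_def)
  have \<kappa>: "\<kappa> \<in> hom (P \<times>\<times> P') Q" "inj_on \<kappa> (carrier (P \<times>\<times> P'))"
    using Q(2) by (auto simp: iso_def bij_betw_def)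
  have "(\<kappa> \<circ> k) y \<noteq> \<one>\<^bsub>Q\<^esub>" if y: "y \<in> insert x F" for y
  proof
    assume "(\<kappa> \<circ> k) y = \<one>\<^bsub>Q\<^esub>"
    then have "\<kappa> (k y) = \<kappa> \<one>\<^bsub>P \<times>\<times> P'\<^esub>" using hom_one[OF \<kappa>(1) grp] by simp
    moreover have "k y \<in> carrier (P \<times>\<times> P')" using k y insert.prems by (auto simp: hom_def)
    ultimately have "k y = \<one>\<^bsub>P \<times>\<times> P'\<^esub>"
      using inj_onD[OF \<kappa>(2)] group.is_monoid[OF grp(1)] monoid.one_closed by blast
    then show False using y P(3) P'(3) by (auto simp: k_def)
  qed
  moreover have "\<kappa> \<circ> k \<in> hom H Q" by (rule Group.hom_compose[OF k \<kappa>(1)])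
  ultimately show ?case using Q(1) by blast
qed

section \<open>Central series\<close>

text \<open>For normal subgroups: the factor is central and either trivial or of prime order. The
  latter is phrased as every element of \<open>M\<close> outside \<open>N\<close> generating
  \<open>M\<close> modulo \<open>N\<close>, which can be read off directly after pulling back along
  an injective map.\<close>

definition central_cyclic_factor :: "('a, 'b) monoid_scheme \<Rightarrow> 'a set \<Rightarrow> 'a set \<Rightarrow> bool" where
  "central_cyclic_factor G N M \<longleftrightarrow> N \<subseteq> M \<and>
     (\<forall>z\<in>M. \<forall>g\<in>carrier G. N #>\<^bsub>G\<^esub> (g \<otimes>\<^bsub>G\<^esub> z) = N #>\<^bsub>G\<^esub> (z \<otimes>\<^bsub>G\<^esub> g)) \<and>
     (\<forall>x\<in>M - N. \<forall>y\<in>M. \<exists>k::nat. N #>\<^bsub>G\<^esub> y = N #>\<^bsub>G\<^esub> (x [^]\<^bsub>G\<^esub> k))"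

text \<open>Among the elements outside \<open>N\<close> that are central modulo \<open>N\<close>,
  take \<open>x\<close> whose cyclic preimage \<open>C x\<close> is smallest. Any \<open>x'\<close>
  in \<open>C x - N\<close> has \<open>C x' \<subseteq> C x\<close>, and by minimality equality, so
  \<open>x'\<close> generates the factor as well.\<close>

lemma ex_central_cyclic_factor:
  fixes G (structure)
  assumes p: "prime p" and G: "finite_p_group p G" and N: "N \<lhd> G" "N \<noteq> carrier G"
  shows "\<exists>M. M \<lhd> G \<and> N \<subset> M \<and> central_cyclic_factor G N M"
proof -
  interpret N: normal N G by (rule N)
  define Q q where "Q = G Mod N" and "q = (\<lambda>x. N #> x)"
  interpret q: group_hom G Q q unfolding Q_def q_def by (rule N.rcos_group_hom)
  have q_one: "q x = \<one>\<^bsub>Q\<^esub> \<longleftrightarrow> x \<in> N" if "x \<in> carrier G" for x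
    using N.rcos_eq_one_iff[OF that] by (simp add: Q_def q_def)
  have fin: "finite (carrier G)" using G by (simp add: finite_p_group_def)
  define Z where "Z = {z \<in> carrier G. \<forall>g\<in>carrier G. q g \<otimes>\<^bsub>Q\<^esub> q z = q z \<otimes>\<^bsub>Q\<^esub> q g}"
  define C where "C = (\<lambda>x. {y \<in> carrier G. \<exists>k::nat. q y = q x [^]\<^bsub>Q\<^esub> k})"
  have "N \<subset> carrier G" using N N.subset by blast
  then obtain z where z: "z \<in> carrier G - N" "\<forall>g\<in>carrier G. N #> (g \<otimes> z) = N #> (z \<otimes> g)"
    using exists_central_mod[OF p G N(1) N.normal_self] by blast
  then have "z \<in> Z - N" by (simp add: Z_def flip: q.hom_mult) (simp add: q_def)
  then obtain x where x: "x \<in> Z - N" "\<And>y. y \<in> Z - N \<Longrightarrow> card (C x) \<le> card (C y)"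
    using ex_has_least_nat[of "\<lambda>x. x \<in> Z - N" z "\<lambda>x. card (C x)"] by blast
  have xG: "x \<in> carrier G" using x by (simp add: Z_def)
  have CZ: "C x \<subseteq> Z"
  proof
    fix y assume "y \<in> C x"
    then obtain k :: nat where y: "y \<in> carrier G" "q y = q x [^]\<^bsub>Q\<^esub> k" by (auto simp: C_def)
    have "q g \<otimes>\<^bsub>Q\<^esub> q y = q y \<otimes>\<^bsub>Q\<^esub> q g" if g: "g \<in> carrier G" for g
      unfolding y(2) using x(1) g xG q.H.group_commutes_pow[of "q x" "q g" k] by (simp add: Z_def)
    then show "y \<in> Z" using y(1) by (simp add: Z_def)
  qed
  have sub: "subgroup (C x) G"
  proof (rule N.subgroupI)
    show "C x \<subseteq> carrier G" by (auto simp: C_def)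
    have "\<one> \<in> C x" by (auto simp: C_def intro: exI[of _ 0])
    then show "C x \<noteq> {}" by blast
  next
    fix y assume "y \<in> C x"
    then obtain k :: nat where y: "y \<in> carrier G" "q y = q x [^]\<^bsub>Q\<^esub> k" by (auto simp: C_def)
    have "order G > 0" using fin N.order_gt_0_iff_finite by simp
    then have o: "order G - 1 + 1 = order G" by simp
    \<comment> \<open>Only natural exponents are allowed in \<open>C\<close>, so the inverse is
      written as the power with exponent \<open>order G - 1\<close>.\<close>
    have "q y [^]\<^bsub>Q\<^esub> (order G - 1) \<otimes>\<^bsub>Q\<^esub> q y = q y [^]\<^bsub>Q\<^esub> order G"
      using o q.H.nat_pow_Suc[of "q y" "order G - 1"] by simp
    also have "\<dots> = q (y [^] order G)" using y(1) by (simp add: q.hom_nat_pow)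
    also have "\<dots> = \<one>\<^bsub>Q\<^esub>" using N.pow_order_eq_1[OF y(1)] by simp
    finally have "inv\<^bsub>Q\<^esub> q y = q y [^]\<^bsub>Q\<^esub> (order G - 1)"
      using y(1) by (intro q.H.inv_equality) auto
    then have "q (inv y) = q x [^]\<^bsub>Q\<^esub> (k * (order G - 1))"
      using y xG by (simp add: q.H.nat_pow_pow)
    then show "inv y \<in> C x" using y(1) by (auto simp: C_def)
  next
    fix y y' assume "y \<in> C x" "y' \<in> C x"
    then obtain k k' :: nat where "y \<in> carrier G" "q y = q x [^]\<^bsub>Q\<^esub> k"
      "y' \<in> carrier G" "q y' = q x [^]\<^bsub>Q\<^esub> k'" by (auto simp: C_def)
    then have "y \<otimes> y' \<in> carrier G" "q (y \<otimes> y') = q x [^]\<^bsub>Q\<^esub> (k + k')"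
      using xG by (simp_all add: q.H.nat_pow_mult)
    then show "y \<otimes> y' \<in> C x" by (auto simp: C_def)
  qed
  have "C x \<lhd> G"
  proof (rule N.normal_invI[OF sub])
    fix g y assume g: "g \<in> carrier G" and y: "y \<in> C x"
    have yG: "y \<in> carrier G" using y by (simp add: C_def)
    have comm: "q g \<otimes>\<^bsub>Q\<^esub> q y = q y \<otimes>\<^bsub>Q\<^esub> q g" using CZ y g by (auto simp: Z_def)
    have "q (g \<otimes> y \<otimes> inv g) = q y" using g yG comm by (simp add: q.H.m_assoc)
    then show "g \<otimes> y \<otimes> inv g \<in> C x" using y g yG by (simp add: C_def)
  qed
  moreover have NC: "N \<subseteq> C x"
  proof
    fix y assume y: "y \<in> N"
    then have "q y = q x [^]\<^bsub>Q\<^esub> (0::nat)" using q_one by simp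
    then show "y \<in> C x" using y N.mem_carrier unfolding C_def by blast
  qed
  moreover have "x \<in> C x" using xG by (auto simp: C_def intro!: exI[of _ 1])
  moreover have "central_cyclic_factor G N (C x)"
    unfolding central_cyclic_factor_def
  proof (intro conjI ballI)
    fix z g assume "z \<in> C x" and g: "g \<in> carrier G"
    then have "z \<in> carrier G" "q g \<otimes>\<^bsub>Q\<^esub> q z = q z \<otimes>\<^bsub>Q\<^esub> q g" using CZ by (auto simp: Z_def)
    then have "q (g \<otimes> z) = q (z \<otimes> g)" using g by simp
    then show "N #> (g \<otimes> z) = N #> (z \<otimes> g)" by (simp add: q_def)
  next
    fix x' y assume x': "x' \<in> C x - N" and y: "y \<in> C x"
    obtain k :: nat where k: "x' \<in> carrier G" "q x' = q x [^]\<^bsub>Q\<^esub> k" using x' by (auto simp: C_def)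
    have "C x' \<subseteq> C x"
      using k xG by (auto simp: C_def q.H.nat_pow_pow)
    moreover have "x' \<in> Z - N" using x' CZ by blast
    ultimately have "C x' = C x"
      using x(2) fin by (metis (no_types, lifting) C_def card_seteq finite_subset mem_Collect_eq subsetI)
    then have "y \<in> C x'" using y by simp
    then obtain l :: nat where "q y = q x' [^]\<^bsub>Q\<^esub> l" by (auto simp: C_def)
    then have "q y = q (x' [^] l)" using k(1) by (simp add: q.hom_nat_pow)
    then show "\<exists>l::nat. N #> y = N #> (x' [^] l)" unfolding q_def by blast
  qed (rule NC)
  ultimately show ?thesis using x(1) by blast
qed

lemma ex_central_series_from:
  assumes p: "prime p" and G: "finite_p_group p G" and N: "N \<lhd> G"
  shows "\<exists>m T. T 0 = N \<and> T m = carrier G \<and> (\<forall>i\<le>m. T i \<lhd> G) \<and>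
    (\<forall>i<m. central_cyclic_factor G (T i) (T (Suc i)))"
  using N
proof (induction "card (carrier G - N)" arbitrary: N rule: less_induct)
  case less
  show ?case
  proof (cases "N = carrier G")
    case True
    then show ?thesis using less.prems by (intro exI[of _ 0] exI[of _ "\<lambda>_. N"]) auto
  next
    case False
    obtain M where M: "M \<lhd> G" "N \<subset> M" "central_cyclic_factor G N M"
      using ex_central_cyclic_factor[OF p G less.prems False] by blast
    have "M \<subseteq> carrier G" using M(1) by (simp add: normal_imp_subgroup subgroup.subset)
    then have "carrier G - M \<subset> carrier G - N" using M(2) by blast
    then have "card (carrier G - M) < card (carrier G - N)"
      using G by (intro psubset_card_mono) (auto simp: finite_p_group_def)
    then obtain m T where T: "T 0 = M" "T m = carrier G" "\<forall>i\<le>m. T i \<lhd> G"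
      "\<forall>i<m. central_cyclic_factor G (T i) (T (Suc i))"
      using less.hyps[OF _ M(1)] by metis
    define T' where "T' = (\<lambda>i. case i of 0 \<Rightarrow> N | Suc j \<Rightarrow> T j)"
    have T': "T' 0 = N" "\<And>j. T' (Suc j) = T j" by (simp_all add: T'_def)
    have "T' i \<lhd> G" if "i \<le> Suc m" for i
      using that T(3) T' less.prems by (cases i) auto
    moreover have "central_cyclic_factor G (T' i) (T' (Suc i))" if "i < Suc m" for i
      using that T(1,4) T' M(3) by (cases i) auto
    ultimately show ?thesis
      using T' T(2) by (intro exI[of _ "Suc m"] exI[of _ T']) auto
  qed
qed

text \<open>A pulled-back series may repeat terms, whereas a chief series is strict. The repetitions
  are deleted while recording that neighbours in \<open>S\<close> are still neighbours in
  \<open>T\<close>, so statements about single factors carry over.\<close>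

lemma strict_subchain:
  fixes T :: "nat \<Rightarrow> 'a set"
  assumes "\<And>i. i < m \<Longrightarrow> T i \<subseteq> T (Suc i)"
  shows "\<exists>n S. S 0 = T 0 \<and> S n = T m \<and> (\<forall>i\<le>n. \<exists>j\<le>m. S i = T j) \<and>
    (\<forall>i<n. S i \<subset> S (Suc i) \<and> (\<exists>j<m. S i = T j \<and> S (Suc i) = T (Suc j)))"
  using assms
proof (induction m)
  case 0
  show ?case by (intro exI[of _ 0] exI[of _ T]) auto
next
  case (Suc m)
  then obtain n S where S: "S 0 = T 0" "S n = T m" "\<forall>i\<le>n. \<exists>j\<le>m. S i = T j"
    "\<forall>i<n. S i \<subset> S (Suc i) \<and> (\<exists>j<m. S i = T j \<and> S (Suc i) = T (Suc j))"
    by (metis less_SucI)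
  show ?case
  proof (cases "T m = T (Suc m)")
    case True
    then show ?thesis using S by (intro exI[of _ n] exI[of _ S]) (metis le_SucI less_SucI)
  next
    case False
    then have TT: "T m \<subset> T (Suc m)" using Suc.prems[of m] by blast
    define S' where "S' = S(Suc n := T (Suc m))"
    have low: "S' i = S i" if "i \<le> n" for i using that by (simp add: S'_def)
    have top: "S' (Suc n) = T (Suc m)" by (simp add: S'_def)
    have "\<exists>j\<le>Suc m. S' i = T j" if "i \<le> Suc n" for i
      using that S(3) low top by (cases "i = Suc n") (auto, metis le_SucI le_SucE)
    moreover have "S' i \<subset> S' (Suc i) \<and> (\<exists>j<Suc m. S' i = T j \<and> S' (Suc i) = T (Suc j))"
      if "i < Suc n" for i
    proof (cases "i = n")
      case True
      then show ?thesis using S(2) TT low[of n] top by auto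
    next
      case False
      then have "i < n" using that by simp
      then show ?thesis using S(4) low[of i] low[of "Suc i"] by (metis Suc_leI less_SucI less_imp_le)
    qed
    ultimately show ?thesis
      using S(1) low[of 0] top by (intro exI[of _ "Suc n"] exI[of _ S']) auto
  qed
qed

section \<open>Pulling back central series\<close>

lemma (in group_hom) normal_vimage_hom:
  assumes "N \<lhd> H"
  shows "{x \<in> carrier G. h x \<in> N} \<lhd> G"
proof -
  interpret N: normal N H by fact
  show ?thesis
  proof (rule G.normal_invI)
    show "subgroup {x \<in> carrier G. h x \<in> N} G"
    proof (rule G.subgroupI)
      have "\<one> \<in> {x \<in> carrier G. h x \<in> N}" using subgroup.one_closed[OF N.is_subgroup] by simp
      then show "{x \<in> carrier G. h x \<in> N} \<noteq> {}" by blast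
    qed (auto simp: subgroup.m_closed[OF N.is_subgroup] subgroup.m_inv_closed[OF N.is_subgroup])
  qed (use N.inv_op_closed2 in auto)
qed

text \<open>The series consists of the distinct preimages under \<open>f\<close> of a central series
  of \<open>P\<close>. Normality of its terms in \<open>P\<close> gives (1), centrality gives (2),
  and the generation property of the factors excludes refinements.\<close>

lemma hnn_faithful_chief_series:
  fixes G (structure)
  assumes p: "prime p" and P: "finite_p_group p P" and faith: "hnn_faithful G P f A \<phi> t"
  shows "\<exists>n S. chief_series G n S \<and>
    (\<forall>i\<le>n. \<phi> ` (A \<inter> S i) = \<phi> ` A \<inter> S i) \<and>
    (\<forall>i<n. \<forall>a\<in>A \<inter> S (Suc i). \<phi> a <# S i = a <# S i)"
proof -
  interpret hnn_faithful G P f A \<phi> t by (rule faith)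
  obtain m T where T: "T 0 = {\<one>\<^bsub>P\<^esub>}" "T m = carrier P" "\<And>i. i \<le> m \<Longrightarrow> T i \<lhd> P"
    "\<And>i. i < m \<Longrightarrow> central_cyclic_factor P (T i) (T (Suc i))"
    using ex_central_series_from[OF p P H.one_is_normal] by blast
  define U where "U = (\<lambda>i. {g \<in> carrier G. f g \<in> T i})"
  have U_normal: "U i \<lhd> G" if "i \<le> m" for i
    unfolding U_def by (rule normal_vimage_hom[OF T(3)[OF that]])
  have U_mono: "U i \<subseteq> U (Suc i)" if "i < m" for i
    using T(4)[OF that] by (auto simp: U_def central_cyclic_factor_def)
  have "\<exists>n S. S 0 = U 0 \<and> S n = U m \<and> (\<forall>i\<le>n. \<exists>j\<le>m. S i = U j) \<and>
    (\<forall>i<n. S i \<subset> S (Suc i) \<and> (\<exists>j<m. S i = U j \<and> S (Suc i) = U (Suc j)))"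
    by (rule strict_subchain) (rule U_mono)
  then obtain n S where S': "S 0 = U 0" "S n = U m" "\<forall>i\<le>n. \<exists>j\<le>m. S i = U j"
    "\<forall>i<n. S i \<subset> S (Suc i) \<and> (\<exists>j<m. S i = U j \<and> S (Suc i) = U (Suc j))"
    by (elim exE conjE) (rule that)
  have S: "S 0 = U 0" "S n = U m" "\<And>i. i \<le> n \<Longrightarrow> \<exists>j\<le>m. S i = U j"
    "\<And>i. i < n \<Longrightarrow> S i \<subset> S (Suc i)"
    "\<And>i. i < n \<Longrightarrow> \<exists>j<m. S i = U j \<and> S (Suc i) = U (Suc j)"
    using S' by auto
  have cong: "inv x \<otimes> y \<in> U j"
    if j: "j < m" and xy: "x \<in> carrier G" "y \<in> carrier G" and eq: "T j #>\<^bsub>P\<^esub> f y = T j #>\<^bsub>P\<^esub> f x" for j x y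
  proof -
    interpret N: normal "T j" P using T(3) j by simp
    have "inv y \<otimes> x \<in> U j"
    proof -
      have "f y \<otimes>\<^bsub>P\<^esub> inv\<^bsub>P\<^esub> f x \<in> T j" using eq xy by (simp add: N.rcos_eq_iff)
      then have "inv\<^bsub>P\<^esub> f x \<otimes>\<^bsub>P\<^esub> (f y \<otimes>\<^bsub>P\<^esub> inv\<^bsub>P\<^esub> f x) \<otimes>\<^bsub>P\<^esub> f x \<in> T j"
        using xy by (intro N.inv_op_closed1) auto
      then have "inv\<^bsub>P\<^esub> (inv\<^bsub>P\<^esub> f x \<otimes>\<^bsub>P\<^esub> f y) \<in> T j"
        using xy by (intro N.m_inv_closed) (simp add: H.m_assoc)
      then show ?thesis using xy by (simp add: U_def H.inv_mult_group)
    qed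
    then have "inv (inv y \<otimes> x) \<in> U j"
      using U_normal[of j] j by (intro subgroup.m_inv_closed[OF normal_imp_subgroup]) auto
    then show ?thesis using xy by (simp add: G.inv_mult_group)
  qed
  have "chief_series G n S"
    unfolding chief_series_def
  proof (intro conjI allI impI)
    show "S 0 = {\<one>}"
    proof -
      have "g = \<one>" if "g \<in> carrier G" "f g = \<one>\<^bsub>P\<^esub>" for g
        using inj_onD[OF inj_f, of g \<one>] that by simp
      then show ?thesis unfolding S(1) U_def T(1) by auto
    qed
    show "S n = carrier G" unfolding S(2) U_def T(2) by auto
    show "S i \<lhd> G" if "i \<le> n" for i using S(3)[OF that] U_normal by auto
    show "S i \<subset> S (Suc i)" if "i < n" for i by (rule S(4)[OF that])
    fix i assume i: "i < n"
    obtain j where j: "j < m" "S i = U j" "S (Suc i) = U (Suc j)" using S(5)[OF i] by blast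
    show "\<not> (\<exists>N. N \<lhd> G \<and> S i \<subset> N \<and> N \<subset> S (Suc i))"
    proof
      assume "\<exists>N. N \<lhd> G \<and> S i \<subset> N \<and> N \<subset> S (Suc i)"
      then obtain N where N: "subgroup N G" "U j \<subset> N" "N \<subset> U (Suc j)"
        unfolding j(2,3) using normal_imp_subgroup by blast
      \<comment> \<open>The image of \<open>x\<close> generates the factor of \<open>P\<close>, so
        \<open>y\<close> is a power of \<open>x\<close> modulo \<open>U j\<close>. As
        \<open>N\<close> contains both \<open>x\<close> and \<open>U j\<close>, it contains
        \<open>y\<close>.\<close>
      obtain x where x: "x \<in> N" "x \<notin> U j" using N(2) by blast
      obtain y where y: "y \<in> U (Suc j)" "y \<notin> N" using N(3) by blast
      have xU: "x \<in> U (Suc j)" using x(1) N(3) by blast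
      have c: "x \<in> carrier G" "y \<in> carrier G" using xU y(1) by (auto simp: U_def)
      have "f x \<in> T (Suc j) - T j" "f y \<in> T (Suc j)" using x(2) xU y(1) by (auto simp: U_def)
      then obtain k :: nat where "T j #>\<^bsub>P\<^esub> f y = T j #>\<^bsub>P\<^esub> (f x [^]\<^bsub>P\<^esub> k)"
        using T(4)[OF j(1)] unfolding central_cyclic_factor_def by blast
      then have "inv (x [^] k) \<otimes> y \<in> U j"
        using c by (intro cong[OF j(1)]) (simp_all add: hom_nat_pow)
      then have "inv (x [^] k) \<otimes> y \<in> N" using N(2) by blast
      then have "x [^] k \<otimes> (inv (x [^] k) \<otimes> y) \<in> N"
        by (rule subgroup.m_closed[OF N(1) G.subgroup_nat_pow_mem[OF N(1) x(1)]])
      then show False using y(2) c by (simp flip: G.m_assoc)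
    qed
  qed
  moreover have "\<phi> ` (A \<inter> S i) = \<phi> ` A \<inter> S i" if i: "i \<le> n" for i
  proof -
    obtain j where j: "j \<le> m" "S i = U j" using S(3)[OF i] by blast
    interpret N: normal "T j" P by (rule T(3)[OF j(1)])
    \<comment> \<open>\<open>f a\<close> and \<open>f (\<phi> a)\<close> are conjugate by
      \<open>t\<close>, and \<open>T j\<close> is normal in \<open>P\<close>.\<close>
    have "\<phi> a \<in> U j \<longleftrightarrow> a \<in> U j" if a: "a \<in> A" for a
    proof -
      have c: "a \<in> carrier G" "\<phi> a \<in> carrier G" using a A_subset \<phi>_closed by auto
      have fa: "f a = t \<otimes>\<^bsub>P\<^esub> f (\<phi> a) \<otimes>\<^bsub>P\<^esub> inv\<^bsub>P\<^esub> t"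
        using t_rel[OF a] c by (simp flip: t_rel[OF a] add: H.m_assoc)
      have f\<phi>: "f (\<phi> a) = inv\<^bsub>P\<^esub> t \<otimes>\<^bsub>P\<^esub> f a \<otimes>\<^bsub>P\<^esub> t"
        using t_rel_inv[OF a] c by (simp add: H.m_assoc)
      have "f a \<in> T j" if "f (\<phi> a) \<in> T j"
        unfolding fa by (rule N.inv_op_closed2[OF t_closed that])
      moreover have "f (\<phi> a) \<in> T j" if "f a \<in> T j"
        unfolding f\<phi> by (rule N.inv_op_closed1[OF t_closed that])
      ultimately show ?thesis using c by (auto simp: U_def)
    qed
    then show ?thesis unfolding j(2) by auto
  qed
  moreover have "\<phi> a <# S i = a <# S i" if i: "i < n" and a: "a \<in> A \<inter> S (Suc i)" for i a
  proof -
    obtain j where j: "j < m" "S i = U j" "S (Suc i) = U (Suc j)" using S(5)[OF i] by blast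
    have c: "a \<in> carrier G" "\<phi> a \<in> carrier G" using a A_subset \<phi>_closed by auto
    have j': "j \<le> m" using j(1) by simp
    interpret N: normal "T j" P by (rule T(3)[OF j'])
    interpret U: normal "U j" G by (rule U_normal[OF j'])
    have "a \<in> U (Suc j)" using a unfolding j(3) by blast
    then have "f a \<in> T (Suc j)" unfolding U_def by blast
    \<comment> \<open>Centrality lets \<open>t\<close> pass \<open>f a\<close> modulo
      \<open>T j\<close>, while the relation turns \<open>f a\<close> into
      \<open>f (\<phi> a)\<close> behind \<open>t\<close>; conjugating by \<open>t\<close> then
      compares \<open>a\<close> with \<open>\<phi> a\<close>.\<close>
    then have "T j #>\<^bsub>P\<^esub> (t \<otimes>\<^bsub>P\<^esub> f a) = T j #>\<^bsub>P\<^esub> (f a \<otimes>\<^bsub>P\<^esub> t)"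
      using T(4)[OF j(1)] t_closed unfolding central_cyclic_factor_def by metis
    also have "f a \<otimes>\<^bsub>P\<^esub> t = t \<otimes>\<^bsub>P\<^esub> f (\<phi> a)" using t_rel a by blast
    finally have "(t \<otimes>\<^bsub>P\<^esub> f a) \<otimes>\<^bsub>P\<^esub> inv\<^bsub>P\<^esub> (t \<otimes>\<^bsub>P\<^esub> f (\<phi> a)) \<in> T j"
      using N.rcos_eq_iff[of "t \<otimes>\<^bsub>P\<^esub> f a" "t \<otimes>\<^bsub>P\<^esub> f (\<phi> a)"] c by simp
    then have "inv\<^bsub>P\<^esub> t \<otimes>\<^bsub>P\<^esub> ((t \<otimes>\<^bsub>P\<^esub> f a) \<otimes>\<^bsub>P\<^esub> inv\<^bsub>P\<^esub> (t \<otimes>\<^bsub>P\<^esub> f (\<phi> a))) \<otimes>\<^bsub>P\<^esub> t \<in> T j"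
      by (rule N.inv_op_closed1[OF t_closed])
    moreover have "inv\<^bsub>P\<^esub> t \<otimes>\<^bsub>P\<^esub> ((t \<otimes>\<^bsub>P\<^esub> f a) \<otimes>\<^bsub>P\<^esub> inv\<^bsub>P\<^esub> (t \<otimes>\<^bsub>P\<^esub> f (\<phi> a))) \<otimes>\<^bsub>P\<^esub> t = f (a \<otimes> inv \<phi> a)"
      using c by (simp add: H.inv_mult_group H.m_assoc) (simp flip: H.m_assoc)
    ultimately have "f (a \<otimes> inv \<phi> a) \<in> T j" by (simp only:)
    moreover have "a \<otimes> inv \<phi> a \<in> carrier G" using c by (intro G.m_closed G.inv_closed)
    ultimately have "a \<otimes> inv \<phi> a \<in> U j" unfolding U_def by blast
    then have "U j #> a = U j #> \<phi> a" using U.rcos_eq_iff[OF c] by blast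
    then show ?thesis unfolding j(2) using U.lcos_eq_rcos[OF c(1)] U.lcos_eq_rcos[OF c(2)] by metis
  qed
  ultimately show ?thesis by blast
qed

text \<open>\<open>G\<close> is finite and embeds, so its non-identity elements give finitely many
  non-trivial elements of the extension. One homomorphism that kills none of them is injective on
  \<open>G\<close>.\<close>

lemma residually_finite_p_group_hnn_faithful:
  assumes G: "group G" "finite (carrier G)" and AB: "subgroup A G" "subgroup B G"
    and \<phi>: "\<phi> \<in> iso (G\<lparr>carrier := A\<rparr>) (G\<lparr>carrier := B\<rparr>)"
    and res: "residually_finite_p_group p (hnn_extension G A \<phi>)"
  shows "\<exists>(P :: nat monoid) f t. finite_p_group p P \<and> hnn_faithful G P f A \<phi> t"
proof -
  let ?H = "hnn_extension G A \<phi>" and ?b = "hnn_base G A \<phi>"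
  have "\<phi> ` A \<subseteq> carrier G"
    using \<phi> subgroup.subset[OF AB(2)] by (auto simp: iso_def bij_betw_def)
  then interpret rep: hnn_rep G ?H ?b A \<phi> "hnn_stable G A \<phi>"
    by (rule hnn_rep_extension[OF G(1) subgroup.subset[OF AB(1)]])
  have inj: "inj_on ?b (carrier G)" by (rule hnn_base_inj[OF G AB \<phi>])
  define F where "F = ?b ` (carrier G - {\<one>\<^bsub>G\<^esub>})"
  have "F \<subseteq> carrier ?H - {\<one>\<^bsub>?H\<^esub>}"
  proof
    fix x assume "x \<in> F"
    then obtain g where g: "g \<in> carrier G" "g \<noteq> \<one>\<^bsub>G\<^esub>" "x = ?b g" by (auto simp: F_def)
    then have "x \<noteq> ?b \<one>\<^bsub>G\<^esub>" using inj_onD[OF inj, of g "\<one>\<^bsub>G\<^esub>"] by auto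
    then show "x \<in> carrier ?H - {\<one>\<^bsub>?H\<^esub>}" using g by simp
  qed
  moreover have "finite F" using G(2) by (simp add: F_def)
  ultimately obtain P :: "nat monoid" and h
    where P: "finite_p_group p P" "h \<in> hom ?H P" "\<forall>x\<in>F. h x \<noteq> \<one>\<^bsub>P\<^esub>"
    using residually_finite_p_group_finite_subset[OF group_hnn_extension res] by blast
  have "group P" using P(1) by (simp add: finite_p_group_def)
  then interpret hnn_rep G P "h \<circ> ?b" A \<phi> "h (hnn_stable G A \<phi>)"
    by (rule hnn_rep_compose[OF rep.hnn_rep_axioms _ P(2)])
  have "inj_on (h \<circ> ?b) (carrier G)"
  proof (rule inj_onI)
    fix x y assume x: "x \<in> carrier G" and y: "y \<in> carrier G" and eq: "(h \<circ> ?b) x = (h \<circ> ?b) y"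
    have xy: "x \<otimes>\<^bsub>G\<^esub> inv\<^bsub>G\<^esub> y \<in> carrier G" using x y by simp
    have "(h \<circ> ?b) (x \<otimes>\<^bsub>G\<^esub> inv\<^bsub>G\<^esub> y) = (h \<circ> ?b) x \<otimes>\<^bsub>P\<^esub> inv\<^bsub>P\<^esub> (h \<circ> ?b) y"
      using x y hom_mult[of x "inv\<^bsub>G\<^esub> y"] hom_inv[of y] rep.G.inv_closed[OF y] by metis
    also have "\<dots> = \<one>\<^bsub>P\<^esub>" unfolding eq using hom_closed[OF y] H.r_inv by blast
    finally have "x \<otimes>\<^bsub>G\<^esub> inv\<^bsub>G\<^esub> y = \<one>\<^bsub>G\<^esub>" using P(3) xy by (auto simp: F_def)
    then show "x = y" using x y by (metis rep.G.inv_equality rep.G.inv_inv rep.G.inv_closed)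
  qed
  then have "hnn_faithful G P (h \<circ> ?b) A \<phi> (h (hnn_stable G A \<phi>))"
    using AB(1) hnn_rep_axioms by (simp add: hnn_faithful_def hnn_faithful_axioms_def)
  then show ?thesis using P(1) by blast
qed

theorem theorem1:
  fixes p :: nat
    and G :: "('a, 'b) monoid_scheme"
    and A B :: "'a set"
    and \<phi> :: "'a \<Rightarrow> 'a"
  assumes "prime p"
    and "finite_p_group p G"
    and "subgroup A G"
    and "subgroup B G"
    and "\<phi> \<in> iso (G\<lparr>carrier := A\<rparr>) (G\<lparr>carrier := B\<rparr>)"
  shows "residually_finite_p_group p (hnn_extension G A \<phi>) \<longleftrightarrow>
    (\<exists>n S. chief_series G n S \<and>
       (\<forall>i\<le>n. \<phi> ` (A \<inter> S i) = B \<inter> S i) \<and>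
       (\<forall>i<n. \<forall>a\<in>A \<inter> S (Suc i). \<phi> a <#\<^bsub>G\<^esub> S i = a <#\<^bsub>G\<^esub> S i))"
proof
  have \<phi>: "inj_on \<phi> A" "\<phi> ` A = B"
    "\<And>a b. a \<in> A \<Longrightarrow> b \<in> A \<Longrightarrow> \<phi> (a \<otimes>\<^bsub>G\<^esub> b) = \<phi> a \<otimes>\<^bsub>G\<^esub> \<phi> b"
    using assms(5) by (auto simp: iso_def hom_def bij_betw_def)
  {
    assume "residually_finite_p_group p (hnn_extension G A \<phi>)"
    moreover have "group G" "finite (carrier G)" using assms(2) by (auto simp: finite_p_group_def)
    ultimately obtain P :: "nat monoid" and f t where "finite_p_group p P" "hnn_faithful G P f A \<phi> t"
      using residually_finite_p_group_hnn_faithful[OF _ _ assms(3-5)] by blast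
    from hnn_faithful_chief_series[OF assms(1) this]
    show "\<exists>n S. chief_series G n S \<and>
       (\<forall>i\<le>n. \<phi> ` (A \<inter> S i) = B \<inter> S i) \<and>
       (\<forall>i<n. \<forall>a\<in>A \<inter> S (Suc i). \<phi> a <#\<^bsub>G\<^esub> S i = a <#\<^bsub>G\<^esub> S i)"
      by (simp only: \<phi>(2))
  }
  assume "\<exists>n S. chief_series G n S \<and>
       (\<forall>i\<le>n. \<phi> ` (A \<inter> S i) = B \<inter> S i) \<and>
       (\<forall>i<n. \<forall>a\<in>A \<inter> S (Suc i). \<phi> a <#\<^bsub>G\<^esub> S i = a <#\<^bsub>G\<^esub> S i)"
  then obtain n S where chief: "chief_series G n S"
    and compat: "\<forall>i\<le>n. \<phi> ` (A \<inter> S i) = B \<inter> S i"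
    and cong: "\<forall>i<n. \<forall>a\<in>A \<inter> S (Suc i). \<phi> a <#\<^bsub>G\<^esub> S i = a <#\<^bsub>G\<^esub> S i"
    by (elim exE conjE) (rule that)
  interpret central_p_series G p n S by (rule central_p_series_chief[OF assms(1,2) chief])
  have "compatible_series G p n S A \<phi>"
  proof (intro compatible_series.intro central_p_series_axioms compatible_series_axioms.intro assms(3) \<phi>(3))
    show \<phi>_closed: "\<phi> a \<in> carrier G" if "a \<in> A" for a
      using that \<phi>(2) subgroup.subset[OF assms(4)] by blast
    show "a \<in> S i" if "i \<le> n" "a \<in> A" "\<phi> a \<in> S i" for i a
    proof -
      \<comment> \<open>By (1) \<open>\<phi> a\<close> is the image of some element of
        \<open>A \<inter> S i\<close>, and injectivity identifies that element with
        \<open>a\<close>.\<close>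
      have "\<phi> a \<in> \<phi> ` (A \<inter> S i)" using compat that \<phi>(2) by blast
      then show ?thesis using \<phi>(1) that(2) by (auto dest: inj_onD)
    qed
    show "S i #>\<^bsub>G\<^esub> \<phi> a = S i #>\<^bsub>G\<^esub> a" if i: "i < n" and a: "a \<in> A" "a \<in> S (Suc i)" for i a
    proof -
      have i': "i \<le> n" using i by simp
      interpret N: normal "S i" G by (rule S_normal[OF i'])
      \<comment> \<open>Condition (2) is stated with left cosets and
        \<open>compatible_series\<close> uses right ones; they agree because \<open>S i\<close> is
        normal.\<close>
      show ?thesis
        using cong[rule_format, OF i IntI[OF a]] N.lcos_eq_rcos[OF \<phi>_closed[OF a(1)]]
          N.lcos_eq_rcos[OF subgroup.mem_carrier[OF assms(3) a(1)]] by simp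
    qed
  qed
  then show "residually_finite_p_group p (hnn_extension G A \<phi>)"
    by (rule compatible_series.residually_finite_p_group_hnn_extension)
qed

end
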